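(* The following problem is NP-hard: given a graph $G$, a total order $\prec$ of its vertices, and an integer $k$, decide whether the edges of $G$ can be partitioned into at most $k$ sets, each of which is a stack or a queue with respect to $\prec$ (i.e., determining the mixed page number of $G$ respecting the fixed vertex order $\prec$ is NP-hard).
   Context: Given a total vertex order $\prec$, two edges $(u_1,v_1)$, $(u_2,v_2)$ with four distinct endpoints and $u_1\prec v_1$, $u_2 \prec v_2$, $u_1 \prec u_2$ are said to cross if $u_1 \prec u_2 \prec v_1 \prec v_2$, and to nest if $u_1 \prec u_2 \prec v_2 \prec v_1$. A stack is a set of edges no two of which cross; a queue is a set of edges no two of which nest. The mixed page number of $G$ respecting $\prec$ is the minimum $s+q$ such that the edges of $G$ can be partitioned into $s$ stacks and $q$ queues with respect to $\prec$. *)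

theory Defs
  imports
    "HOL-Library.Disjoint_Sets"
    "HOL-Computational_Algebra.Polynomial"
begin

section \<open>Stacks, queues and the mixed page number\<close>

definition simple_graph :: "'a set \<Rightarrow> 'a set set \<Rightarrow> bool" where
  "simple_graph V E \<longleftrightarrow> finite V \<and> (\<forall>e\<in>E. e \<subseteq> V \<and> card e = 2)"

definition vertex_order :: "'a set \<Rightarrow> ('a \<times> 'a) set \<Rightarrow> bool" where
  "vertex_order V r \<longleftrightarrow> r \<subseteq> V \<times> V \<and> strict_linear_order_on V r"

text \<open>
  For a strict order \<open>r\<close> the chains below force the four endpoints to be distinct.
  Both relations are directed (the first edge is the one with the smaller left endpoint);
  \<open>is_stack\<close> and \<open>is_queue\<close> range over all ordered pairs of edges.
\<close>

definition crosses :: "('a \<times> 'a) set \<Rightarrow> 'a set \<Rightarrow> 'a set \<Rightarrow> bool" where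
  "crosses r e f \<longleftrightarrow> (\<exists>u1 v1 u2 v2. e = {u1, v1} \<and> f = {u2, v2} \<and>
     (u1, u2) \<in> r \<and> (u2, v1) \<in> r \<and> (v1, v2) \<in> r)"

definition nests :: "('a \<times> 'a) set \<Rightarrow> 'a set \<Rightarrow> 'a set \<Rightarrow> bool" where
  "nests r e f \<longleftrightarrow> (\<exists>u1 v1 u2 v2. e = {u1, v1} \<and> f = {u2, v2} \<and>
     (u1, u2) \<in> r \<and> (u2, v2) \<in> r \<and> (v2, v1) \<in> r)"

definition is_stack :: "('a \<times> 'a) set \<Rightarrow> 'a set set \<Rightarrow> bool" where
  "is_stack r S \<longleftrightarrow> (\<forall>e\<in>S. \<forall>f\<in>S. \<not> crosses r e f)"

definition is_queue :: "('a \<times> 'a) set \<Rightarrow> 'a set set \<Rightarrow> bool" where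
  "is_queue r S \<longleftrightarrow> (\<forall>e\<in>S. \<forall>f\<in>S. \<not> nests r e f)"

definition mixed_partitionable :: "('a \<times> 'a) set \<Rightarrow> 'a set set \<Rightarrow> nat \<Rightarrow> bool" where
  "mixed_partitionable r E k \<longleftrightarrow>
     (\<exists>P. partition_on E P \<and> card P \<le> k \<and> (\<forall>S\<in>P. is_stack r S \<or> is_queue r S))"

definition stack_queue_partition ::
    "('a \<times> 'a) set \<Rightarrow> 'a set set \<Rightarrow> 'a set set set \<Rightarrow> 'a set set set \<Rightarrow> bool" where
  "stack_queue_partition r E SS QQ \<longleftrightarrow> partition_on E (SS \<union> QQ) \<and> SS \<inter> QQ = {} \<and>
     (\<forall>S\<in>SS. is_stack r S) \<and> (\<forall>Q\<in>QQ. is_queue r Q)"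

definition mixed_page_number :: "('a \<times> 'a) set \<Rightarrow> 'a set set \<Rightarrow> nat" where
  "mixed_page_number r E =
     (LEAST m. \<exists>s q SS QQ. m = s + q \<and> stack_queue_partition r E SS QQ \<and>
        card SS = s \<and> card QQ = q)"

lemma mixed_page_number_le_iff:
  assumes G: "simple_graph V E" and ord: "vertex_order V r"
  shows "mixed_page_number r E \<le> k \<longleftrightarrow> mixed_partitionable r E k"
proof -
  have fin: "finite E"
    using G unfolding simple_graph_def by (auto intro: finite_subset[of E "Pow V"])
  define A where "A m \<longleftrightarrow> (\<exists>s q SS QQ. m = s + q \<and> stack_queue_partition r E SS QQ \<and>
        card SS = s \<and> card QQ = q)" for m
  define B where "B m \<longleftrightarrow> (\<exists>P. partition_on E P \<and> card P = m \<and>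
        (\<forall>S\<in>P. is_stack r S \<or> is_queue r S))" for m
  have AB: "A m \<longleftrightarrow> B m" for m
  proof
    assume "A m"
    then obtain SS QQ where *: "m = card SS + card QQ" "stack_queue_partition r E SS QQ"
      unfolding A_def by blast
    then have "finite (SS \<union> QQ)"
      using finite_elements[OF fin] unfolding stack_queue_partition_def by blast
    then have "card (SS \<union> QQ) = m"
      using * by (simp add: card_Un_disjoint stack_queue_partition_def)
    then show "B m"
      using *(2) unfolding B_def stack_queue_partition_def by blast
  next
    assume "B m"
    then obtain P where P: "partition_on E P" "card P = m"
        "\<forall>S\<in>P. is_stack r S \<or> is_queue r S"
      unfolding B_def by blast
    define SS where "SS = {S \<in> P. is_stack r S}"
    define QQ where "QQ = {S \<in> P. \<not> is_stack r S}"
    have U: "SS \<union> QQ = P" "SS \<inter> QQ = {}"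
      unfolding SS_def QQ_def by auto
    have "finite P" using finite_elements[OF fin P(1)] .
    then have "card SS + card QQ = m"
      using U P(2) by (metis card_Un_disjoint finite_Un)
    moreover have "stack_queue_partition r E SS QQ"
      unfolding stack_queue_partition_def U(1)
    proof (intro conjI)
      show "partition_on E P" by fact
      show "SS \<inter> QQ = {}" by fact
      show "\<forall>S\<in>SS. is_stack r S" by (simp add: SS_def)
      show "\<forall>Q\<in>QQ. is_queue r Q" using P(3) by (auto simp: QQ_def)
    qed
    ultimately show "A m" unfolding A_def by blast
  qed
  have "\<not> crosses r e e" for e
  proof
    have tr: "trans r" and irr: "\<And>a. (a, a) \<notin> r"
      using ord by (auto simp: vertex_order_def strict_linear_order_on_def irrefl_def)
    assume "crosses r e e"
    then obtain u1 v1 u2 v2 where e: "{u1, v1} = {u2, v2}"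
        and lt: "(u1, u2) \<in> r" "(u2, v1) \<in> r" "(v1, v2) \<in> r"
      unfolding crosses_def by metis
    have "(u1, v2) \<in> r"
      using lt tr by (meson transD)
    then show False
      using e lt irr by (auto simp: doubleton_eq_iff)
  qed
  then have "is_stack r {e}" for e
    by (simp add: is_stack_def)
  moreover have "partition_on E ((\<lambda>e. {e}) ` E)"
    by (auto simp: partition_on_def disjoint_def)
  ultimately have "\<exists>m. B m"
    unfolding B_def by blast
  then have "B (LEAST m. B m)"
    by (rule LeastI_ex)
  moreover have "mixed_page_number r E = (LEAST m. B m)"
    unfolding mixed_page_number_def A_def[symmetric] AB ..
  moreover have "(LEAST m. B m) \<le> m" if "B m" for m
    using that by (rule Least_le)
  moreover have "mixed_partitionable r E k \<longleftrightarrow> (\<exists>m. B m \<and> m \<le> k)"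
    unfolding mixed_partitionable_def B_def by auto
  ultimately show ?thesis
    by (metis le_trans)
qed

section \<open>Polynomial time, NP and NP-hardness\<close>

text \<open>
  Deterministic multi-tape Turing machines with two-way infinite tapes. States are
  \<open>0, \<dots>, tm_states M\<close>, where \<open>0\<close> is the start state and \<open>tm_states M\<close> the halting state.
  Tape symbols are \<open>0, \<dots>, tm_symbols M - 1\<close>, where \<open>0\<close> is the blank and \<open>1\<close>, \<open>2\<close> are the
  input symbols for the bits. The transition function maps a state and the symbols under
  the heads to the new state and, for each tape, the symbol to be written and the head move.
\<close>

datatype move = Move_Left | Move_Stay | Move_Right

record tm =
  tm_tapes :: nat
  tm_symbols :: nat
  tm_states :: nat
  tm_delta :: "nat \<Rightarrow> nat list \<Rightarrow> nat \<times> (nat \<times> move) list"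

definition wf_tm :: "tm \<Rightarrow> bool" where
  "wf_tm M \<longleftrightarrow> tm_tapes M \<ge> 1 \<and> tm_symbols M \<ge> 3 \<and>
     (\<forall>q < tm_states M. \<forall>as. length as = tm_tapes M \<and> (\<forall>a \<in> set as. a < tm_symbols M) \<longrightarrow>
        (case tm_delta M q as of (q', acts) \<Rightarrow>
           q' \<le> tm_states M \<and> length acts = tm_tapes M \<and>
           (\<forall>(a, d) \<in> set acts. a < tm_symbols M)))"

type_synonym tape = "(int \<Rightarrow> nat) \<times> int"
type_synonym config = "nat \<times> tape list"

fun head_move :: "move \<Rightarrow> int \<Rightarrow> int" where
  "head_move Move_Left i = i - 1"
| "head_move Move_Stay i = i"
| "head_move Move_Right i = i + 1"

definition tape_act :: "nat \<times> move \<Rightarrow> tape \<Rightarrow> tape" where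
  "tape_act = (\<lambda>(a, d) (c, i). (c(i := a), head_move d i))"

definition tm_step :: "tm \<Rightarrow> config \<Rightarrow> config" where
  "tm_step M = (\<lambda>(q, ts).
     if q < tm_states M
     then (case tm_delta M q (map (\<lambda>(c, i). c i) ts) of
             (q', acts) \<Rightarrow> (q', map2 tape_act acts ts))
     else (q, ts))"

definition contents :: "bool list \<Rightarrow> int \<Rightarrow> nat" where
  "contents x i = (if 0 \<le> i \<and> i < int (length x) then (if x ! nat i then 2 else 1) else 0)"

definition tm_init :: "tm \<Rightarrow> bool list list \<Rightarrow> config" where
  "tm_init M xs =
     (0, map (\<lambda>j. (contents (if j < length xs then xs ! j else []), 0)) [0..<tm_tapes M])"

text \<open>
  The arguments are written on the first tapes and the result is left on the first tape.
  A halted configuration is a fixed point of \<open>tm_step\<close>, so halting within \<open>t\<close> steps amounts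
  to being halted after exactly \<open>t\<close> steps.
\<close>

definition tm_computes :: "tm \<Rightarrow> bool list list \<Rightarrow> bool list \<Rightarrow> nat \<Rightarrow> bool" where
  "tm_computes M xs y t \<longleftrightarrow>
     (case (tm_step M ^^ t) (tm_init M xs) of
        (q, ts) \<Rightarrow> q = tm_states M \<and> fst (ts ! 0) = contents y)"

definition polytime :: "nat \<Rightarrow> (bool list list \<Rightarrow> bool list) \<Rightarrow> bool" where
  "polytime n f \<longleftrightarrow> (\<exists>M (p :: nat poly). wf_tm M \<and> n \<le> tm_tapes M \<and>
     (\<forall>xs. length xs = n \<longrightarrow> tm_computes M xs (f xs) (poly p (sum_list (map length xs)))))"

definition NP :: "bool list set set" where
  "NP = {L. \<exists>R (p :: nat poly). polytime 2 (\<lambda>xs. [R (xs ! 0) (xs ! 1)]) \<and>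
     (\<forall>x. x \<in> L \<longleftrightarrow> (\<exists>u. length u \<le> poly p (length x) \<and> R x u))}"

definition polytime_reducible :: "bool list set \<Rightarrow> bool list set \<Rightarrow> bool" where
  "polytime_reducible A B \<longleftrightarrow>
     (\<exists>f. polytime 1 (\<lambda>xs. f (xs ! 0)) \<and> (\<forall>x. x \<in> A \<longleftrightarrow> f x \<in> B))"

definition NP_hard :: "bool list set \<Rightarrow> bool" where
  "NP_hard L \<longleftrightarrow> (\<forall>A \<in> NP. polytime_reducible A L)"

section \<open>The decision problem\<close>

text \<open>
  Numbers are written in binary, least significant bit first. The flag bits make
  all encodings prefix-free.
\<close>

fun bits :: "nat \<Rightarrow> bool list" where
  "bits n = (if n = 0 then [] else odd n # bits (n div 2))"

declare bits.simps [simp del]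

definition enc_list :: "('a \<Rightarrow> bool list) \<Rightarrow> 'a list \<Rightarrow> bool list" where
  "enc_list enc xs = concat (map (\<lambda>x. True # enc x) xs) @ [False]"

definition enc_nat :: "nat \<Rightarrow> bool list" where
  "enc_nat n = enc_list (\<lambda>b. [b]) (bits n)"

definition enc_pair :: "nat \<times> nat \<Rightarrow> bool list" where
  "enc_pair = (\<lambda>(u, v). enc_nat u @ enc_nat v)"

definition enc_instance :: "nat list \<Rightarrow> (nat \<times> nat) list \<Rightarrow> nat \<Rightarrow> bool list" where
  "enc_instance vs es k = enc_list enc_nat vs @ enc_list enc_pair es @ enc_nat k"

text \<open>
  The vertices are listed in increasing order, which determines both the vertex set and the
  order; the edges are listed without repetition, in any order and with either orientation.
\<close>

definition lists_instance ::
    "nat list \<Rightarrow> (nat \<times> nat) list \<Rightarrow> nat set \<Rightarrow> nat set set \<Rightarrow> (nat \<times> nat) set \<Rightarrow> bool" where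
  "lists_instance vs es V E r \<longleftrightarrow>
     set vs = V \<and> sorted_wrt (\<lambda>u v. (u, v) \<in> r) vs \<and>
     set (map (\<lambda>(u, v). {u, v}) es) = E \<and> distinct (map (\<lambda>(u, v). {u, v}) es)"

definition mixed_page_problem :: "bool list set" where
  "mixed_page_problem = {enc_instance vs es k | vs es k. \<exists>V E r.
     simple_graph V E \<and> vertex_order V r \<and> lists_instance vs es V E r \<and>
     mixed_partitionable r E k}"

lemma enc_list_prefix_free:
  assumes "\<And>x y s t. enc x @ s = enc y @ t \<Longrightarrow> x = y \<and> s = t"
  shows "enc_list enc xs @ s = enc_list enc ys @ t \<Longrightarrow> xs = ys \<and> s = t"
proof (induction xs arbitrary: ys)
  case Nil
  then show ?case by (cases ys) (auto simp: enc_list_def)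
next
  case (Cons x xs)
  then obtain y ys' where ys: "ys = y # ys'"
    by (cases ys) (auto simp: enc_list_def)
  have "enc x @ (enc_list enc xs @ s) = enc y @ (enc_list enc ys' @ t)"
    using Cons.prems by (simp add: ys enc_list_def)
  then have "x = y \<and> enc_list enc xs @ s = enc_list enc ys' @ t"
    by (rule assms)
  then show ?case using Cons.IH ys by blast
qed

lemma bits_inject: "bits m = bits n \<Longrightarrow> m = n"
proof (induction m arbitrary: n rule: bits.induct)
  case (1 m)
  show ?case
  proof (cases "m = 0 \<or> n = 0")
    case True
    then show ?thesis using "1.prems" bits.simps[of m] bits.simps[of n] by (auto split: if_splits)
  next
    case False
    then have "odd m = odd n" "bits (m div 2) = bits (n div 2)"
      using "1.prems" bits.simps[of m] bits.simps[of n] by auto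
    moreover from this(2) have "m div 2 = n div 2"
      using "1.IH" False by blast
    ultimately show ?thesis
      by (metis odd_two_times_div_two_succ dvd_mult_div_cancel)
  qed
qed

lemma enc_nat_prefix_free: "enc_nat m @ s = enc_nat n @ t \<Longrightarrow> m = n \<and> s = t"
  unfolding enc_nat_def using enc_list_prefix_free[of "\<lambda>b. [b]" "bits m" s "bits n" t] bits_inject
  by auto

lemma enc_pair_prefix_free: "enc_pair x @ s = enc_pair y @ t \<Longrightarrow> x = y \<and> s = t"
  unfolding enc_pair_def by (cases x; cases y) (auto dest!: enc_nat_prefix_free)

lemma enc_instance_inject:
  "enc_instance vs es k = enc_instance vs' es' k' \<Longrightarrow> vs = vs' \<and> es = es' \<and> k = k'"
  unfolding enc_instance_def
  by (metis append_Nil2 enc_list_prefix_free enc_nat_prefix_free enc_pair_prefix_free)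

lemma mixed_page_problem_iff:
  assumes "simple_graph V E" "vertex_order V r" "lists_instance vs es V E r"
  shows "enc_instance vs es k \<in> mixed_page_problem \<longleftrightarrow> mixed_page_number r E \<le> k"
proof -
  have r: "r = {(vs ! i, vs ! j) | i j. i < j \<and> j < length vs}"
    if "vertex_order V r" "lists_instance vs es V E r" for V E r
  proof -
    have "(vs ! i, vs ! j) \<in> r" if "i < j" "j < length vs" for i j
      using that \<open>lists_instance vs es V E r\<close> by (auto simp: lists_instance_def sorted_wrt_iff_nth_less)
    note sorted = this
    have "\<exists>i j. u = vs ! i \<and> v = vs ! j \<and> i < j \<and> j < length vs" if uv: "(u, v) \<in> r" for u v
    proof -
      have tr: "trans r" "\<And>a. (a, a) \<notin> r" and sub: "u \<in> set vs" "v \<in> set vs"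
        using that \<open>vertex_order V r\<close> \<open>lists_instance vs es V E r\<close>
        by (auto simp: vertex_order_def strict_linear_order_on_def irrefl_def lists_instance_def)
      obtain i j where ij: "u = vs ! i" "v = vs ! j" "i < length vs" "j < length vs"
        using sub by (metis in_set_conv_nth)
      have "\<not> j < i" "i \<noteq> j"
        using sorted[of j i] uv ij tr by (metis transE)+
      then have "i < j" by simp
      then show ?thesis using ij by blast
    qed
    then show ?thesis using sorted by auto
  qed
  have "enc_instance vs es k \<in> mixed_page_problem \<longleftrightarrow> mixed_partitionable r E k"
  proof
    assume "enc_instance vs es k \<in> mixed_page_problem"
    then obtain V' E' r' where *: "vertex_order V' r'" "lists_instance vs es V' E' r'"
        "mixed_partitionable r' E' k"
      unfolding mixed_page_problem_def by (auto dest!: enc_instance_inject)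
    then have "r' = r" "E' = E"
      using r[of V' r' E'] r[of V r E] assms by (auto simp: lists_instance_def)
    then show "mixed_partitionable r E k" using * by simp
  next
    assume "mixed_partitionable r E k"
    then show "enc_instance vs es k \<in> mixed_page_problem"
      unfolding mixed_page_problem_def using assms by blast
  qed
  then show ?thesis
    using mixed_page_number_le_iff[OF assms(1,2)] by simp
qed

end

theory Submission
  imports Defs
begin

text \<open>
  The reduction starts from an arbitrary verifier. The accepting computations of a verifier on
  input \<open>x\<close> are described, as in the Cook--Levin theorem, by Horn clauses (apart from the guessed
  certificate) saying which symbol stands at which distance from each head. Giving every
  literal a variable of its own makes each clause either all positive or all negative.

  A set of edges with \<open>s\<close> stacks and \<open>q\<close> queues is regarded as a colouring: at most \<open>s\<close> pairwise
  crossing edges lie on stacks, and at most \<open>q\<close> pairwise nesting edges on queues. Every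
  occurrence of a variable in a clause becomes an edge from the variable's segment to the clause's
  segment, put on a queue if it makes the clause true. The edges ending at a clause cross each
  other and so many columns of nested edges that one of them must be on a queue; a negative
  occurrence of a variable nests each positive one and, together with \<open>q - 1\<close> columns of
  crossing edges, they cannot both be on queues. A column of more than \<open>s + q\<close> nested
  (crossing) edges always has an edge on a stack (a queue), which also pins down \<open>s\<close> and \<open>q\<close>.

  The instance is printed by nested bounded loops. Since the vertices are consecutive numbers
  \<open>i\<close> named \<open>2 ^ i\<close>, all that is needed is to print numbers in unary whose value is a
  polynomial in the loop indices. Such programs are compiled to counter machines, and these to
  Turing machines whose head positions are the counters.
\<close>

section \<open>Counter programs on Turing machines\<close>

text \<open>The reduction has to be carried out by an explicit Turing machine, so every number in
  the instance must be a polynomial in loop indices, with neither subtraction nor search. This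
  shapes the combinatorics. An endpoint is a key of five digits, ordered lexicographically; read in
  a large radix it becomes such a polynomial, and the positions that end no edge stay as isolated
  vertices. Since symbols are addressed by their distance from a head, no atoms for head positions
  are needed and the width of the clauses depends on the machine alone. Splitting the literals into
  variables of their own pays off in the page assignment. Wires of one variable and one sign cross
  pairwise, so a single queue takes them all. Clauses are numbered with the negative ones last, so
  that wires of opposite sign nest. Wires that do not satisfy their clause may cross or nest in any
  way; each gets a stack of its own, and this is what dictates the number of stacks and hence of
  fillers.\<close>

datatype test = NZ nat | In_Nonblank | In_One

datatype com =
    Inc nat
  | Dec nat
  | Emit bool
  | In_Right
  | In_Left
  | Seq com com
  | While test com
  | If test com com

type_synonym state = "(nat \<Rightarrow> nat) \<times> bool list \<times> int"

fun holds :: "bool list \<Rightarrow> test \<Rightarrow> state \<Rightarrow> bool" where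
  "holds x (NZ r) (\<rho>, out, i) \<longleftrightarrow> \<rho> r \<noteq> 0"
| "holds x In_Nonblank (\<rho>, out, i) \<longleftrightarrow> contents x i \<noteq> 0"
| "holds x In_One (\<rho>, out, i) \<longleftrightarrow> contents x i = 2"

text \<open>\<open>Dec\<close> on a zero counter has no rule: the head would pass to the left of the
  marker and no longer encode a number. The step count charges one machine step for every elementary
  command and every test.\<close>

inductive big :: "bool list \<Rightarrow> com \<Rightarrow> state \<Rightarrow> nat \<Rightarrow> state \<Rightarrow> bool" for x where
  Inc: "big x (Inc r) (\<rho>, out, i) 1 (\<rho>(r := Suc (\<rho> r)), out, i)"
| Dec: "\<rho> r \<noteq> 0 \<Longrightarrow> big x (Dec r) (\<rho>, out, i) 1 (\<rho>(r := \<rho> r - 1), out, i)"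
| Emit: "big x (Emit b) (\<rho>, out, i) 1 (\<rho>, out @ [b], i)"
| In_Right: "big x In_Right (\<rho>, out, i) 1 (\<rho>, out, i + 1)"
| In_Left: "big x In_Left (\<rho>, out, i) 1 (\<rho>, out, i - 1)"
| Seq: "big x c s t s' \<Longrightarrow> big x d s' t' s'' \<Longrightarrow> big x (Seq c d) s (t + t') s''"
| While_False: "\<not> holds x b s \<Longrightarrow> big x (While b c) s 1 s"
| While_True: "holds x b s \<Longrightarrow> big x c s t s' \<Longrightarrow> big x (While b c) s' t' s'' \<Longrightarrow>
    big x (While b c) s (1 + t + t') s''"
| If_True: "holds x b s \<Longrightarrow> big x c s t s' \<Longrightarrow> big x (If b c d) s (1 + t) s'"
| If_False: "\<not> holds x b s \<Longrightarrow> big x d s t s' \<Longrightarrow> big x (If b c d) s (1 + t) s'"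

fun size_com :: "com \<Rightarrow> nat" where
  "size_com (Seq c d) = size_com c + size_com d"
| "size_com (While b c) = 1 + size_com c"
| "size_com (If b c d) = 1 + size_com c + size_com d"
| "size_com _ = 1"

fun regs_test :: "test \<Rightarrow> nat" where
  "regs_test (NZ r) = Suc r"
| "regs_test _ = 0"

fun regs_com :: "com \<Rightarrow> nat" where
  "regs_com (Inc r) = Suc r"
| "regs_com (Dec r) = Suc r"
| "regs_com (Seq c d) = max (regs_com c) (regs_com d)"
| "regs_com (While b c) = max (regs_test b) (regs_com c)"
| "regs_com (If b c d) = max (regs_test b) (max (regs_com c) (regs_com d))"
| "regs_com _ = 0"

text \<open>
  Tape \<open>0\<close> carries the output, tape \<open>1\<close> the input, and tape \<open>r + 2\<close> the counter \<open>r\<close>: its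
  only non-blank cell is cell \<open>0\<close>, and the value of the counter is the position of the head.
\<close>

fun test_sym :: "test \<Rightarrow> nat list \<Rightarrow> bool" where
  "test_sym (NZ r) as \<longleftrightarrow> as ! (r + 2) \<noteq> 3"
| "test_sym In_Nonblank as \<longleftrightarrow> as ! 1 \<noteq> 0"
| "test_sym In_One as \<longleftrightarrow> as ! 1 = 2"

definition stay :: "nat list \<Rightarrow> (nat \<times> move) list" where
  "stay as = map (\<lambda>a. (a, Move_Stay)) as"

definition move_tape :: "nat list \<Rightarrow> nat \<Rightarrow> move \<Rightarrow> (nat \<times> move) list" where
  "move_tape as j d = (stay as)[j := (as ! j, d)]"

text \<open>\<open>off\<close> is the first control state of the fragment and \<open>ex\<close> the
  state to which it leaves. The body of a loop gets the state of the test as its exit, so no jump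
  instruction is needed.\<close>

fun code :: "com \<Rightarrow> nat \<Rightarrow> nat \<Rightarrow> nat \<Rightarrow> nat list \<Rightarrow> nat \<times> (nat \<times> move) list" where
  "code (Inc r) off ex q as = (ex, move_tape as (r + 2) Move_Right)"
| "code (Dec r) off ex q as = (ex, move_tape as (r + 2) Move_Left)"
| "code (Emit b) off ex q as = (ex, (stay as)[0 := (if b then 2 else 1, Move_Right)])"
| "code In_Right off ex q as = (ex, move_tape as 1 Move_Right)"
| "code In_Left off ex q as = (ex, move_tape as 1 Move_Left)"
| "code (Seq c d) off ex q as =
     (if q < off + size_com c then code c off (off + size_com c) q as
      else code d (off + size_com c) ex q as)"
| "code (While b c) off ex q as =
     (if q = off then (if test_sym b as then off + 1 else ex, stay as)
      else code c (off + 1) off q as)"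
| "code (If b c d) off ex q as =
     (if q = off then (if test_sym b as then off + 1 else off + 1 + size_com c, stay as)
      else if q < off + 1 + size_com c then code c (off + 1) ex q as
      else code d (off + 1 + size_com c) ex q as)"

lemma size_com_pos: "0 < size_com c"
  by (induction c) auto

definition marker :: "int \<Rightarrow> nat" where
  "marker i = (if i = 0 then 3 else 0)"

fun tapes :: "nat \<Rightarrow> bool list \<Rightarrow> state \<Rightarrow> tape list" where
  "tapes R x (\<rho>, out, i) =
     [(contents out, int (length out)), (contents x, i)] @
     map (\<lambda>r. (marker, int (\<rho> r))) [0..<R]"

definition scan :: "tape list \<Rightarrow> nat list" where
  "scan ts = map (\<lambda>(c, i). c i) ts"

lemma length_tapes [simp]: "length (tapes R x s) = R + 2"
  by (cases s) auto

lemma length_scan [simp]: "length (scan ts) = length ts"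
  by (simp add: scan_def)

lemma length_stay [simp]: "length (stay as) = length as"
  by (simp add: stay_def)

lemma nth_stay [simp]: "j < length as \<Longrightarrow> stay as ! j = (as ! j, Move_Stay)"
  by (simp add: stay_def)

lemma nth_scan [simp]: "j < length ts \<Longrightarrow> scan ts ! j = (case ts ! j of (c, i) \<Rightarrow> c i)"
  by (simp add: scan_def)

lemma nth_tapes:
  "tapes R x (\<rho>, out, i) ! 0 = (contents out, int (length out))"
  "tapes R x (\<rho>, out, i) ! Suc 0 = (contents x, i)"
  "r < R \<Longrightarrow> tapes R x (\<rho>, out, i) ! Suc (Suc r) = (marker, int (\<rho> r))"
  by simp_all

lemma test_sym_iff_holds:
  "regs_test b \<le> R \<Longrightarrow> test_sym b (scan (tapes R x s)) = holds x b s"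
  by (cases s; cases b) (auto simp: nth_tapes marker_def simp del: tapes.simps)

lemma tape_act_simp [simp]: "tape_act (a, d) (c, i) = (c(i := a), head_move d i)"
  by (simp add: tape_act_def)

lemma map2_tape_act_stay: "map2 tape_act (stay (scan ts)) ts = ts"
  by (rule nth_equalityI) (auto split: prod.splits)

lemma map2_tape_act_update:
  assumes "j < length ts"
  shows "map2 tape_act ((stay (scan ts))[j := a]) ts = ts[j := tape_act a (ts ! j)]"
  using assms
  by (intro nth_equalityI) (auto simp: nth_list_update split: prod.splits)

lemma tapes_update:
  "(tapes R x (\<rho>, out, i))[0 := (contents out', int (length out'))] = tapes R x (\<rho>, out', i)"
  "(tapes R x (\<rho>, out, i))[Suc 0 := (contents x, i')] = tapes R x (\<rho>, out, i')"
  "r < R \<Longrightarrow> (tapes R x (\<rho>, out, i))[Suc (Suc r) := (marker, int n)] = tapes R x (\<rho>(r := n), out, i)"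
  by (auto intro!: nth_equalityI simp: nth_list_update)

lemma contents_snoc: "(contents out)(int (length out) := if b then 2 else 1) = contents (out @ [b])"
  by (rule ext) (auto simp: contents_def nth_append)

lemma tm_step_code:
  assumes "q < tm_states M"
  shows "tm_step M (q, ts) = (fst (tm_delta M q (scan ts)),
    map2 tape_act (snd (tm_delta M q (scan ts))) ts)"
  using assms by (simp add: tm_step_def scan_def case_prod_unfold)

lemma funpow_one: "((f :: 'a \<Rightarrow> 'a) ^^ (1 :: nat)) = f"
  by (rule ext) simp

text \<open>The transition function is only constrained on the states of the fragment, and
  \<open>off\<close> and \<open>ex\<close> stay arbitrary in the induction; subprograms therefore
  embed at their own offsets and with their own exits.\<close>

lemma big_imp_tm_steps:
  assumes "big x c s t s'"
    and "\<And>q as. off \<le> q \<Longrightarrow> q < off + size_com c \<Longrightarrow> tm_delta M q as = code c off ex q as"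
    and "off + size_com c \<le> tm_states M" and "regs_com c \<le> R"
  shows "(tm_step M ^^ t) (off, tapes R x s) = (ex, tapes R x s')"
  using assms
proof (induction arbitrary: off ex rule: big.induct)
  case (Inc r \<rho> out i)
  then have "tm_step M (off, tapes R x (\<rho>, out, i)) = (ex, (tapes R x (\<rho>, out, i))
      [Suc (Suc r) := (marker, int (Suc (\<rho> r)))])"
    by (simp add: tm_step_code size_com_pos move_tape_def map2_tape_act_update nth_tapes
        add.commute[of 1] del: tapes.simps)
  then show ?case using Inc.prems by (simp add: tapes_update del: tapes.simps of_nat_Suc)
next
  case (Dec \<rho> r out i)
  have "int (\<rho> r) - 1 = int (\<rho> r - 1)" using Dec.hyps by simp
  then have "tm_step M (off, tapes R x (\<rho>, out, i)) = (ex, (tapes R x (\<rho>, out, i))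
      [Suc (Suc r) := (marker, int (\<rho> r - 1))])"
    using Dec.prems
    by (simp add: tm_step_code size_com_pos move_tape_def map2_tape_act_update nth_tapes
        del: tapes.simps of_nat_diff)
  then show ?case using Dec.prems by (simp add: tapes_update del: tapes.simps)
next
  case (Emit b \<rho> out i)
  then have "tm_step M (off, tapes R x (\<rho>, out, i)) = (ex, (tapes R x (\<rho>, out, i))
      [0 := (contents (out @ [b]), int (length (out @ [b])))])"
    by (simp add: tm_step_code size_com_pos map2_tape_act_update nth_tapes contents_snoc[symmetric] add.commute[of 1]
        del: tapes.simps)
  then show ?case using Emit.prems by (simp only: tapes_update) simp
next
  case (In_Right \<rho> out i)
  then have "tm_step M (off, tapes R x (\<rho>, out, i)) = (ex, (tapes R x (\<rho>, out, i))
      [Suc 0 := (contents x, i + 1)])"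
    by (simp add: tm_step_code size_com_pos move_tape_def map2_tape_act_update nth_tapes del: tapes.simps)
  then show ?case by (simp add: tapes_update del: tapes.simps)
next
  case (In_Left \<rho> out i)
  then have "tm_step M (off, tapes R x (\<rho>, out, i)) = (ex, (tapes R x (\<rho>, out, i))
      [Suc 0 := (contents x, i - 1)])"
    by (simp add: tm_step_code size_com_pos move_tape_def map2_tape_act_update nth_tapes del: tapes.simps)
  then show ?case by (simp add: tapes_update del: tapes.simps)
next
  case (Seq c s t s' d t' s'')
  have "(tm_step M ^^ t) (off, tapes R x s) = (off + size_com c, tapes R x s')"
    using Seq.prems by (intro Seq.IH(1)) auto
  moreover have "(tm_step M ^^ t') (off + size_com c, tapes R x s') = (ex, tapes R x s'')"
    using Seq.prems by (intro Seq.IH(2)) auto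
  ultimately show ?case by (simp add: add.commute[of t] funpow_add)
next
  case (While_False b s c)
  then have "tm_step M (off, tapes R x s) = (ex, tapes R x s)"
    by (auto simp: tm_step_code size_com_pos test_sym_iff_holds map2_tape_act_stay)
  then show ?case by simp
next
  case (While_True b s c t s' t' s'')
  have "tm_step M (off, tapes R x s) = (off + 1, tapes R x s)"
    using While_True.hyps(1) While_True.prems
    by (auto simp: tm_step_code size_com_pos test_sym_iff_holds map2_tape_act_stay)
  moreover have "(tm_step M ^^ t) (off + 1, tapes R x s) = (off, tapes R x s')"
    using While_True.prems by (intro While_True.IH(1)) auto
  moreover have "(tm_step M ^^ t') (off, tapes R x s') = (ex, tapes R x s'')"
    using While_True.prems by (intro While_True.IH(2)) auto
  moreover have "1 + t + t' = t' + (t + 1)" by simp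
  ultimately show ?case by (simp only: funpow_add comp_apply funpow_one)
next
  case (If_True b s c t s' d)
  have "tm_step M (off, tapes R x s) = (off + 1, tapes R x s)"
    using If_True.hyps(1) If_True.prems
    by (auto simp: tm_step_code size_com_pos test_sym_iff_holds map2_tape_act_stay)
  moreover have "(tm_step M ^^ t) (off + 1, tapes R x s) = (ex, tapes R x s')"
    using If_True.prems by (intro If_True.IH) auto
  moreover have "1 + t = t + 1" by simp
  ultimately show ?case by (simp only: funpow_add comp_apply funpow_one)
next
  case (If_False b s d t s' c)
  have "tm_step M (off, tapes R x s) = (off + 1 + size_com c, tapes R x s)"
    using If_False.hyps(1) If_False.prems
    by (auto simp: tm_step_code size_com_pos test_sym_iff_holds map2_tape_act_stay)
  moreover have "(tm_step M ^^ t) (off + 1 + size_com c, tapes R x s) = (ex, tapes R x s')"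
    using If_False.prems by (intro If_False.IH) auto
  moreover have "1 + t = t + 1" by simp
  ultimately show ?case by (simp only: funpow_add comp_apply funpow_one)
qed

section \<open>Counter programs as polynomial-time machines\<close>

text \<open>Input and output share the first tape, and that tape must hold nothing but the output in
  the end. State \<open>0\<close> therefore moves the input to tape \<open>1\<close> while erasing
  it, state \<open>1\<close> rewinds both heads, and its last step puts the marker \<open>3\<close>
  on the counter tapes.\<close>

definition com_tm :: "com \<Rightarrow> tm" where
  "com_tm c = \<lparr>tm_tapes = regs_com c + 2, tm_symbols = 4, tm_states = 2 + size_com c,
     tm_delta = (\<lambda>q as.
       if q = 0 then
         if as ! 0 \<noteq> 0
         then (0, (stay as)[0 := (0, Move_Right), 1 := (as ! 0, Move_Right)])
         else (1, (stay as)[0 := (as ! 0, Move_Left), 1 := (as ! 1, Move_Left)])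
       else if q = 1 then
         if as ! 1 \<noteq> 0
         then (1, (stay as)[0 := (as ! 0, Move_Left), 1 := (as ! 1, Move_Left)])
         else (2, [(as ! 0, Move_Right), (as ! 1, Move_Right)] @
                  map (\<lambda>r. (3, Move_Stay)) [0..<regs_com c])
       else code c 2 (2 + size_com c) q as)\<rparr>"

definition small :: "(nat \<times> move) list \<Rightarrow> bool" where
  "small acts \<longleftrightarrow> (\<forall>(a, d) \<in> set acts. a < 4)"

lemma small_update: "small acts \<Longrightarrow> fst b < 4 \<Longrightarrow> small (acts[j := b])"
  by (auto simp: small_def dest!: subsetD[OF set_update_subset_insert])

lemma small_stay: "\<forall>a\<in>set as. a < 4 \<Longrightarrow> small (stay as)"
  by (auto simp: small_def stay_def)

lemma small_move_tape: "\<forall>a\<in>set as. a < 4 \<Longrightarrow> small (move_tape as j d)"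
  by (cases "j < length as") (auto simp: move_tape_def small_stay list_update_beyond intro!: small_update)

lemma code_wf:
  assumes "length as = R + 2" and "\<forall>a\<in>set as. a < 4" and "regs_com c \<le> R"
    and "off \<le> q" "q < off + size_com c"
  shows "fst (code c off ex q as) \<le> max ex (off + size_com c) \<and>
    length (snd (code c off ex q as)) = R + 2 \<and> small (snd (code c off ex q as))"
proof -
  note stay = small_stay[OF assms(2)]
  show ?thesis
    using assms(3-)
  proof (induction c arbitrary: off ex)
    case (Seq c d)
    show ?case
    proof (cases "q < off + size_com c")
      case True
      then show ?thesis using Seq.IH(1)[of off "off + size_com c"] Seq.prems by auto
    next
      case False
      then show ?thesis using Seq.IH(2)[of "off + size_com c" ex] Seq.prems by (auto simp: add.assoc)
    qed
  next
    case (While b c)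
    show ?case
    proof (cases "q = off")
      case True
      then show ?thesis using stay assms(1) by auto
    next
      case False
      then show ?thesis using While.IH[of "off + 1" off] While.prems by auto
    qed
  next
    case (If b c d)
    consider "q = off" | "q \<noteq> off" "q < off + 1 + size_com c" | "\<not> q < off + 1 + size_com c"
      by blast
    then show ?case
    proof cases
      case 1
      then show ?thesis using stay assms(1) by auto
    next
      case 2
      then show ?thesis using If.IH(1)[of "off + 1" ex] If.prems by auto
    next
      case 3
      then show ?thesis using If.IH(2)[of "off + 1 + size_com c" ex] If.prems
        by (auto simp: add.assoc)
    qed
  qed (use stay assms(1) small_move_tape[OF assms(2)] in
      \<open>auto simp: small_update\<close>, (simp add: move_tape_def)+)
qed

lemma wf_com_tm: "wf_tm (com_tm c)"
proof -
  have "case tm_delta (com_tm c) q as of (q', acts) \<Rightarrow>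
      q' \<le> tm_states (com_tm c) \<and> length acts = tm_tapes (com_tm c) \<and>
      small acts"
    if q: "q < tm_states (com_tm c)"
      and as: "length as = tm_tapes (com_tm c)" "\<forall>a\<in>set as. a < tm_symbols (com_tm c)" for q as
  proof -
    have as': "length as = regs_com c + 2" "\<forall>a\<in>set as. a < 4" "as ! 0 < 4" "as ! Suc 0 < 4"
      using as by (auto simp: com_tm_def)
    consider "q = 0" | "q = 1" | "2 \<le> q" by linarith
    then show ?thesis
    proof cases
      case 1
      then show ?thesis using as' small_stay[OF as'(2)]
        by (auto simp: com_tm_def small_update; auto simp: small_def)
    next
      case 2
      then show ?thesis using as' small_stay[OF as'(2)]
        by (auto simp: com_tm_def small_update; auto simp: small_def)
    next
      case 3
      then show ?thesis using code_wf[OF as'(1,2), of c 2 q "2 + size_com c"] q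
        by (auto simp: com_tm_def case_prod_unfold)
    qed
  qed
  then show ?thesis by (auto simp: wf_tm_def com_tm_def small_def)
qed

lemma map2_tape_act_update2:
  assumes "j < length ts" "j' < length ts" "j \<noteq> j'"
  shows "map2 tape_act ((stay (scan ts))[j := a, j' := b]) ts =
    ts[j := tape_act a (ts ! j), j' := tape_act b (ts ! j')]"
  using assms
  by (intro nth_equalityI) (auto simp: nth_list_update split: prod.splits)

lemma com_tm_copy:
  assumes "i \<le> length x"
  shows "(tm_step (com_tm c) ^^ i) (tm_init (com_tm c) [x]) =
    (0, [(\<lambda>p. if p < int i then 0 else contents x p, int i), (contents (take i x), int i)] @
        replicate (regs_com c) (contents [], 0))"
  using assms
proof (induction i)
  case 0
  have "tm_init (com_tm c) [x] = (0, [(contents x, 0), (contents [], 0)] @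
      replicate (regs_com c) (contents [], 0))"
    by (auto simp: tm_init_def com_tm_def nth_append nth_Cons intro!: nth_equalityI split: nat.splits)
  moreover have "(\<lambda>p. if p < 0 then 0 else contents x p) = contents x"
    by (rule ext) (simp add: contents_def)
  ultimately show ?case by simp
next
  case (Suc i)
  let ?ts = "[(\<lambda>p. if p < int i then 0 else contents x p, int i), (contents (take i x), int i)] @
        replicate (regs_com c) (contents [], 0)"
  have b: "contents x (int i) = (if x ! i then 2 else 1)"
    using Suc.prems by (simp add: contents_def)
  have "tm_step (com_tm c) (0, ?ts) = (0, ?ts
     [0 := (\<lambda>p. if p < int (Suc i) then 0 else contents x p, int (Suc i)),
      1 := ((contents (take i x))(int i := contents x (int i)), int (Suc i))])"
  proof -
    have "(\<lambda>p. if p < int i then 0 else contents x p)(int i := 0) =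
        (\<lambda>p. if p < int (Suc i) then 0 else contents x p)"
      by (rule ext) auto
    then show ?thesis
      by (subst tm_step_code)
        (simp_all add: com_tm_def map2_tape_act_update2 b add.commute[of 1])
  qed
  moreover have "(contents (take i x))(int i := contents x (int i)) = contents (take (Suc i) x)"
  proof -
    have "length (take i x) = i" using Suc.prems by simp
    then show ?thesis
      using contents_snoc[of "take i x" "x ! i"] Suc.prems
      by (simp add: b take_Suc_conv_app_nth)
  qed
  ultimately show ?case using Suc by simp
qed

lemma com_tm_rewind:
  assumes "i \<le> length x"
  shows "(tm_step (com_tm c) ^^ i) (1, [(contents [], int (length x) - 1), (contents x, int (length x) - 1)] @
      replicate (regs_com c) (contents [], 0)) =
    (1, [(contents [], int (length x) - 1 - int i), (contents x, int (length x) - 1 - int i)] @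
      replicate (regs_com c) (contents [], 0))"
  using assms
proof (induction i)
  case (Suc i)
  let ?p = "int (length x) - 1 - int i"
  let ?ts = "[(contents [], ?p), (contents x, ?p)] @ replicate (regs_com c) (contents [], 0)"
  have "contents x ?p \<noteq> 0"
    using Suc.prems by (simp add: contents_def)
  then have "tm_step (com_tm c) (1, ?ts) = (1, ?ts[0 := (contents [], ?p - 1), 1 := (contents x, ?p - 1)])"
    by (subst tm_step_code) (simp_all add: com_tm_def map2_tape_act_update2)
  then show ?case using Suc by simp
qed simp

lemma com_tm_prelude:
  "(tm_step (com_tm c) ^^ (2 * length x + 2)) (tm_init (com_tm c) [x]) =
    (2, tapes (regs_com c) x (\<lambda>_. 0, [], 0))"
proof -
  let ?M = "com_tm c" and ?n = "length x"
  let ?rest = "replicate (regs_com c) (contents [], 0 :: int)"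
  have nil: "contents [] = (\<lambda>_. 0)" by (rule ext) (simp add: contents_def)
  have "(\<lambda>p. if p < int ?n then 0 else contents x p) = contents []"
    by (rule ext) (simp add: contents_def)
  then have 1: "(tm_step ?M ^^ ?n) (tm_init ?M [x]) = (0, [(contents [], int ?n), (contents x, int ?n)] @ ?rest)"
    using com_tm_copy[of ?n x c] by simp
  let ?ts = "[(contents [], int ?n), (contents x, int ?n)] @ ?rest"
  have 2: "tm_step ?M (0, ?ts) = (1, [(contents [], int ?n - 1), (contents x, int ?n - 1)] @ ?rest)"
    by (subst tm_step_code) (simp_all add: com_tm_def map2_tape_act_update2 nil fun_upd_idem)
  have 3: "(tm_step ?M ^^ ?n) (1, [(contents [], int ?n - 1), (contents x, int ?n - 1)] @ ?rest) =
      (1, [(contents [], -1), (contents x, -1)] @ ?rest)"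
    using com_tm_rewind[of ?n x c] by simp
  have m: "contents x (-1) = 0" by (simp add: contents_def)
  have 4: "tm_step ?M (1, [(contents [], -1), (contents x, -1)] @ ?rest) =
      (2, tapes (regs_com c) x (\<lambda>_. 0, [], 0))"
  proof -
    have "(contents [])(0 := 3) = marker" by (rule ext) (simp add: nil marker_def)
    then have "map2 tape_act (map (\<lambda>r. (3, Move_Stay)) [0..<regs_com c]) ?rest =
        map (\<lambda>r. (marker, 0)) [0..<regs_com c]"
      by (intro nth_equalityI) (auto simp del: upt_Suc)
    then show ?thesis
      by (subst tm_step_code) (simp_all add: com_tm_def m fun_upd_idem nil)
  qed
  \<comment> \<open>\<open>?n\<close> steps to copy, one to turn round, \<open>?n\<close> to rewind
    and one to write the markers.\<close>
  have "2 * ?n + 2 = 1 + (?n + (1 + ?n))" by simp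
  then have "(tm_step ?M ^^ (2 * ?n + 2)) (tm_init ?M [x]) =
      tm_step ?M ((tm_step ?M ^^ ?n) (tm_step ?M ((tm_step ?M ^^ ?n) (tm_init ?M [x]))))"
    by (simp only: funpow_add comp_apply funpow_one)
  then show ?thesis by (simp only: 1 2 3 4)
qed

lemma tm_steps_halted: "(tm_step M ^^ t) (tm_states M, ts) = (tm_states M, ts)"
  by (induction t) (simp_all add: tm_step_def)

text \<open>A halted machine stays put, so a program that stops early still meets the exact time of
  \<open>tm_computes\<close>. The summand \<open>[:2, 2:]\<close> pays for moving the input.\<close>

theorem polytime_com:
  fixes P :: "nat poly"
  assumes "\<And>x. \<exists>t \<le> poly P (length x). \<exists>\<rho> i. big x c (\<lambda>_. 0, [], 0) t (\<rho>, f x, i)"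
  shows "polytime 1 (\<lambda>xs. f (xs ! 0))"
proof -
  have "tm_computes (com_tm c) [x] (f x) (poly (P + [:2, 2:]) (length x))" for x
  proof -
    obtain t \<rho> i where t: "t \<le> poly P (length x)" and b: "big x c (\<lambda>_. 0, [], 0) t (\<rho>, f x, i)"
      using assms by blast
    have run: "(tm_step (com_tm c) ^^ t) (2, tapes (regs_com c) x (\<lambda>_. 0, [], 0)) =
        (tm_states (com_tm c), tapes (regs_com c) x (\<rho>, f x, i))"
      by (rule big_imp_tm_steps[OF b]) (auto simp: com_tm_def)
    obtain d where d: "poly (P + [:2, 2:]) (length x) = d + (t + (2 * length x + 2))"
    proof -
      have "t + (2 * length x + 2) \<le> poly (P + [:2, 2:]) (length x)"
        using t by (simp add: algebra_simps)
      then show ?thesis using that by (metis le_add_diff_inverse2)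
    qed
    have "(tm_step (com_tm c) ^^ poly (P + [:2, 2:]) (length x)) (tm_init (com_tm c) [x]) =
        (tm_states (com_tm c), tapes (regs_com c) x (\<rho>, f x, i))"
      by (simp only: d funpow_add[of d] funpow_add[of t] comp_apply com_tm_prelude run tm_steps_halted)
    then show ?thesis by (simp add: tm_computes_def)
  qed
  then have "\<forall>xs. length xs = 1 \<longrightarrow>
      tm_computes (com_tm c) xs (f (xs ! 0)) (poly (P + [:2, 2:]) (sum_list (map length xs)))"
    by (auto simp: length_Suc_conv)
  moreover have "1 \<le> tm_tapes (com_tm c)" by (simp add: com_tm_def)
  ultimately show ?thesis
    unfolding polytime_def using wf_com_tm by blast
qed

section \<open>Printing with bounded loops\<close>

datatype pexp = Const nat | Var nat | Add pexp pexp | Mul pexp pexp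

fun val :: "pexp \<Rightarrow> (nat \<Rightarrow> nat) \<Rightarrow> nat" where
  "val (Const n) \<eta> = n"
| "val (Var v) \<eta> = \<eta> v"
| "val (Add p q) \<eta> = val p \<eta> + val q \<eta>"
| "val (Mul p q) \<eta> = val p \<eta> * val q \<eta>"

fun below :: "nat \<Rightarrow> pexp \<Rightarrow> bool" where
  "below d (Const n) \<longleftrightarrow> True"
| "below d (Var v) \<longleftrightarrow> v < d"
| "below d (Add p q) \<longleftrightarrow> below d p \<and> below d q"
| "below d (Mul p q) \<longleftrightarrow> below d p \<and> below d q"

text \<open>
  \<open>Rep p e\<close> iterates \<open>e\<close>; the next two free variables hold the loop index and its
  complement \<open>val p \<eta> - Suc index\<close>, which stands in for the missing subtraction.
\<close>

datatype 'a em =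
    Leaf 'a
  | Cat "'a em" "'a em"
  | Rep pexp "'a em"
  | If_Bit nat "'a em" "'a em"

fun sem :: "('a \<Rightarrow> (nat \<Rightarrow> nat) \<Rightarrow> 'b list) \<Rightarrow> bool list \<Rightarrow> nat \<Rightarrow> 'a em \<Rightarrow> (nat \<Rightarrow> nat) \<Rightarrow> 'b list" where
  "sem L x d (Leaf a) \<eta> = L a \<eta>"
| "sem L x d (Cat e e') \<eta> = sem L x d e \<eta> @ sem L x d e' \<eta>"
| "sem L x d (Rep p e) \<eta> = concat (map (\<lambda>i. sem L x (d + 2) e
     (\<eta>(d := i, Suc d := val p \<eta> - Suc i))) [0..<val p \<eta>])"
| "sem L x d (If_Bit v e e') \<eta> =
     (if \<eta> v < length x \<and> x ! \<eta> v then sem L x d e \<eta> else sem L x d e' \<eta>)"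

fun wf_em :: "(nat \<Rightarrow> 'a \<Rightarrow> bool) \<Rightarrow> nat \<Rightarrow> 'a em \<Rightarrow> bool" where
  "wf_em W d (Leaf a) \<longleftrightarrow> W d a"
| "wf_em W d (Cat e e') \<longleftrightarrow> wf_em W d e \<and> wf_em W d e'"
| "wf_em W d (Rep p e) \<longleftrightarrow> below d p \<and> wf_em W (d + 2) e"
| "wf_em W d (If_Bit v e e') \<longleftrightarrow> v < d \<and> wf_em W d e \<and> wf_em W d e'"

lemma concat_concat: "concat (concat xss) = concat (map concat xss)"
  by (induction xss) auto

text \<open>Lets the loops be analysed as a list of edges and then be reused, with other leaves, as
  the program that prints this list.\<close>

lemma sem_map_em:
  assumes "\<And>a \<eta>. L (g a) \<eta> = concat (map h (L' a \<eta>))"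
  shows "sem L x d (map_em g e) \<eta> = concat (map h (sem L' x d e \<eta>))"
  by (induction e arbitrary: d \<eta>)
    (simp_all add: assms map_concat comp_def concat_concat cong: map_cong)

lemma wf_em_map_em:
  assumes "\<And>d a. W' d a \<Longrightarrow> W d (g a)"
  shows "wf_em W' d e \<Longrightarrow> wf_em W d (map_em g e)"
  by (induction e arbitrary: d) (auto simp: assms)

text \<open>\<open>Pow\<close> prints vertex names. \<open>Bin\<close> serves the number of pages,
  whose binary digits have to be computed by repeated halving.\<close>

datatype leaf = Out "bool list" | Pow pexp | Bin pexp

fun leaf_out :: "leaf \<Rightarrow> (nat \<Rightarrow> nat) \<Rightarrow> bool list" where
  "leaf_out (Out bs) \<eta> = bs"
| "leaf_out (Pow p) \<eta> = enc_nat (2 ^ val p \<eta>)"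
| "leaf_out (Bin p) \<eta> = enc_nat (val p \<eta>)"

fun wf_leaf :: "nat \<Rightarrow> leaf \<Rightarrow> bool" where
  "wf_leaf d (Out bs) \<longleftrightarrow> True"
| "wf_leaf d (Pow p) \<longleftrightarrow> below d p"
| "wf_leaf d (Bin p) \<longleftrightarrow> below d p"

definition ev :: "bool list \<Rightarrow> com \<Rightarrow> state \<Rightarrow> nat \<Rightarrow> state \<Rightarrow> bool" where
  "ev x c s b s' \<longleftrightarrow> (\<exists>t\<le>b. big x c s t s')"

lemma ev_mono: "ev x c s b s' \<Longrightarrow> b \<le> b' \<Longrightarrow> ev x c s b' s'"
  unfolding ev_def by (meson order_trans)

lemma ev_Inc: "\<rho>' = \<rho>(r := Suc (\<rho> r)) \<Longrightarrow> ev x (Inc r) (\<rho>, out, i) 1 (\<rho>', out, i)"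
  unfolding ev_def using big.Inc by blast

lemma ev_Dec: "\<rho> r \<noteq> 0 \<Longrightarrow> \<rho>' = \<rho>(r := \<rho> r - 1) \<Longrightarrow> ev x (Dec r) (\<rho>, out, i) 1 (\<rho>', out, i)"
  unfolding ev_def using big.Dec by blast

lemma ev_Emit: "ev x (Emit b) (\<rho>, out, i) 1 (\<rho>, out @ [b], i)"
  unfolding ev_def using big.Emit by blast

lemma ev_In_Right: "i' = i + 1 \<Longrightarrow> ev x In_Right (\<rho>, out, i) 1 (\<rho>, out, i')"
  unfolding ev_def using big.In_Right by blast

lemma ev_In_Left: "i' = i - 1 \<Longrightarrow> ev x In_Left (\<rho>, out, i) 1 (\<rho>, out, i')"
  unfolding ev_def using big.In_Left by blast

lemma ev_Seq: "ev x c s b s' \<Longrightarrow> ev x d s' b' s'' \<Longrightarrow> ev x (Seq c d) s (b + b') s''"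
  unfolding ev_def using big.Seq by (meson add_mono)

lemma ev_If_True: "holds x t s \<Longrightarrow> ev x c s b s' \<Longrightarrow> ev x (If t c d) s (1 + b) s'"
  unfolding ev_def using big.If_True by (meson add_left_mono)

lemma ev_If_False: "\<not> holds x t s \<Longrightarrow> ev x d s b s' \<Longrightarrow> ev x (If t c d) s (1 + b) s'"
  unfolding ev_def using big.If_False by (meson add_left_mono)

lemma ev_While_False: "\<not> holds x t s \<Longrightarrow> ev x (While t c) s 1 s"
  unfolding ev_def using big.While_False by blast

lemma ev_While_True:
  "holds x t s \<Longrightarrow> ev x c s b s' \<Longrightarrow> ev x (While t c) s' b' s'' \<Longrightarrow>
    ev x (While t c) s (1 + b + b') s''"
  unfolding ev_def using big.While_True by (meson add_left_mono add_mono)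

lemma ev_While:
  assumes "\<And>i. i < n \<Longrightarrow> holds x t (S i)" "\<not> holds x t (S n)"
    and "\<And>i. i < n \<Longrightarrow> ev x c (S i) b (S (Suc i))"
  shows "ev x (While t c) (S 0) (n * (b + 1) + 1) (S n)"
  using assms
proof (induction n arbitrary: S)
  case 0
  then show ?case using ev_While_False by simp
next
  case (Suc n)
  have "ev x (While t c) (S (Suc 0)) (n * (b + 1) + 1) (S (Suc n))"
    using Suc.prems by (intro Suc.IH[of "\<lambda>i. S (Suc i)"]) auto
  then have "ev x (While t c) (S 0) (1 + b + (n * (b + 1) + 1)) (S (Suc n))"
    using Suc.prems by (intro ev_While_True) auto
  then show ?case by (simp add: algebra_simps)
qed

lemma ev_While':
  assumes "s = S 0" "S n = s'" "\<And>i. i < n \<Longrightarrow> holds x t (S i)" "\<not> holds x t (S n)"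
    and "\<And>i. i < n \<Longrightarrow> ev x c (S i) b (S (Suc i))"
  shows "ev x (While t c) s (n * (b + 1) + 1) s'"
  using ev_While[OF assms(3-)] assms(1,2) by simp

text \<open>Variable \<open>v\<close> lives in register \<open>2 * v\<close>; the odd registers are scratch.\<close>

abbreviation "vreg v \<equiv> 2 * v"
abbreviation "sreg k \<equiv> Suc (2 * k)"

section \<open>Evaluating polynomials with counters\<close>

lemma sreg_neq [simp]: "sreg k \<noteq> vreg v" "vreg v \<noteq> sreg k"
  by presburger+

text \<open>Reading a counter destroys it, so \<open>Var\<close> moves the value through
  \<open>sreg k\<close> and back. Code at level \<open>k\<close> works with the scratch counters
  from \<open>k\<close> on, which it finds and leaves at zero. \<open>Inc\<close> followed by
  \<open>Dec\<close> stands in for the empty program.\<close>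

fun add_to :: "nat \<Rightarrow> pexp \<Rightarrow> nat \<Rightarrow> com" where
  "add_to k (Const n) r = foldr (\<lambda>_. Seq (Inc r)) [0..<n] (Seq (Inc r) (Dec r))"
| "add_to k (Var v) r =
     Seq (While (NZ (vreg v)) (Seq (Dec (vreg v)) (Seq (Inc r) (Inc (sreg k)))))
         (While (NZ (sreg k)) (Seq (Dec (sreg k)) (Inc (vreg v))))"
| "add_to k (Add p q) r = Seq (add_to k p r) (add_to k q r)"
| "add_to k (Mul p q) r =
     Seq (add_to (Suc k) p (sreg k))
         (While (NZ (sreg k)) (Seq (Dec (sreg k)) (add_to (Suc k) q r)))"

lemma poly_mono_nat: "a \<le> b \<Longrightarrow> poly (p :: nat poly) a \<le> poly p b"
  by (induction p) (auto intro!: add_mono mult_mono)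

lemma val_bound: "\<exists>Q :: nat poly. \<forall>d X \<eta>. below d p \<longrightarrow> (\<forall>v<d. \<eta> v \<le> X) \<longrightarrow> val p \<eta> \<le> poly Q X"
proof (induction p)
  case (Const n)
  show ?case by (rule exI[of _ "[:n:]"]) simp
next
  case (Var v)
  show ?case by (rule exI[of _ "[:0, 1:]"]) simp
next
  case (Add p q)
  then obtain Q Q' :: "nat poly"
    where *: "\<forall>d X \<eta>. below d p \<longrightarrow> (\<forall>v<d. \<eta> v \<le> X) \<longrightarrow> val p \<eta> \<le> poly Q X"
      "\<forall>d X \<eta>. below d q \<longrightarrow> (\<forall>v<d. \<eta> v \<le> X) \<longrightarrow> val q \<eta> \<le> poly Q' X"
    by blast
  show ?case by (rule exI[of _ "Q + Q'"]) (auto intro!: add_mono *[rule_format])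
next
  case (Mul p q)
  then obtain Q Q' :: "nat poly"
    where *: "\<forall>d X \<eta>. below d p \<longrightarrow> (\<forall>v<d. \<eta> v \<le> X) \<longrightarrow> val p \<eta> \<le> poly Q X"
      "\<forall>d X \<eta>. below d q \<longrightarrow> (\<forall>v<d. \<eta> v \<le> X) \<longrightarrow> val q \<eta> \<le> poly Q' X"
    by blast
  show ?case by (rule exI[of _ "Q * Q'"]) (auto intro!: mult_mono *[rule_format])
qed

lemma val_cong: "below d p \<Longrightarrow> (\<And>v. v < d \<Longrightarrow> \<eta> v = \<eta>' v) \<Longrightarrow> val p \<eta> = val p \<eta>'"
  by (induction p) auto

definition vars :: "(nat \<Rightarrow> nat) \<Rightarrow> nat \<Rightarrow> nat" where
  "vars \<rho> v = \<rho> (vreg v)"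

lemma vars_upd [simp]:
  "vars (\<rho>(vreg v := n)) = (vars \<rho>)(v := n)"
  "vars (\<rho>(sreg k := n)) = vars \<rho>"
  by (auto simp: vars_def fun_eq_iff)

text \<open>The target \<open>r\<close> may be a scratch counter below level \<open>k\<close>; this
  is how \<open>Mul\<close> stores its first factor.\<close>

definition adds :: "nat \<Rightarrow> pexp \<Rightarrow> nat poly \<Rightarrow> bool" where
  "adds d p P \<longleftrightarrow> (\<forall>x k r \<rho> out i X. (\<forall>j\<ge>k. \<rho> (sreg j) = 0) \<longrightarrow>
     (\<forall>v<d. r \<noteq> vreg v) \<longrightarrow> (\<forall>j\<ge>k. r \<noteq> sreg j) \<longrightarrow> (\<forall>v<d. vars \<rho> v \<le> X) \<longrightarrow>
     ev x (add_to k p r) (\<rho>, out, i) (poly P X) (\<rho>(r := \<rho> r + val p (vars \<rho>)), out, i))"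

lemma addsD:
  assumes "adds d p P" "\<forall>j\<ge>k. \<rho> (sreg j) = 0" "\<forall>v<d. r \<noteq> vreg v" "\<forall>j\<ge>k. r \<noteq> sreg j"
    "\<forall>v<d. vars \<rho> v \<le> X"
  shows "ev x (add_to k p r) (\<rho>, out, i) (poly P X) (\<rho>(r := \<rho> r + val p (vars \<rho>)), out, i)"
  using assms unfolding adds_def by blast


lemma adds_scratch:
  assumes "adds d p P" "\<forall>j\<ge>k. \<rho> (sreg j) = 0" "\<forall>v<d. vars \<rho> v \<le> X"
  shows "ev x (add_to (Suc k) p (sreg k)) (\<rho>, out, i) (poly P X) (\<rho>(sreg k := val p (vars \<rho>)), out, i)"
  using addsD[OF assms(1), where r = "sreg k" and k = "Suc k" and \<rho> = \<rho>] assms(2,3) by simp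

lemma ev_add_to: "below d p \<Longrightarrow> \<exists>P. adds d p P"
proof (induction p)
  case (Const n)
  have "ev x (foldr (\<lambda>_. Seq (Inc r)) xs (Seq (Inc r) (Dec r))) (\<rho>, out, i) (length xs + 2)
      (\<rho>(r := \<rho> r + length xs), out, i)" for x r \<rho> out i and xs :: "nat list"
  proof (induction xs arbitrary: \<rho>)
    case Nil
    have "ev x (Seq (Inc r) (Dec r)) (\<rho>, out, i) (1 + 1) (\<rho>, out, i)"
      by (rule ev_Seq[OF ev_Inc[OF refl] ev_Dec]) auto
    then show ?case by (simp add: numeral_2_eq_2)
  next
    case (Cons a xs)
    have "ev x (Seq (Inc r) (foldr (\<lambda>_. Seq (Inc r)) xs (Seq (Inc r) (Dec r)))) (\<rho>, out, i)
        (1 + (length xs + 2)) (\<rho>(r := Suc (\<rho> r), r := Suc (\<rho> r) + length xs), out, i)"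
      using Cons.IH[of "\<rho>(r := Suc (\<rho> r))"] by (intro ev_Seq[OF ev_Inc[OF refl]]) (simp add: fun_upd_same del: fun_upd_apply)
    then show ?case by (simp del: fun_upd_apply)
  qed
  from this[where xs = "[0..<n]"] show ?case
    unfolding adds_def by (intro exI[of _ "[:n + 2:]"]) (simp del: fun_upd_apply)
next
  case (Var v)
  have "ev x (add_to k (Var v) r) (\<rho>, out, i) ((X * 4 + 1) + (X * 3 + 1))
      (\<rho>(r := \<rho> r + vars \<rho> v), out, i)"
    if *: "\<forall>j\<ge>k. \<rho> (sreg j) = 0" "\<forall>v<d. r \<noteq> vreg v" "\<forall>j\<ge>k. r \<noteq> sreg j" "\<forall>v<d. vars \<rho> v \<le> X"
    for x k r \<rho> out i X
  proof -
    let ?n = "vars \<rho> v"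
    have neq: "r \<noteq> vreg v" "r \<noteq> sreg k" "vreg v \<noteq> r" "sreg k \<noteq> r" "\<rho> (sreg k) = 0" "?n \<le> X"
      using * Var by force+
    define S where "S j = (\<rho>(vreg v := ?n - j, r := \<rho> r + j, sreg k := j), out, i)" for j
    define S' where "S' j = (\<rho>(vreg v := j, r := \<rho> r + ?n, sreg k := ?n - j), out, i)" for j
    have 1: "ev x (While (NZ (vreg v)) (Seq (Dec (vreg v)) (Seq (Inc r) (Inc (sreg k)))))
        (\<rho>, out, i) (?n * (3 + 1) + 1) (S ?n)"
    proof (rule ev_While'[of _ S])
      show "(\<rho>, out, i) = S 0" using neq by (auto simp: S_def vars_def fun_eq_iff)
      fix j assume j: "j < ?n"
      have "ev x (Seq (Dec (vreg v)) (Seq (Inc r) (Inc (sreg k)))) (S j) (1 + (1 + 1)) (S (Suc j))"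
        unfolding S_def using j neq
        by (intro ev_Seq[OF ev_Dec[OF _ refl] ev_Seq[OF ev_Inc[OF refl] ev_Inc]]) (auto simp: fun_eq_iff)
      then show "ev x (Seq (Dec (vreg v)) (Seq (Inc r) (Inc (sreg k)))) (S j) 3 (S (Suc j))"
        by (rule ev_mono) simp
    qed (use neq in \<open>auto simp: S_def\<close>)
    have 2: "ev x (While (NZ (sreg k)) (Seq (Dec (sreg k)) (Inc (vreg v)))) (S ?n) (?n * (2 + 1) + 1) (S' ?n)"
    proof (rule ev_While'[of _ S'])
      show "S ?n = S' 0" by (simp add: S_def S'_def)
      fix j assume j: "j < ?n"
      have "ev x (Seq (Dec (sreg k)) (Inc (vreg v))) (S' j) (1 + 1) (S' (Suc j))"
        unfolding S'_def using j neq
        by (intro ev_Seq[OF ev_Dec[OF _ refl] ev_Inc]) (auto simp: fun_eq_iff)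
      then show "ev x (Seq (Dec (sreg k)) (Inc (vreg v))) (S' j) 2 (S' (Suc j))"
        by (rule ev_mono) simp
    qed (use neq in \<open>auto simp: S'_def\<close>)
    have fin: "S' ?n = (\<rho>(r := \<rho> r + ?n), out, i)"
      using neq by (auto simp: S'_def vars_def fun_eq_iff)
    show ?thesis
      using ev_Seq[OF 1 2] neq(6) unfolding fin by (auto elim!: ev_mono)
  qed
  \<comment> \<open>Each unit of the variable costs four steps on the way out and three on the way
    back, tests included; two more tests end the loops.\<close>
  moreover have P_eq: "poly [:2, 7:] X = (X * 4 + 1) + (X * 3 + 1)" for X :: nat
    by simp
  ultimately show ?case
    by (intro exI[of _ "[:2, 7:]"]) (simp only: adds_def P_eq val.simps, blast)
next
  case (Add p q)
  then obtain P P' where *: "adds d p P" "adds d q P'" and b: "below d p" "below d q"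
    by auto
  have "ev x (add_to k (Add p q) r) (\<rho>, out, i) (poly P X + poly P' X)
      (\<rho>(r := \<rho> r + val (Add p q) (vars \<rho>)), out, i)"
    if h: "\<forall>j\<ge>k. \<rho> (sreg j) = 0" "\<forall>v<d. r \<noteq> vreg v" "\<forall>j\<ge>k. r \<noteq> sreg j"
      "\<forall>v<d. vars \<rho> v \<le> X"
    for x k r \<rho> out i X
  proof -
    let ?\<rho> = "\<rho>(r := \<rho> r + val p (vars \<rho>))"
    have same: "vars ?\<rho> v = vars \<rho> v" if "v < d" for v
      using h(2) that by (auto simp: vars_def)
    have q: "val q (vars ?\<rho>) = val q (vars \<rho>)"
      using b same by (intro val_cong) auto
    have "ev x (add_to k q r) (?\<rho>, out, i) (poly P' X) (?\<rho>(r := ?\<rho> r + val q (vars ?\<rho>)), out, i)"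
      using h same by (intro addsD[OF *(2)]) auto
    from ev_Seq[OF addsD[OF *(1) h] this] show ?thesis
      by (simp add: q add.assoc)
  qed
  then show ?case by (intro exI[of _ "P + P'"]) (simp only: adds_def poly_add, blast)
next
  case (Mul p q)
  then obtain P P' where *: "adds d p P" "adds d q P'" and b: "below d p" "below d q"
    by auto
  obtain Q :: "nat poly" where Q: "\<And>X \<eta>. \<forall>v<d. \<eta> v \<le> X \<Longrightarrow> val p \<eta> \<le> poly Q X"
    using val_bound[of p] b by blast
  have "ev x (add_to k (Mul p q) r) (\<rho>, out, i) (poly P X + (poly Q X * ((1 + poly P' X) + 1) + 1))
      (\<rho>(r := \<rho> r + val (Mul p q) (vars \<rho>)), out, i)"
    if h: "\<forall>j\<ge>k. \<rho> (sreg j) = 0" "\<forall>v<d. r \<noteq> vreg v" "\<forall>j\<ge>k. r \<noteq> sreg j"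
      "\<forall>v<d. vars \<rho> v \<le> X"
    for x k r \<rho> out i X
  proof -
    let ?m = "val p (vars \<rho>)" and ?n = "val q (vars \<rho>)"
    have r: "r \<noteq> sreg k" "sreg k \<noteq> r" "\<rho> (sreg k) = 0" using h by force+
    \<comment> \<open>After \<open>j\<close> rounds the second factor has been added
      \<open>j\<close> times. It stays the same throughout, as neither the target nor the scratch
      counter is one of its variables.\<close>
    define S where "S j = (\<rho>(r := \<rho> r + j * ?n, sreg k := ?m - j), out, i)" for j
    have "ev x (add_to (Suc k) p (sreg k)) (\<rho>, out, i) (poly P X)
        (\<rho>(sreg k := \<rho> (sreg k) + ?m), out, i)"
      using h by (intro addsD[OF *(1)]) auto
    then have 1: "ev x (add_to (Suc k) p (sreg k)) (\<rho>, out, i) (poly P X) (S 0)"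
      using r by (simp add: S_def)
    have 2: "ev x (While (NZ (sreg k)) (Seq (Dec (sreg k)) (add_to (Suc k) q r))) (S 0)
        (?m * ((1 + poly P' X) + 1) + 1) (S ?m)"
    proof (rule ev_While)
      fix j assume j: "j < ?m"
      let ?\<rho> = "\<rho>(r := \<rho> r + j * ?n, sreg k := ?m - Suc j)"
      have same: "vars ?\<rho> v = vars \<rho> v" if "v < d" for v
        using h(2) that by (auto simp: vars_def)
      have q: "val q (vars ?\<rho>) = ?n"
        using b same by (intro val_cong) auto
      have "ev x (add_to (Suc k) q r) (?\<rho>, out, i) (poly P' X) (?\<rho>(r := ?\<rho> r + val q (vars ?\<rho>)), out, i)"
      proof (rule addsD[OF *(2)])
        show "\<forall>j'\<ge>Suc k. ?\<rho> (sreg j') = 0"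
          using h(1,3) by (simp add: Suc_le_eq) (metis less_imp_le_nat)
      qed (use h same in auto)
      moreover have "(?\<rho>(r := ?\<rho> r + val q (vars ?\<rho>)), out, i) = S (Suc j)"
        unfolding q using r by (auto simp: S_def fun_eq_iff)
      ultimately have "ev x (add_to (Suc k) q r) (?\<rho>, out, i) (poly P' X) (S (Suc j))"
        by simp
      then show "ev x (Seq (Dec (sreg k)) (add_to (Suc k) q r)) (S j) (1 + poly P' X) (S (Suc j))"
        unfolding S_def[of j] using j by (intro ev_Seq[OF ev_Dec]) (auto simp: fun_eq_iff)
    qed (auto simp: S_def)
    have fin: "S ?m = (\<rho>(r := \<rho> r + val (Mul p q) (vars \<rho>)), out, i)"
      using r by (auto simp: S_def fun_eq_iff)
    have "?m \<le> poly Q X" using Q h by auto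
    then have "poly P X + (?m * ((1 + poly P' X) + 1) + 1) \<le>
        poly P X + (poly Q X * ((1 + poly P' X) + 1) + 1)"
      by (intro add_left_mono add_right_mono mult_right_mono) auto
    then show ?thesis
      using ev_Seq[OF 1 2] unfolding fin by (auto elim!: ev_mono)
  qed
  moreover have P_eq: "poly (P + (Q * (([:1:] + P') + [:1:]) + [:1:])) X =
      poly P X + (poly Q X * ((1 + poly P' X) + 1) + 1)" for X
    by simp
  ultimately show ?case
    by (intro exI[of _ "P + (Q * (([:1:] + P') + [:1:]) + [:1:])"]) (simp only: adds_def P_eq, blast)
qed

definition val_le :: "nat \<Rightarrow> pexp \<Rightarrow> nat poly \<Rightarrow> bool" where
  "val_le d p Q \<longleftrightarrow> (\<forall>X \<eta>. (\<forall>v<d. \<eta> v \<le> X) \<longrightarrow> val p \<eta> \<le> poly Q X)"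

lemma val_leD: "val_le d p Q \<Longrightarrow> \<forall>v<d. \<eta> v \<le> X \<Longrightarrow> val p \<eta> \<le> poly Q X"
  unfolding val_le_def by blast

lemma add_to_bounds:
  assumes "below d p"
  obtains P Q where "adds d p P" "val_le d p Q"
proof -
  have "\<exists>Q. val_le d p Q" unfolding val_le_def using val_bound[of p] assms by blast
  then show ?thesis using ev_add_to[OF assms] that by blast
qed

section \<open>Printing and loops with counters\<close>

definition skip :: "nat \<Rightarrow> com" where
  "skip k = Seq (Inc (sreg k)) (Dec (sreg k))"

text \<open>One round of the binary encoding: the half collects in \<open>sreg (k + 1)\<close>, and
  a leftover unit in \<open>sreg (k + 2)\<close> is the least significant bit.\<close>

definition halve :: "nat \<Rightarrow> com" where
  "halve k =
     Seq (While (NZ (sreg k)) (Seq (Dec (sreg k))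
           (If (NZ (sreg k)) (Seq (Dec (sreg k)) (Inc (sreg (k + 1)))) (Inc (sreg (k + 2))))))
    (Seq (Emit True)
    (Seq (If (NZ (sreg (k + 2))) (Seq (Dec (sreg (k + 2))) (Emit True)) (Emit False))
         (While (NZ (sreg (k + 1))) (Seq (Dec (sreg (k + 1))) (Inc (sreg k))))))"

fun emit_leaf :: "nat \<Rightarrow> leaf \<Rightarrow> com" where
  "emit_leaf k (Out bs) = foldr (\<lambda>b. Seq (Emit b)) bs (skip k)"
| "emit_leaf k (Pow p) =
     Seq (add_to (Suc k) p (sreg k))
    (Seq (While (NZ (sreg k)) (Seq (Dec (sreg k)) (Seq (Emit True) (Emit False))))
    (Seq (Emit True) (Seq (Emit True) (Emit False))))"
| "emit_leaf k (Bin p) =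
     Seq (add_to (Suc k) p (sreg k)) (Seq (While (NZ (sreg k)) (halve k)) (Emit False))"

text \<open>The rounds still to come are counted by the complement variable itself: decremented
  before the body, it has the value that \<open>sem\<close> prescribes there. \<open>If_Bit\<close>
  walks the input head to the cell and back, keeping the index in a scratch counter meanwhile, so
  the head rests at cell \<open>0\<close> between commands.\<close>

fun compile :: "nat \<Rightarrow> nat \<Rightarrow> leaf list em \<Rightarrow> com" where
  "compile d k (Leaf ls) = foldr (\<lambda>l. Seq (emit_leaf k l)) ls (skip k)"
| "compile d k (Cat e e') = Seq (compile d k e) (compile d k e')"
| "compile d k (Rep p e) =
     Seq (add_to k p (vreg (Suc d)))
    (Seq (While (NZ (vreg (Suc d))) (Seq (Dec (vreg (Suc d))) (Seq (compile (d + 2) k e) (Inc (vreg d)))))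
         (While (NZ (vreg d)) (Dec (vreg d))))"
| "compile d k (If_Bit v e e') =
     Seq (While (NZ (vreg v)) (Seq (Dec (vreg v)) (Seq (Inc (sreg k)) In_Right)))
    (Seq (If In_One (Inc (sreg (Suc k))) (skip k))
    (Seq (While (NZ (sreg k)) (Seq (Dec (sreg k)) (Seq (Inc (vreg v)) In_Left)))
         (If (NZ (sreg (Suc k))) (Seq (Dec (sreg (Suc k))) (compile d k e)) (compile d k e'))))"

definition leaves_out :: "leaf list \<Rightarrow> (nat \<Rightarrow> nat) \<Rightarrow> bool list" where
  "leaves_out ls \<eta> = concat (map (\<lambda>l. leaf_out l \<eta>) ls)"

definition wf_leaves :: "nat \<Rightarrow> leaf list \<Rightarrow> bool" where
  "wf_leaves d ls \<longleftrightarrow> (\<forall>l\<in>set ls. wf_leaf d l)"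

lemma ev_skip: "ev x (skip k) (\<rho>, out, i) 2 (\<rho>, out, i)"
proof -
  have "ev x (skip k) (\<rho>, out, i) (1 + 1) (\<rho>, out, i)"
    unfolding skip_def by (rule ev_Seq[OF ev_Inc[OF refl] ev_Dec]) auto
  then show ?thesis by (simp add: numeral_2_eq_2)
qed

lemma enc_nat_rec: "enc_nat n = (if n = 0 then [False] else True # odd n # enc_nat (n div 2))"
  by (subst (1) enc_nat_def, subst bits.simps) (simp add: enc_nat_def enc_list_def)

lemma bits_pow2: "bits (2 ^ n) = replicate n False @ [True]"
  by (induction n) (subst bits.simps, simp add: bits.simps[of 0])+

lemma enc_nat_pow2: "enc_nat (2 ^ n) = concat (replicate n [True, False]) @ [True, True, False]"
  by (simp add: enc_nat_def enc_list_def bits_pow2)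

lemma ev_emit_Out: "ev x (foldr (\<lambda>b. Seq (Emit b)) bs (skip k)) (\<rho>, out, i) (length bs + 2) (\<rho>, out @ bs, i)"
proof (induction bs arbitrary: out)
  case Nil
  show ?case using ev_skip by (simp add: numeral_2_eq_2)
next
  case (Cons b bs)
  have "ev x (Seq (Emit b) (foldr (\<lambda>b. Seq (Emit b)) bs (skip k))) (\<rho>, out, i) (1 + (length bs + 2))
      (\<rho>, (out @ [b]) @ bs, i)"
    by (rule ev_Seq[OF ev_Emit Cons.IH])
  then show ?case by simp
qed

lemma ev_emit_pow2:
  assumes "\<rho> (sreg k) = n"
  shows "ev x (While (NZ (sreg k)) (Seq (Dec (sreg k)) (Seq (Emit True) (Emit False)))) (\<rho>, out, i)
    (n * (3 + 1) + 1) (\<rho>(sreg k := 0), out @ concat (replicate n [True, False]), i)"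
proof -
  define S where "S j = (\<rho>(sreg k := n - j), out @ concat (replicate j [True, False]), i)" for j
  show ?thesis
  proof (rule ev_While'[of _ S])
    fix j assume j: "j < n"
    have rep: "concat (replicate (Suc j) [True, False]) = (concat (replicate j [True, False]) @ [True]) @ [False]"
      by (induction j) auto
    have "ev x (Seq (Dec (sreg k)) (Seq (Emit True) (Emit False))) (S j) (1 + (1 + 1)) (S (Suc j))"
      unfolding S_def rep append_assoc[symmetric] using j
      by (intro ev_Seq[OF ev_Dec ev_Seq[OF ev_Emit ev_Emit]]) (auto simp: fun_eq_iff)
    then show "ev x (Seq (Dec (sreg k)) (Seq (Emit True) (Emit False))) (S j) 3 (S (Suc j))"
      by (rule ev_mono) simp
  qed (use assms in \<open>auto simp: S_def\<close>)
qed

lemma ev_halve: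
  assumes "\<rho> (sreg (k + 1)) = 0" "\<rho> (sreg (k + 2)) = 0" "\<rho> (sreg k) = m" "m \<le> X"
  shows "ev x (halve k) (\<rho>, out, i) (9 * X + 9) (\<rho>(sreg k := m div 2), out @ [True, odd m], i)"
proof -
  let ?a = "sreg k" and ?b = "sreg (k + 1)" and ?c = "sreg (k + 2)"
  define n where "n = (m + 1) div 2"
  \<comment> \<open>For odd \<open>m\<close> the last of the \<open>(m + 1) div 2\<close> rounds
    finds a single unit; truncated subtraction and \<open>min\<close> describe that round as
    well.\<close>
  define S where "S j = (\<rho>(?a := m - 2 * j, ?b := min j (m div 2), ?c := if 2 * j > m then 1 else 0), out, i)" for j
  have 1: "ev x (While (NZ ?a) (Seq (Dec ?a) (If (NZ ?a) (Seq (Dec ?a) (Inc ?b)) (Inc ?c)))) (\<rho>, out, i)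
      (n * (4 + 1) + 1) (S n)"
  proof (rule ev_While'[of _ S])
    show "(\<rho>, out, i) = S 0" using assms by (auto simp: S_def fun_eq_iff)
    fix j assume "j < n"
    then have j: "2 * j < m" by (auto simp: n_def)
    let ?\<rho> = "\<rho>(?a := m - 2 * j - 1, ?b := j, ?c := 0)"
    have S_j: "S j = (\<rho>(?a := m - 2 * j, ?b := j, ?c := 0), out, i)"
      using j by (simp add: S_def min_def) linarith
    have d: "ev x (Dec ?a) (S j) 1 (?\<rho>, out, i)"
      unfolding S_j using j by (intro ev_Dec) (auto simp: fun_eq_iff)
    have e: "ev x (If (NZ ?a) (Seq (Dec ?a) (Inc ?b)) (Inc ?c)) (?\<rho>, out, i) 3 (S (Suc j))"
    proof (cases "m = 2 * j + 1")
      case True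
      have "ev x (If (NZ ?a) (Seq (Dec ?a) (Inc ?b)) (Inc ?c)) (?\<rho>, out, i) (1 + 1) (S (Suc j))"
        unfolding S_def using True by (intro ev_If_False ev_Inc) (auto simp: fun_eq_iff)
      then show ?thesis by (rule ev_mono) simp
    next
      case False
      then have "2 * j + 2 \<le> m" using j by simp
      then have "ev x (If (NZ ?a) (Seq (Dec ?a) (Inc ?b)) (Inc ?c)) (?\<rho>, out, i) (1 + (1 + 1)) (S (Suc j))"
        unfolding S_def by (intro ev_If_True ev_Seq[OF ev_Dec[OF _ refl] ev_Inc]) (auto simp: fun_eq_iff)
      then show ?thesis by (rule ev_mono) simp
    qed
    show "ev x (Seq (Dec ?a) (If (NZ ?a) (Seq (Dec ?a) (Inc ?b)) (Inc ?c))) (S j) 4 (S (Suc j))"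
      using ev_Seq[OF d e] by (rule ev_mono) simp
  next
    show "\<not> holds x (NZ ?a) (S n)" by (simp add: S_def n_def)
    fix j assume "j < n"
    then have j: "2 * j < m" by (auto simp: n_def)
    then show "holds x (NZ ?a) (S j)" by (simp add: S_def)
  qed simp
  have Sn: "S n = (\<rho>(?a := 0, ?b := m div 2, ?c := m mod 2), out, i)"
    by (cases "even m") (auto simp: S_def n_def fun_eq_iff elim!: evenE oddE)
  let ?\<rho> = "\<rho>(?a := 0, ?b := m div 2)"
  have 2: "ev x (If (NZ ?c) (Seq (Dec ?c) (Emit True)) (Emit False)) (\<rho>(?a := 0, ?b := m div 2, ?c := m mod 2), out @ [True], i)
      3 (?\<rho>, (out @ [True]) @ [odd m], i)"
  proof (cases "even m")
    case True
    have "ev x (If (NZ ?c) (Seq (Dec ?c) (Emit True)) (Emit False)) (?\<rho>, out @ [True], i)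
      (1 + 1) (?\<rho>, (out @ [True]) @ [False], i)"
      using assms by (intro ev_If_False ev_Emit) auto
    moreover have "\<rho>(?a := 0, ?b := m div 2, ?c := m mod 2) = ?\<rho>"
      using True assms by (auto simp: fun_eq_iff)
    ultimately show ?thesis using True by (auto elim!: ev_mono)
  next
    case False
    have "ev x (If (NZ ?c) (Seq (Dec ?c) (Emit True)) (Emit False))
      (\<rho>(?a := 0, ?b := m div 2, ?c := 1), out @ [True], i)
      (1 + (1 + 1)) (?\<rho>, (out @ [True]) @ [True], i)"
      using assms by (intro ev_If_True ev_Seq[OF ev_Dec ev_Emit]) (auto simp: fun_eq_iff)
    then show ?thesis using False by (auto simp: odd_iff_mod_2_eq_one elim!: ev_mono)
  qed
  define S' where "S' j = (\<rho>(?a := j, ?b := m div 2 - j), out @ [True, odd m], i)" for j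
  have 3: "ev x (While (NZ ?b) (Seq (Dec ?b) (Inc ?a))) (?\<rho>, out @ [True, odd m], i)
      (m div 2 * (2 + 1) + 1) (S' (m div 2))"
  proof (rule ev_While'[of _ S'])
    show "(?\<rho>, out @ [True, odd m], i) = S' 0" by (simp add: S'_def)
    fix j assume j: "j < m div 2"
    have "ev x (Seq (Dec ?b) (Inc ?a)) (S' j) (1 + 1) (S' (Suc j))"
      unfolding S'_def using j by (intro ev_Seq[OF ev_Dec[OF _ refl] ev_Inc]) (auto simp: fun_eq_iff)
    then show "ev x (Seq (Dec ?b) (Inc ?a)) (S' j) 2 (S' (Suc j))" by (rule ev_mono) simp
  qed (auto simp: S'_def)
  have fin: "S' (m div 2) = (\<rho>(?a := m div 2), out @ [True, odd m], i)"
    using assms by (auto simp: S'_def fun_eq_iff)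
  have "ev x (halve k) (\<rho>, out, i) ((n * (4 + 1) + 1) + (1 + (3 + (m div 2 * (2 + 1) + 1)))) (S' (m div 2))"
    unfolding halve_def using 1 2 3 unfolding Sn by (intro ev_Seq[OF _ ev_Seq[OF ev_Emit ev_Seq]]) auto
  moreover have "(n * (4 + 1) + 1) + (1 + (3 + (m div 2 * (2 + 1) + 1))) \<le> 9 * X + 9"
    using assms(4) by (simp add: n_def)
  ultimately show ?thesis unfolding fin by (rule ev_mono)
qed

text \<open>The number of rounds is bounded by \<open>m\<close> instead of its bit length. This is
  harmless, since printed values are polynomial in the input length.\<close>

lemma ev_emit_bits:
  assumes "\<rho> (sreg (k + 1)) = 0" "\<rho> (sreg (k + 2)) = 0" "\<rho> (sreg k) = m" "m \<le> X"
  shows "ev x (Seq (While (NZ (sreg k)) (halve k)) (Emit False)) (\<rho>, out, i)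
    (m * (9 * X + 10) + 2) (\<rho>(sreg k := 0), out @ enc_nat m, i)"
proof -
  \<comment> \<open>The loop prints all of the encoding except the closing flag, which the final
    \<open>Emit\<close> supplies.\<close>
  have "\<exists>out'. out @ enc_nat m = out' @ [False] \<and>
      ev x (While (NZ (sreg k)) (halve k)) (\<rho>, out, i) (m * (9 * X + 10) + 1) (\<rho>(sreg k := 0), out', i)"
    using assms
  proof (induction m arbitrary: \<rho> out rule: less_induct)
    case (less m)
    show ?case
    proof (cases "m = 0")
      case True
      then have "\<rho> = \<rho>(sreg k := 0)" using less.prems by (auto simp: fun_eq_iff)
      then have "ev x (While (NZ (sreg k)) (halve k)) (\<rho>, out, i) 1 (\<rho>(sreg k := 0), out, i)"
        using ev_While_False[of x "NZ (sreg k)" "(\<rho>, out, i)" "halve k"] True less.prems by simp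
      then show ?thesis using True by (simp add: enc_nat_rec[of 0] del: fun_upd_apply)
    next
      case False
      let ?\<rho> = "\<rho>(sreg k := m div 2)" and ?out = "out @ [True, odd m]"
      obtain out' where out': "?out @ enc_nat (m div 2) = out' @ [False]"
        and ev: "ev x (While (NZ (sreg k)) (halve k)) (?\<rho>, ?out, i) (m div 2 * (9 * X + 10) + 1) (?\<rho>(sreg k := 0), out', i)"
        using less.IH[of "m div 2" ?\<rho> ?out] False less.prems le_trans[OF div_le_dividend less.prems(4)]
        by (auto simp del: fun_upd_apply simp: fun_upd_same fun_upd_other)
      have "out @ enc_nat m = out' @ [False]"
        using out' False by (subst enc_nat_rec) simp
      moreover have "ev x (While (NZ (sreg k)) (halve k)) (\<rho>, out, i)
          (1 + (9 * X + 9) + (m div 2 * (9 * X + 10) + 1)) (?\<rho>(sreg k := 0), out', i)"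
        using False less.prems by (intro ev_While_True[OF _ ev_halve[OF less.prems] ev]) simp
      moreover have "1 + (9 * X + 9) + (m div 2 * (9 * X + 10) + 1) \<le> m * (9 * X + 10) + 1"
      proof -
        have "(m div 2 + 1) * (9 * X + 10) \<le> m * (9 * X + 10)"
          using False by (intro mult_right_mono) auto
        then show ?thesis by (simp add: algebra_simps)
      qed
      ultimately show ?thesis by (auto simp del: fun_upd_apply elim!: ev_mono)
    qed
  qed
  then obtain out' where out': "out @ enc_nat m = out' @ [False]"
    "ev x (While (NZ (sreg k)) (halve k)) (\<rho>, out, i) (m * (9 * X + 10) + 1) (\<rho>(sreg k := 0), out', i)"
    by blast
  have "ev x (Seq (While (NZ (sreg k)) (halve k)) (Emit False)) (\<rho>, out, i)
    (m * (9 * X + 10) + 1 + 1) (\<rho>(sreg k := 0), out' @ [False], i)"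
    by (rule ev_Seq[OF out'(2) ev_Emit])
  then show ?thesis using out'(1) by (simp add: algebra_simps)
qed

definition emits :: "nat \<Rightarrow> (nat \<Rightarrow> com) \<Rightarrow> ((nat \<Rightarrow> nat) \<Rightarrow> bool list) \<Rightarrow> nat poly \<Rightarrow> bool" where
  "emits d c g P \<longleftrightarrow> (\<forall>x k \<rho> out i X. (\<forall>j\<ge>k. \<rho> (sreg j) = 0) \<longrightarrow> (\<forall>v<d. vars \<rho> v \<le> X) \<longrightarrow>
    ev x (c k) (\<rho>, out, i) (poly P X) (\<rho>, out @ g (vars \<rho>), i))"

lemma emitsI:
  assumes "\<And>x k \<rho> out i X. \<forall>j\<ge>k. \<rho> (sreg j) = 0 \<Longrightarrow> \<forall>v<d. vars \<rho> v \<le> X \<Longrightarrow>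
    ev x (c k) (\<rho>, out, i) (poly P X) (\<rho>, out @ g (vars \<rho>), i)"
  shows "emits d c g P"
  unfolding emits_def using assms by blast

lemma emitsD:
  assumes "emits d c g P" "\<forall>j\<ge>k. \<rho> (sreg j) = 0" "\<forall>v<d. vars \<rho> v \<le> X"
  shows "ev x (c k) (\<rho>, out, i) (poly P X) (\<rho>, out @ g (vars \<rho>), i)"
  using assms unfolding emits_def by blast

lemma ev_emit_leaf:
  assumes "wf_leaf d l"
  shows "\<exists>P. emits d (\<lambda>k. emit_leaf k l) (leaf_out l) P"
proof (cases l)
  case (Out bs)
  have "emits d (\<lambda>k. emit_leaf k l) (leaf_out l) [:length bs + 2:]"
    using ev_emit_Out[of _ bs] by (intro emitsI) (simp add: Out)
  then show ?thesis ..
next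
  case (Pow p)
  then have b: "below d p" using assms by simp
  obtain P Q where P: "adds d p P" and Q: "val_le d p Q"
    using add_to_bounds[OF b] by blast
  have "ev x (emit_leaf k l) (\<rho>, out, i) (poly P X + ((poly Q X * 4 + 1) + (1 + (1 + 1))))
      (\<rho>, out @ leaf_out l (vars \<rho>), i)"
    if h: "\<forall>j\<ge>k. \<rho> (sreg j) = 0" "\<forall>v<d. vars \<rho> v \<le> X" for x k \<rho> out i X
  proof -
    let ?n = "val p (vars \<rho>)"
    let ?\<rho> = "\<rho>(sreg k := ?n)"
    note 1 = adds_scratch[OF P h]
    have 2: "ev x (While (NZ (sreg k)) (Seq (Dec (sreg k)) (Seq (Emit True) (Emit False)))) (?\<rho>, out, i)
        (poly Q X * 4 + 1) (?\<rho>(sreg k := 0), out @ concat (replicate ?n [True, False]), i)"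
      using val_leD[OF Q h(2)] by (intro ev_mono[OF ev_emit_pow2]) auto
    have \<rho>: "?\<rho>(sreg k := 0) = \<rho>" using h by (auto simp: fun_eq_iff)
    show ?thesis
      unfolding Pow emit_leaf.simps leaf_out.simps enc_nat_pow2
      using ev_Seq[OF 1 ev_Seq[OF 2[unfolded \<rho>] ev_Seq[OF ev_Emit ev_Seq[OF ev_Emit ev_Emit]]]] by simp
  qed
  moreover have "poly (P + ((Q * [:4:] + [:1:]) + [:3:])) X =
      poly P X + ((poly Q X * 4 + 1) + (1 + (1 + 1)))" for X
    by simp
  ultimately have "emits d (\<lambda>k. emit_leaf k l) (leaf_out l) (P + ((Q * [:4:] + [:1:]) + [:3:]))"
    by (intro emitsI) (simp only:)
  then show ?thesis ..
next
  case (Bin p)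
  then have b: "below d p" using assms by simp
  obtain P Q where P: "adds d p P" and Q: "val_le d p Q"
    using add_to_bounds[OF b] by blast
  have "ev x (emit_leaf k l) (\<rho>, out, i) (poly P X + (poly Q X * (9 * poly Q X + 10) + 2))
      (\<rho>, out @ leaf_out l (vars \<rho>), i)"
    if h: "\<forall>j\<ge>k. \<rho> (sreg j) = 0" "\<forall>v<d. vars \<rho> v \<le> X" for x k \<rho> out i X
  proof -
    let ?n = "val p (vars \<rho>)"
    let ?\<rho> = "\<rho>(sreg k := ?n)"
    note 1 = adds_scratch[OF P h]
    have z: "\<rho> (sreg (k + 1)) = 0" "\<rho> (sreg (k + 2)) = 0"
      using h(1)[rule_format, of "k + 1"] h(1)[rule_format, of "k + 2"] by simp_all
    have 2: "ev x (Seq (While (NZ (sreg k)) (halve k)) (Emit False)) (?\<rho>, out, i)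
        (?n * (9 * poly Q X + 10) + 2) (?\<rho>(sreg k := 0), out @ enc_nat ?n, i)"
      using val_leD[OF Q h(2)] z by (intro ev_emit_bits) auto
    have "?n * (9 * poly Q X + 10) + 2 \<le> poly Q X * (9 * poly Q X + 10) + 2"
      using val_leD[OF Q h(2)] by (intro add_right_mono mult_right_mono) auto
    then have 3: "ev x (Seq (While (NZ (sreg k)) (halve k)) (Emit False)) (?\<rho>, out, i)
        (poly Q X * (9 * poly Q X + 10) + 2) (?\<rho>(sreg k := 0), out @ enc_nat ?n, i)"
      by (rule ev_mono[OF 2])
    have \<rho>: "?\<rho>(sreg k := 0) = \<rho>" using h by (auto simp: fun_eq_iff)
    show ?thesis
      unfolding Bin emit_leaf.simps leaf_out.simps
      using ev_Seq[OF 1 3] unfolding \<rho> .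
  qed
  moreover have "poly (P + (Q * ([:9:] * Q + [:10:]) + [:2:])) X =
      poly P X + (poly Q X * (9 * poly Q X + 10) + 2)" for X
    by simp
  ultimately have "emits d (\<lambda>k. emit_leaf k l) (leaf_out l) (P + (Q * ([:9:] * Q + [:10:]) + [:2:]))"
    by (intro emitsI) (simp only:)
  then show ?thesis ..
qed

lemma ev_emit_leaves:
  assumes "wf_leaves d ls"
  shows "\<exists>P. emits d (\<lambda>k. foldr (\<lambda>l. Seq (emit_leaf k l)) ls (skip k)) (leaves_out ls) P"
  using assms
proof (induction ls)
  case Nil
  have "emits d (\<lambda>k. foldr (\<lambda>l. Seq (emit_leaf k l)) [] (skip k)) (leaves_out []) [:2:]"
    using ev_skip by (intro emitsI) (simp add: leaves_out_def)
  then show ?case ..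
next
  case (Cons l ls)
  then obtain P P' where P: "emits d (\<lambda>k. emit_leaf k l) (leaf_out l) P"
      and P': "emits d (\<lambda>k. foldr (\<lambda>l. Seq (emit_leaf k l)) ls (skip k)) (leaves_out ls) P'"
    using ev_emit_leaf[of d l] by (auto simp: wf_leaves_def)
  have "emits d (\<lambda>k. foldr (\<lambda>l. Seq (emit_leaf k l)) (l # ls) (skip k)) (leaves_out (l # ls)) (P + P')"
  proof (rule emitsI)
    fix x k \<rho> out i X
    assume h: "\<forall>j\<ge>k. \<rho> (sreg j) = 0" "\<forall>v<d. vars \<rho> v \<le> X"
    from ev_Seq[OF emitsD[OF P h] emitsD[OF P' h]]
    show "ev x (foldr (\<lambda>l. Seq (emit_leaf k l)) (l # ls) (skip k)) (\<rho>, out, i) (poly (P + P') X)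
        (\<rho>, out @ leaves_out (l # ls) (vars \<rho>), i)"
      by (simp add: leaves_out_def)
  qed
  then show ?case ..
qed

text \<open>All counters and the input head come back to where they were, so that a loop can rerun
  its body with the two variables from \<open>d\<close> on as fresh ones.\<close>

definition compiles :: "nat \<Rightarrow> leaf list em \<Rightarrow> nat poly \<Rightarrow> bool" where
  "compiles d e P \<longleftrightarrow> (\<forall>x k \<rho> out X. (\<forall>v\<ge>d. vars \<rho> v = 0) \<longrightarrow> (\<forall>j\<ge>k. \<rho> (sreg j) = 0) \<longrightarrow>
    (\<forall>v<d. vars \<rho> v \<le> X) \<longrightarrow>
    ev x (compile d k e) (\<rho>, out, 0) (poly P X) (\<rho>, out @ sem leaves_out x d e (vars \<rho>), 0))"

lemma compilesD:
  assumes "compiles d e P" "\<forall>v\<ge>d. vars \<rho> v = 0" "\<forall>j\<ge>k. \<rho> (sreg j) = 0" "\<forall>v<d. vars \<rho> v \<le> X"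
  shows "ev x (compile d k e) (\<rho>, out, 0) (poly P X) (\<rho>, out @ sem leaves_out x d e (vars \<rho>), 0)"
  using assms unfolding compiles_def by blast

lemma ev_compile:
  assumes "wf_em wf_leaves d e"
  shows "\<exists>P. compiles d e P"
  using assms
proof (induction e arbitrary: d)
  case (Leaf ls)
  then obtain P where P: "emits d (\<lambda>k. foldr (\<lambda>l. Seq (emit_leaf k l)) ls (skip k)) (leaves_out ls) P"
    using ev_emit_leaves[of d ls] by auto
  have "compiles d (Leaf ls) P"
    unfolding compiles_def compile.simps sem.simps using emitsD[OF P] by blast
  then show ?case ..
next
  case (Cat e e')
  then obtain P where P: "compiles d e P"
    by auto
  from Cat obtain P' where P': "compiles d e' P'"
    by auto
  have "compiles d (Cat e e') (P + P')"
    unfolding compiles_def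
  proof (intro allI impI)
    fix x k \<rho> out X
    assume h: "\<forall>v\<ge>d. vars \<rho> v = 0" "\<forall>j\<ge>k. \<rho> (sreg j) = 0" "\<forall>v<d. vars \<rho> v \<le> X"
    from ev_Seq[OF compilesD[OF P h] compilesD[OF P' h]]
    show "ev x (compile d k (Cat e e')) (\<rho>, out, 0) (poly (P + P') X)
        (\<rho>, out @ sem leaves_out x d (Cat e e') (vars \<rho>), 0)"
      by simp
  qed
  then show ?case ..
next
  case (Rep p e)
  then have b: "below d p" and wf: "wf_em wf_leaves (d + 2) e" by auto
  obtain P Q where P: "adds d p P" and Q: "val_le d p Q"
    using add_to_bounds[OF b] by blast
  obtain P' where P': "compiles (d + 2) e P'"
    using Rep.IH[OF wf] by blast
  \<comment> \<open>Inside the loop the new variables are bounded by the number of rounds, itself a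
    polynomial in \<open>X\<close>; hence the composition of polynomials in the final bound.\<close>
  define B where "B X = poly P' (X + poly Q X)" for X
  have "ev x (compile d k (Rep p e)) (\<rho>, out, 0)
      (poly P X + ((poly Q X * (1 + (B X + 1) + 1) + 1) + (poly Q X * (1 + 1) + 1)))
      (\<rho>, out @ sem leaves_out x d (Rep p e) (vars \<rho>), 0)"
    if h: "\<forall>v\<ge>d. vars \<rho> v = 0" "\<forall>j\<ge>k. \<rho> (sreg j) = 0" "\<forall>v<d. vars \<rho> v \<le> X" for x k \<rho> out X
  proof -
    let ?n = "val p (vars \<rho>)" and ?i = "vreg d" and ?r = "vreg (Suc d)"
    let ?\<rho> = "\<lambda>j. \<rho>(?i := j, ?r := ?n - Suc j)"
    let ?s = "\<lambda>j. sem leaves_out x (d + 2) e ((vars \<rho>)(d := j, Suc d := ?n - Suc j))"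
    have n: "?n \<le> poly Q X" by (rule val_leD[OF Q h(3)])
    have z: "\<rho> ?i = 0" "\<rho> ?r = 0"
      using h(1)[rule_format, of d] h(1)[rule_format, of "Suc d"] by (simp_all add: vars_def)
    define S where "S j = (\<rho>(?i := j, ?r := ?n - j), out @ concat (map ?s [0..<j]), 0 :: int)" for j
    have "ev x (add_to k p ?r) (\<rho>, out, 0) (poly P X) (\<rho>(?r := \<rho> ?r + ?n), out, 0)"
      using h by (intro addsD[OF P]) auto
    moreover have "(\<rho>(?r := \<rho> ?r + ?n), out, 0) = S 0"
      using z by (auto simp: S_def fun_eq_iff)
    ultimately have 1: "ev x (add_to k p ?r) (\<rho>, out, 0) (poly P X) (S 0)" by simp
    have 2: "ev x (While (NZ ?r) (Seq (Dec ?r) (Seq (compile (d + 2) k e) (Inc ?i)))) (S 0)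
        (?n * (1 + (B X + 1) + 1) + 1) (S ?n)"
    proof (rule ev_While)
      fix j assume j: "j < ?n"
      have v: "vars (?\<rho> j) = (vars \<rho>)(d := j, Suc d := ?n - Suc j)"
        by (simp del: mult_Suc_right)
      have "ev x (compile (d + 2) k e) (?\<rho> j, out @ concat (map ?s [0..<j]), 0) (B X)
          (?\<rho> j, (out @ concat (map ?s [0..<j])) @ sem leaves_out x (d + 2) e (vars (?\<rho> j)), 0)"
        unfolding B_def
      proof (rule compilesD[OF P'])
        show "\<forall>v\<ge>d + 2. vars (?\<rho> j) v = 0" unfolding v using h(1) by auto
        show "\<forall>j'\<ge>k. ?\<rho> j (sreg j') = 0" using h(2) by (simp del: mult_Suc_right)
        show "\<forall>v<d + 2. vars (?\<rho> j) v \<le> X + poly Q X"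
          unfolding v using h(3) j n by (auto simp: less_Suc_eq intro: trans_le_add1)
      qed
      then have c: "ev x (compile (d + 2) k e) (?\<rho> j, out @ concat (map ?s [0..<j]), 0) (B X)
          (?\<rho> j, out @ concat (map ?s [0..<Suc j]), 0)"
        unfolding v by simp
      have "ev x (Dec ?r) (S j) 1 (?\<rho> j, out @ concat (map ?s [0..<j]), 0)"
        unfolding S_def using j by (intro ev_Dec) (auto simp: fun_eq_iff)
      moreover have "ev x (Inc ?i) (?\<rho> j, out @ concat (map ?s [0..<Suc j]), 0) 1 (S (Suc j))"
        unfolding S_def by (intro ev_Inc) (auto simp: fun_eq_iff)
      ultimately show "ev x (Seq (Dec ?r) (Seq (compile (d + 2) k e) (Inc ?i))) (S j)
          (1 + (B X + 1)) (S (Suc j))"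
        using c by (intro ev_Seq)
    qed (auto simp: S_def)
    define S' where "S' j = (\<rho>(?i := ?n - j), out @ concat (map ?s [0..<?n]), 0 :: int)" for j
    have 3: "ev x (While (NZ ?i) (Dec ?i)) (S ?n) (?n * (1 + 1) + 1) (S' ?n)"
    proof (rule ev_While'[of _ S'])
      show "S ?n = S' 0" using z by (auto simp: S_def S'_def fun_eq_iff)
      show "ev x (Dec ?i) (S' j) 1 (S' (Suc j))" if "j < ?n" for j
        unfolding S'_def using that by (intro ev_Dec) (auto simp: fun_eq_iff)
    qed (auto simp: S'_def)
    have fin: "S' ?n = (\<rho>, out @ sem leaves_out x d (Rep p e) (vars \<rho>), 0)"
      using z by (auto simp: S'_def fun_eq_iff)
    have "ev x (compile d k (Rep p e)) (\<rho>, out, 0)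
      (poly P X + ((?n * (1 + (B X + 1) + 1) + 1) + (?n * (1 + 1) + 1))) (S' ?n)"
      unfolding compile.simps by (rule ev_Seq[OF 1 ev_Seq[OF 2 3]])
    moreover have "poly P X + ((?n * (1 + (B X + 1) + 1) + 1) + (?n * (1 + 1) + 1)) \<le>
        poly P X + ((poly Q X * (1 + (B X + 1) + 1) + 1) + (poly Q X * (1 + 1) + 1))"
      using n by (intro add_mono mult_right_mono order_refl) auto
    ultimately show ?thesis unfolding fin by (rule ev_mono)
  qed
  moreover have P_eq: "poly (P + ((Q * ([:1:] + (pcompose P' ([:0, 1:] + Q) + [:1:]) + [:1:]) + [:1:]) +
         (Q * [:1 + 1:] + [:1:]))) X = poly P X + ((poly Q X * (1 + (B X + 1) + 1) + 1) + (poly Q X * (1 + 1) + 1))" for X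
    by (simp add: poly_pcompose B_def)
  ultimately show ?case
    by (intro exI[of _ "P + ((Q * ([:1:] + (pcompose P' ([:0, 1:] + Q) + [:1:]) + [:1:]) + [:1:]) +
         (Q * [:1 + 1:] + [:1:]))"]) (simp only: compiles_def P_eq, blast)
next
  case (If_Bit v e e')
  then have v: "v < d" by simp
  from If_Bit obtain P where P: "compiles d e P"
    by auto
  from If_Bit obtain P' where P': "compiles d e' P'"
    by auto
  have "ev x (compile d k (If_Bit v e e')) (\<rho>, out, 0)
      ((X * (3 + 1) + 1) + ((1 + 2) + ((X * (3 + 1) + 1) + (1 + (1 + (poly P X + poly P' X))))))
      (\<rho>, out @ sem leaves_out x d (If_Bit v e e') (vars \<rho>), 0)"
    if h: "\<forall>v\<ge>d. vars \<rho> v = 0" "\<forall>j\<ge>k. \<rho> (sreg j) = 0" "\<forall>v<d. vars \<rho> v \<le> X" for x k \<rho> out X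
  proof -
    let ?n = "vars \<rho> v" and ?v = "vreg v" and ?a = "sreg k" and ?b = "sreg (Suc k)"
    define bit where "bit \<longleftrightarrow> ?n < length x \<and> x ! ?n"
    have n: "?n \<le> X" using v h(3) by blast
    have z: "\<rho> ?a = 0" "\<rho> ?b = 0" using h(2)[rule_format, of k] h(2)[rule_format, of "Suc k"] by simp_all
    define S where "S j = (\<rho>(?v := ?n - j, ?a := j), out, int j)" for j
    have "ev x (While (NZ ?v) (Seq (Dec ?v) (Seq (Inc ?a) In_Right))) (\<rho>, out, 0) (?n * (3 + 1) + 1) (S ?n)"
    proof (rule ev_While'[of _ S])
      show "(\<rho>, out, 0) = S 0" using z by (auto simp: S_def vars_def fun_eq_iff)
      fix j assume j: "j < ?n"
      have "ev x (Seq (Dec ?v) (Seq (Inc ?a) In_Right)) (S j) (1 + (1 + 1)) (S (Suc j))"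
        unfolding S_def using j
        by (intro ev_Seq[OF ev_Dec[OF _ refl] ev_Seq[OF ev_Inc ev_In_Right]]) (auto simp: fun_eq_iff)
      then show "ev x (Seq (Dec ?v) (Seq (Inc ?a) In_Right)) (S j) 3 (S (Suc j))"
        by (rule ev_mono) simp
    qed (auto simp: S_def)
    then have 1: "ev x (While (NZ ?v) (Seq (Dec ?v) (Seq (Inc ?a) In_Right))) (\<rho>, out, 0) (X * (3 + 1) + 1) (S ?n)"
      by (rule ev_mono) (use n in simp)
    define S' where "S' j = (\<rho>(?v := j, ?a := ?n - j, ?b := of_bool bit), out, int (?n - j))" for j
    have one: "holds x In_One (S ?n) \<longleftrightarrow> bit"
      by (auto simp: S_def bit_def contents_def)
    have 2: "ev x (If In_One (Inc ?b) (skip k)) (S ?n) (1 + 2) (S' 0)"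
    proof (cases bit)
      case True
      have "ev x (If In_One (Inc ?b) (skip k)) (S ?n) (1 + 1) (S' 0)"
      proof (rule ev_If_True)
        show "ev x (Inc ?b) (S ?n) 1 (S' 0)"
          unfolding S_def S'_def diff_zero using True z by (intro ev_Inc) (auto simp: fun_eq_iff)
      qed (use True one in simp)
      then show ?thesis by (rule ev_mono) simp
    next
      case False
      have "S ?n = S' 0" using False z by (auto simp: S_def S'_def fun_eq_iff)
      moreover have "ev x (skip k) (S ?n) 2 (S ?n)" unfolding S_def by (rule ev_skip)
      ultimately show ?thesis using one False by (intro ev_If_False) auto
    qed
    have "ev x (While (NZ ?a) (Seq (Dec ?a) (Seq (Inc ?v) In_Left))) (S' 0) (?n * (3 + 1) + 1) (S' ?n)"
    proof (rule ev_While)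
      fix j assume j: "j < ?n"
      have "?v \<noteq> Suc (Suc (sreg k))" by presburger
      then have "ev x (Seq (Dec ?a) (Seq (Inc ?v) In_Left)) (S' j) (1 + (1 + 1)) (S' (Suc j))"
        unfolding S'_def using j
        by (intro ev_Seq[OF ev_Dec[OF _ refl] ev_Seq[OF ev_Inc ev_In_Left]])
          (auto simp: fun_eq_iff)
      then show "ev x (Seq (Dec ?a) (Seq (Inc ?v) In_Left)) (S' j) 3 (S' (Suc j))"
        by (rule ev_mono) simp
    qed (auto simp: S'_def)
    then have 3: "ev x (While (NZ ?a) (Seq (Dec ?a) (Seq (Inc ?v) In_Left))) (S' 0) (X * (3 + 1) + 1) (S' ?n)"
      by (rule ev_mono) (use n in simp)
    have fin: "S' ?n = (\<rho>(?b := of_bool bit), out, 0)"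
      using z by (auto simp: S'_def fun_eq_iff vars_def)
    have 4: "ev x (If (NZ ?b) (Seq (Dec ?b) (compile d k e)) (compile d k e')) (S' ?n)
        (1 + (1 + (poly P X + poly P' X))) (\<rho>, out @ sem leaves_out x d (If_Bit v e e') (vars \<rho>), 0)"
    proof (cases bit)
      case True
      have "ev x (If (NZ ?b) (Seq (Dec ?b) (compile d k e)) (compile d k e')) (S' ?n)
          (1 + (1 + poly P X)) (\<rho>, out @ sem leaves_out x d e (vars \<rho>), 0)"
        unfolding fin
      proof (rule ev_If_True[OF _ ev_Seq[OF _ compilesD[OF P h]]])
        show "ev x (Dec ?b) (\<rho>(?b := of_bool bit), out, 0) 1 (\<rho>, out, 0)"
          using True z by (intro ev_Dec) (auto simp: fun_eq_iff)
      qed (use True in simp)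
      then show ?thesis using True by (auto simp: bit_def elim!: ev_mono)
    next
      case False
      then have "\<rho>(?b := of_bool bit) = \<rho>" using z by (auto simp: fun_eq_iff)
      then have "ev x (If (NZ ?b) (Seq (Dec ?b) (compile d k e)) (compile d k e')) (S' ?n)
          (1 + poly P' X) (\<rho>, out @ sem leaves_out x d e' (vars \<rho>), 0)"
        unfolding fin using z compilesD[OF P' h] by (intro ev_If_False) auto
      then show ?thesis using False by (auto simp: bit_def elim!: ev_mono)
    qed
    show ?thesis
      unfolding compile.simps by (rule ev_Seq[OF 1 ev_Seq[OF 2 ev_Seq[OF 3 4]]])
  qed
  moreover have P_eq: "poly ([:7, 8:] + P + P') X =
      (X * (3 + 1) + 1) + ((1 + 2) + ((X * (3 + 1) + 1) + (1 + (1 + (poly P X + poly P' X)))))" for X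
    by simp
  ultimately show ?case
    by (intro exI[of _ "[:7, 8:] + P + P'"]) (simp only: compiles_def P_eq, blast)
qed

text \<open>Provides variable \<open>0\<close>, the input length. Apart from loop indices it is the
  only variable on which the numbers of the instance depend.\<close>

definition count_input :: com where
  "count_input =
     Seq (While In_Nonblank (Seq (Inc 0) In_Right))
    (Seq In_Left (Seq (While In_Nonblank In_Left) In_Right))"

lemma ev_count_input:
  "ev x count_input (\<lambda>_. 0, [], 0) (5 * length x + 4) ((\<lambda>_. 0)(0 := length x), [], 0)"
proof -
  let ?n = "length x"
  define S :: "nat \<Rightarrow> state" where "S j = ((\<lambda>_. 0)(0 := j), [], int j)" for j
  have 1: "ev x (While In_Nonblank (Seq (Inc 0) In_Right)) (\<lambda>_. 0, [], 0) (?n * (2 + 1) + 1) (S ?n)"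
  proof (rule ev_While'[of _ S])
    fix j assume j: "j < ?n"
    show "holds x In_Nonblank (S j)" using j by (simp add: S_def contents_def)
    have "ev x (Seq (Inc 0) In_Right) (S j) (1 + 1) (S (Suc j))"
      unfolding S_def by (intro ev_Seq[OF ev_Inc ev_In_Right]) (auto simp: fun_eq_iff)
    then show "ev x (Seq (Inc 0) In_Right) (S j) 2 (S (Suc j))" by (rule ev_mono) simp
  qed (auto simp: S_def contents_def fun_eq_iff)
  define S' :: "nat \<Rightarrow> state" where "S' j = ((\<lambda>_. 0)(0 := ?n), [], int ?n - 1 - int j)" for j
  have 2: "ev x In_Left (S ?n) 1 (S' 0)"
    unfolding S_def S'_def by (rule ev_In_Left) simp
  have 3: "ev x (While In_Nonblank In_Left) (S' 0) (?n * (1 + 1) + 1) (S' ?n)"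
  proof (rule ev_While)
    fix j assume j: "j < ?n"
    show "holds x In_Nonblank (S' j)" using j by (simp add: S'_def contents_def)
    show "ev x In_Left (S' j) 1 (S' (Suc j))"
      unfolding S'_def by (rule ev_In_Left) simp
  qed (simp add: S'_def contents_def)
  have 4: "ev x In_Right (S' ?n) 1 ((\<lambda>_. 0)(0 := ?n), [], 0)"
    unfolding S'_def by (rule ev_In_Right) simp
  show ?thesis
    unfolding count_input_def
    using ev_Seq[OF 1 ev_Seq[OF 2 ev_Seq[OF 3 4]]] by (rule ev_mono) simp
qed

definition input_env :: "bool list \<Rightarrow> nat \<Rightarrow> nat" where
  "input_env x = (\<lambda>_. 0)(0 := length x)"

theorem polytime_em:
  assumes "wf_em wf_leaves 1 e"
  shows "polytime 1 (\<lambda>xs. sem leaves_out (xs ! 0) 1 e (input_env (xs ! 0)))"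
proof -
  obtain P where P: "compiles 1 e P"
    using ev_compile[OF assms] by blast
  let ?c = "Seq count_input (compile 1 0 e)"
  have "\<exists>t \<le> poly ([:4, 5:] + P) (length x). \<exists>\<rho> i. big x ?c (\<lambda>_. 0, [], 0) t
      (\<rho>, sem leaves_out x 1 e (input_env x), i)" for x
  proof -
    have v: "vars ((\<lambda>_. 0)(0 := length x)) = input_env x"
      by (auto simp: vars_def input_env_def fun_eq_iff)
    have "ev x (compile 1 0 e) ((\<lambda>_. 0)(0 := length x), [], 0) (poly P (length x))
        ((\<lambda>_. 0)(0 := length x), [] @ sem leaves_out x 1 e (vars ((\<lambda>_. 0)(0 := length x))), 0)"
      by (rule compilesD[OF P]) (auto simp: vars_def)
    from ev_Seq[OF ev_count_input this]
    have "ev x ?c (\<lambda>_. 0, [], 0) (poly ([:4, 5:] + P) (length x))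
        ((\<lambda>_. 0)(0 := length x), sem leaves_out x 1 e (input_env x), 0)"
      unfolding v append_Nil by (rule ev_mono) simp
    then show ?thesis unfolding ev_def by blast
  qed
  then show ?thesis by (rule polytime_com)
qed

section \<open>From monotone clauses to page assignments\<close>

text \<open>
  Crossing and nesting are considered for a family of edges \<open>e t\<close>, \<open>t \<in> T\<close>, given by
  their left and right endpoints; page \<open>p\<close> is a stack if \<open>stk p\<close> and a queue otherwise.
\<close>

definition cross :: "('p \<Rightarrow> 'p \<Rightarrow> bool) \<Rightarrow> 'p \<times> 'p \<Rightarrow> 'p \<times> 'p \<Rightarrow> bool" where
  "cross lt e f \<longleftrightarrow> lt (fst e) (fst f) \<and> lt (fst f) (snd e) \<and> lt (snd e) (snd f)"

definition nest :: "('p \<Rightarrow> 'p \<Rightarrow> bool) \<Rightarrow> 'p \<times> 'p \<Rightarrow> 'p \<times> 'p \<Rightarrow> bool" where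
  "nest lt e f \<longleftrightarrow> lt (fst e) (fst f) \<and> lt (fst f) (snd f) \<and> lt (snd f) (snd e)"

definition pages ::
    "('p \<Rightarrow> 'p \<Rightarrow> bool) \<Rightarrow> nat \<Rightarrow> 't set \<Rightarrow> ('t \<Rightarrow> 'p \<times> 'p) \<Rightarrow> ('t \<Rightarrow> nat) \<Rightarrow> (nat \<Rightarrow> bool) \<Rightarrow> bool" where
  "pages lt k T e pg stk \<longleftrightarrow> (\<forall>t\<in>T. pg t < k) \<and>
     (\<forall>t\<in>T. \<forall>t'\<in>T. pg t = pg t' \<longrightarrow>
        (stk (pg t) \<longrightarrow> \<not> cross lt (e t) (e t')) \<and> (\<not> stk (pg t) \<longrightarrow> \<not> nest lt (e t) (e t')))"

text \<open>Crossing edges cannot share a stack, so the page function is injective on them.\<close>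

lemma pages_cross_bound:
  assumes "pages lt k T e pg stk" "S \<subseteq> T"
    and "\<And>t. t \<in> S \<Longrightarrow> stk (pg t)"
    and "\<And>t t'. t \<in> S \<Longrightarrow> t' \<in> S \<Longrightarrow> t \<noteq> t' \<Longrightarrow> cross lt (e t) (e t') \<or> cross lt (e t') (e t)"
  shows "card S \<le> card {p. p < k \<and> stk p}"
proof (rule card_inj_on_le)
  show "inj_on pg S"
    using assms unfolding inj_on_def pages_def by (metis subsetD)
  show "pg ` S \<subseteq> {p. p < k \<and> stk p}"
    using assms(1-3) by (auto simp: pages_def)
qed simp

lemma pages_nest_bound:
  assumes "pages lt k T e pg stk" "S \<subseteq> T"
    and "\<And>t. t \<in> S \<Longrightarrow> \<not> stk (pg t)"
    and "\<And>t t'. t \<in> S \<Longrightarrow> t' \<in> S \<Longrightarrow> t \<noteq> t' \<Longrightarrow> nest lt (e t) (e t') \<or> nest lt (e t') (e t)"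
  shows "card S \<le> card {p. p < k \<and> \<not> stk p}"
proof (rule card_inj_on_le)
  show "inj_on pg S"
    using assms unfolding inj_on_def pages_def by (metis subsetD)
  show "pg ` S \<subseteq> {p. p < k \<and> \<not> stk p}"
    using assms(1-3) by (auto simp: pages_def)
qed simp

lemma comparable_image:
  fixes n :: nat
  assumes "\<And>i i'. i < i' \<Longrightarrow> i' < n \<Longrightarrow> N (h i) (h i')"
    and "t \<in> h ` {..<n}" "t' \<in> h ` {..<n}" "t \<noteq> t'"
  shows "N t t' \<or> N t' t"
proof -
  obtain i i' where "i < n" "i' < n" "i \<noteq> i'" "t = h i" "t' = h i'"
    using assms(2-4) by blast
  then show ?thesis using assms(1) by (cases "i < i'") auto
qed

lemma comparable_Un3:
  assumes "\<forall>t\<in>A. \<forall>t'\<in>A. t \<noteq> t' \<longrightarrow> N t t' \<or> N t' t" "\<forall>t\<in>A. \<forall>t'\<in>B. N t t'"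
    "\<forall>t\<in>B. \<forall>t'\<in>B. t \<noteq> t' \<longrightarrow> N t t' \<or> N t' t" "\<forall>t\<in>C. \<forall>t'\<in>A. N t t'" "\<forall>t\<in>C. \<forall>t'\<in>B. N t t'"
    "\<forall>t\<in>C. \<forall>t'\<in>C. t \<noteq> t' \<longrightarrow> N t t' \<or> N t' t"
    and "t \<in> A \<union> B \<union> C" "t' \<in> A \<union> B \<union> C" "t \<noteq> t'"
  shows "N t t' \<or> N t' t"
  using assms by blast

section \<open>The gadgets for monotone clauses\<close>

text \<open>The first component is the region: \<open>0\<close> for \<open>Base\<close>,
  \<open>1\<close> for the segments of the variables, \<open>2\<close> for those of the clauses,
  \<open>3\<close> for the right ends of \<open>Above\<close>. In regions \<open>1\<close> and
  \<open>2\<close> the second component is the segment and the third a zone within it.\<close>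

type_synonym key = "nat \<times> nat \<times> nat \<times> nat \<times> nat"

fun key_less :: "key \<Rightarrow> key \<Rightarrow> bool" where
  "key_less (r, a, b, c, d) (r', a', b', c', d') \<longleftrightarrow>
     r < r' \<or> r = r' \<and> (a < a' \<or> a = a' \<and> (b < b' \<or> b = b' \<and> (c < c' \<or> c = c' \<and> d < d')))"

datatype tag =
    Base nat nat
  | Wire nat nat
  | Below nat nat nat
  | Above nat nat
  | Fill nat nat nat

text \<open>Clauses below \<open>mp\<close> are positive, the others negative. They form a subset of
  \<open>{..<m}\<close> since the numbering used later has gaps.\<close>

locale monotone_cnf =
  fixes V m mp W :: nat and Cl :: "nat set" and vr :: "nat \<Rightarrow> nat \<Rightarrow> nat"
  assumes W_pos: "0 < W" and Cl: "Cl \<subseteq> {..<m}"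
    and vr_less: "\<And>c l. c \<in> Cl \<Longrightarrow> l < W \<Longrightarrow> vr c l < V"
begin

text \<open>False wires get the stacks \<open>c * W + l\<close>, up to \<open>m * W\<close> of them.
  The filler columns at a clause have to avoid the stacks of its false wires, at most
  \<open>W - 1\<close> if the clause is satisfied, which gives \<open>s\<close>. If all
  \<open>W\<close> wires were on stacks, \<open>fil + W\<close> crossing edges would be one too
  many.\<close>

definition fil :: nat where "fil = m * W"
definition s :: nat where "s = fil + (W - 1)"
definition k :: nat where "k = s + V"

definition sat :: "(nat \<Rightarrow> bool) \<Rightarrow> bool" where
  "sat \<alpha> \<longleftrightarrow> (\<forall>c\<in>Cl. \<exists>l<W. \<alpha> (vr c l) \<longleftrightarrow> c < mp)"

text \<open>
  \<open>Base\<close>: \<open>s\<close> crossing columns of \<open>k + 1\<close> nested edges each. \<open>Fill\<close>: the same with \<open>fil\<close>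
  columns, crossing the wires that end at clause \<open>c\<close>. \<open>Below\<close> and \<open>Above\<close>: for each variable,
  \<open>V - 1\<close> nested columns of \<open>k + 1\<close> crossing edges, below resp. above its wires (the columns
  above are shared with the other variables). All negative wires of a variable nest
  all its positive wires.
\<close>

fun edge :: "tag \<Rightarrow> key \<times> key" where
  "edge (Base i j) = ((0, 0, 0, i, j), (0, 0, 1, i, k - j))"
| "edge (Wire c l) = ((1, vr c l, if c < mp then 1 else 0, c, l), (2, c, 1, vr c l, l))"
| "edge (Below v i j) = ((1, v, 2, i, j), (1, v, 3, V - Suc v - Suc i, j))"
| "edge (Above v j) = ((1, v, 4, 0, j), (3, V - Suc v, 0, 0, j))"
| "edge (Fill c i j) = ((2, c, 0, i, j), (2, c, 2, i, k - j))"

definition tags :: "tag set" where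
  "tags = {Base i j | i j. i < s \<and> j < Suc k} \<union> {Wire c l | c l. c \<in> Cl \<and> l < W} \<union>
     {Below v i j | v i j. v < V \<and> i < V - Suc v \<and> j < Suc k} \<union> {Above v j | v j. v < V \<and> j < Suc k} \<union>
     {Fill c i j | c i j. c \<in> Cl \<and> i < fil \<and> j < Suc k}"

lemma tags_iff [simp]:
  "Base i j \<in> tags \<longleftrightarrow> i < s \<and> j < Suc k"
  "Wire c l \<in> tags \<longleftrightarrow> c \<in> Cl \<and> l < W"
  "Below v i j \<in> tags \<longleftrightarrow> v < V \<and> i < V - Suc v \<and> j < Suc k"
  "Above v j \<in> tags \<longleftrightarrow> v < V \<and> j < Suc k"
  "Fill c i j \<in> tags \<longleftrightarrow> c \<in> Cl \<and> i < fil \<and> j < Suc k"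
  by (auto simp: tags_def)

text \<open>Queue \<open>s + v\<close> takes the true wires of \<open>v\<close>, which have one sign
  and so cross each other, together with \<open>Above v\<close>, which crosses them, and the columns
  \<open>Below v' i\<close> with \<open>v' + i + 1 = v\<close>, which lie to the left of both. On
  the stacks, only the fillers and the wires at the same clause can conflict, and the injection
  \<open>g\<close> separates them.\<close>

lemma sat_imp_pages:
  assumes "sat \<alpha>"
  shows "\<exists>pg stk. pages key_less k tags edge pg stk"
proof -
  define sel where "sel c l \<longleftrightarrow> (\<alpha> (vr c l) \<longleftrightarrow> c < mp)" for c l
  have sel: "\<exists>l<W. sel c l" if "c \<in> Cl" for c
    using assms that by (auto simp: sat_def sel_def)
  \<comment> \<open>Clause \<open>c\<close> has a true wire, so at most \<open>W - 1\<close> of the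
    \<open>s\<close> stacks are forbidden and \<open>fil\<close> remain for the filler
    columns.\<close>
  have "\<exists>g. inj_on g {..<fil} \<and> g ` {..<fil} \<subseteq> {..<s} - {c * W + l | l. l < W \<and> \<not> sel c l}"
    if c: "c \<in> Cl" for c
  proof -
    obtain l0 where l0: "l0 < W" "sel c l0" using sel[OF c] by blast
    have "{c * W + l | l. l < W \<and> \<not> sel c l} \<subseteq> (+) (c * W) ` ({..<W} - {l0})"
      using l0 by auto
    then have "card {c * W + l | l. l < W \<and> \<not> sel c l} \<le> card ((+) (c * W) ` ({..<W} - {l0}))"
      by (intro card_mono) auto
    also have "\<dots> \<le> W - 1"
      using l0 by (intro order.trans[OF card_image_le]) auto
    finally have "card {..<fil} \<le> card ({..<s} - {c * W + l | l. l < W \<and> \<not> sel c l})"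
      using diff_card_le_card_Diff[of "{c * W + l | l. l < W \<and> \<not> sel c l}" "{..<s}"]
      by (simp add: s_def)
    then show ?thesis
      using card_le_inj[of "{..<fil}" "{..<s} - {c * W + l | l. l < W \<and> \<not> sel c l}"]
      by auto
  qed
  then have "\<exists>g. \<forall>c\<in>Cl. inj_on (g c) {..<fil} \<and>
      g c ` {..<fil} \<subseteq> {..<s} - {c * W + l | l. l < W \<and> \<not> sel c l}"
    by (intro bchoice ballI)
  then obtain g where g: "\<And>c. c \<in> Cl \<Longrightarrow> inj_on (g c) {..<fil}"
      "\<And>c. c \<in> Cl \<Longrightarrow> g c ` {..<fil} \<subseteq> {..<s} - {c * W + l | l. l < W \<and> \<not> sel c l}"
    by blast
  have g_less: "g c i < s" if "c \<in> Cl" "i < fil" for c i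
    using g(2)[OF that(1)] that by auto
  have g_neq: "g c i \<noteq> c * W + l" if "c \<in> Cl" "i < fil" "l < W" "\<not> sel c l" for c i l
    using g(2)[OF that(1)] that by blast
  have g_inj: "i = i'" if "c \<in> Cl" "i < fil" "i' < fil" "g c i = g c i'" for c i i'
    using g(1)[OF that(1)] that by (auto simp: inj_on_def)
  have w_less: "c * W + l < s" if "c \<in> Cl" "l < W" for c l
  proof -
    have "c * W + l < Suc c * W" using that by simp
    also have "\<dots> \<le> m * W" using that Cl by (intro mult_right_mono) auto
    finally show ?thesis by (simp add: s_def fil_def)
  qed
  have w_inj: "c = c' \<and> l = l'" if "c * W + l = c' * W + l'" "l < W" "l' < W" for c c' l l'
  proof -
    have div: "(a * W + b) div W = a" if "b < W" for a b
      using that by simp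
    have "c = c'" using div[of l c] div[of l' c'] that by simp
    then show ?thesis using that(1) by simp
  qed
  define pg where "pg t = (case t of
       Base i j \<Rightarrow> i
     | Wire c l \<Rightarrow> if sel c l then s + vr c l else c * W + l
     | Below v i j \<Rightarrow> s + Suc (v + i)
     | Above v j \<Rightarrow> s + v
     | Fill c i j \<Rightarrow> g c i)" for t
  have "pages key_less k tags edge pg (\<lambda>p. p < s)"
    unfolding pages_def
  proof (intro conjI ballI impI)
    fix t assume "t \<in> tags"
    then show "pg t < k"
      by (cases t) (auto simp: pg_def k_def vr_less g_less w_less trans_less_add1)
  next
    fix t t' assume t: "t \<in> tags" "t' \<in> tags" "pg t = pg t'" "pg t < s"
    show "\<not> cross key_less (edge t) (edge t')"
    proof (cases t)
      case (Base i j)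
      then show ?thesis using t by (cases t') (auto simp: pg_def cross_def split: if_splits)
    next
      case (Wire c l)
      then show ?thesis using t
        by (cases t') (auto simp: pg_def cross_def g_neq[symmetric] dest: w_inj split: if_splits)
    next
      case (Below v i j)
      then show ?thesis using t by (cases t') (auto simp: pg_def)
    next
      case (Above v j)
      then show ?thesis using t by (cases t') (auto simp: pg_def)
    next
      case (Fill c i j)
      then show ?thesis using t
        by (cases t') (auto simp: pg_def cross_def g_neq dest: g_inj split: if_splits)
    qed
  next
    fix t t' assume t: "t \<in> tags" "t' \<in> tags" "pg t = pg t'" "\<not> pg t < s"
    have q: "(\<exists>c l. t = Wire c l \<and> (\<alpha> (vr c l) \<longleftrightarrow> c < mp) \<and> pg t = s + vr c l) \<or>
        (\<exists>v i j. t = Below v i j \<and> pg t = s + Suc (v + i)) \<or> (\<exists>v j. t = Above v j \<and> pg t = s + v)"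
      if "t \<in> tags" "\<not> pg t < s" for t
      using that by (cases t) (auto simp: pg_def g_less w_less sel_def split: if_splits)
    from t(4) have "\<not> pg t' < s" using t(3) by simp
    with q[OF t(1,4)] q[OF t(2)] t(3) show "\<not> nest key_less (edge t) (edge t')"
      by (elim disjE exE conjE) (auto simp: nest_def split: if_splits)
  qed
  then show ?thesis by blast
qed

text \<open>A variable is made true when one of its wires to positive clauses is on a queue; then a
  queue wire at a negative clause must belong to a false variable.\<close>

lemma pages_imp_sat:
  assumes pages: "pages key_less k tags edge pg stk"
  shows "\<exists>\<alpha>. sat \<alpha>"
proof -
  let ?st = "{p. p < k \<and> stk p}" and ?qu = "{p. p < k \<and> \<not> stk p}"
  note cross_bound = pages_cross_bound[OF pages] and nest_bound = pages_nest_bound[OF pages]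
  have st_qu: "card ?st + card ?qu = k"
  proof -
    have "?st \<union> ?qu = {..<k}" "?st \<inter> ?qu = {}" by auto
    then show ?thesis by (metis (no_types, lifting) card_Un_disjoint card_lessThan finite_Un finite_lessThan)
  qed
  have thick_nest: "\<exists>j<Suc k. stk (pg (h j))"
    if h: "inj h" "\<And>j. j < Suc k \<Longrightarrow> h j \<in> tags"
      "\<And>j j'. j < j' \<Longrightarrow> j' < Suc k \<Longrightarrow> nest key_less (edge (h j)) (edge (h j'))" for h
  proof (rule ccontr)
    assume no: "\<not> (\<exists>j<Suc k. stk (pg (h j)))"
    have "card (h ` {..<Suc k}) \<le> card ?qu"
    proof (rule nest_bound)
      show "nest key_less (edge t) (edge t') \<or> nest key_less (edge t') (edge t)"
        if "t \<in> h ` {..<Suc k}" "t' \<in> h ` {..<Suc k}" "t \<noteq> t'" for t t'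
        by (rule comparable_image[where N = "\<lambda>t t'. nest key_less (edge t) (edge t')", OF h(3) that])
    qed (use h no in auto)
    moreover have "card (h ` {..<Suc k}) = Suc k"
      using h(1) by (subst card_image) (auto intro: inj_on_subset)
    ultimately show False using st_qu by linarith
  qed
  have thick_cross: "\<exists>j<Suc k. \<not> stk (pg (h j))"
    if h: "inj h" "\<And>j. j < Suc k \<Longrightarrow> h j \<in> tags"
      "\<And>j j'. j < j' \<Longrightarrow> j' < Suc k \<Longrightarrow> cross key_less (edge (h j)) (edge (h j'))" for h
  proof (rule ccontr)
    assume no: "\<not> (\<exists>j<Suc k. \<not> stk (pg (h j)))"
    have "card (h ` {..<Suc k}) \<le> card ?st"
    proof (rule cross_bound)
      show "cross key_less (edge t) (edge t') \<or> cross key_less (edge t') (edge t)"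
        if "t \<in> h ` {..<Suc k}" "t' \<in> h ` {..<Suc k}" "t \<noteq> t'" for t t'
        by (rule comparable_image[where N = "\<lambda>t t'. cross key_less (edge t) (edge t')", OF h(3) that])
    qed (use h no in auto)
    moreover have "card (h ` {..<Suc k}) = Suc k"
      using h(1) by (subst card_image) (auto intro: inj_on_subset)
    ultimately show False using st_qu by linarith
  qed
  have "\<exists>j<Suc k. stk (pg (Base i j))" if "i < s" for i
    by (rule thick_nest) (use that in \<open>auto simp: inj_def nest_def\<close>)
  then obtain jb where jb: "\<And>i. i < s \<Longrightarrow> jb i < Suc k \<and> stk (pg (Base i (jb i)))" by metis
  have "\<exists>j<Suc k. stk (pg (Fill c i j))" if "c \<in> Cl" "i < fil" for c i
    by (rule thick_nest) (use that in \<open>auto simp: inj_def nest_def\<close>)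
  then obtain jf where jf: "\<And>c i. c \<in> Cl \<Longrightarrow> i < fil \<Longrightarrow> jf c i < Suc k \<and> stk (pg (Fill c i (jf c i)))"
    by metis
  have "\<exists>j<Suc k. \<not> stk (pg (Above v j))" if "v < V" for v
    by (rule thick_cross) (use that in \<open>auto simp: inj_def cross_def\<close>)
  then obtain ja where ja: "\<And>v. v < V \<Longrightarrow> ja v < Suc k \<and> \<not> stk (pg (Above v (ja v)))" by metis
  have "\<exists>j<Suc k. \<not> stk (pg (Below v i j))" if "v < V" "i < V - Suc v" for v i
    by (rule thick_cross) (use that in \<open>auto simp: inj_def cross_def\<close>)
  then obtain jl where jl: "\<And>v i. v < V \<Longrightarrow> i < V - Suc v \<Longrightarrow> jl v i < Suc k \<and> \<not> stk (pg (Below v i (jl v i)))"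
    by metis
  have "card ((\<lambda>i. Base i (jb i)) ` {..<s}) \<le> card ?st"
    by (rule cross_bound) (use jb in \<open>auto simp: cross_def\<close>)
  then have s_le: "s \<le> card ?st"
    by (subst (asm) card_image) (auto simp: inj_on_def)
  have "card ((\<lambda>v. Above v (ja v)) ` {..<V}) \<le> card ?qu"
  proof (rule nest_bound)
    show "nest key_less (edge t) (edge t') \<or> nest key_less (edge t') (edge t)"
      if "t \<in> (\<lambda>v. Above v (ja v)) ` {..<V}" "t' \<in> (\<lambda>v. Above v (ja v)) ` {..<V}" "t \<noteq> t'" for t t'
      by (rule comparable_image[where N = "\<lambda>t t'. nest key_less (edge t) (edge t')", OF _ that])
        (auto simp: nest_def)
  qed (use ja in auto)
  then have V_le: "V \<le> card ?qu"
    by (subst (asm) card_image) (auto simp: inj_on_def)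
  \<comment> \<open>There are only \<open>k = s + V\<close> pages, so both lower bounds are
    attained.\<close>
  have st: "card ?st = s" and qu: "card ?qu = V"
    using s_le V_le st_qu by (auto simp: k_def)
  have clause: "\<exists>l<W. \<not> stk (pg (Wire c l))" if c: "c \<in> Cl" for c
  proof (rule ccontr)
    assume no: "\<not> (\<exists>l<W. \<not> stk (pg (Wire c l)))"
    let ?A = "Wire c ` {..<W}" and ?B = "(\<lambda>i. Fill c i (jf c i)) ` {..<fil}"
    have "card (?A \<union> ?B) \<le> card ?st"
    proof (rule cross_bound)
      show "?A \<union> ?B \<subseteq> tags" using c jf by auto
      show "stk (pg t)" if "t \<in> ?A \<union> ?B" for t using that c jf no by auto
      \<comment> \<open>At a clause the wires arrive in the order in which they start, and each of
        them ends between the two endpoints of every filler.\<close>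
      show "cross key_less (edge t) (edge t') \<or> cross key_less (edge t') (edge t)"
        if "t \<in> ?A \<union> ?B" "t' \<in> ?A \<union> ?B" "t \<noteq> t'" for t t'
        using that by (auto simp: cross_def)
    qed
    moreover have "card (?A \<union> ?B) = W + fil"
      by (subst card_Un_disjoint) (auto simp: card_image inj_on_def)
    ultimately show False using st W_pos by (simp add: s_def)
  qed
  have var: False
    if c: "c \<in> Cl" "c' \<in> Cl" "l < W" "l' < W" "c < mp" "\<not> c' < mp" "vr c l = vr c' l'"
      and no: "\<not> stk (pg (Wire c l))" "\<not> stk (pg (Wire c' l'))" for c c' l l'
  proof -
    define v where "v = vr c l"
    have v: "v < V" "vr c' l' = v" using c vr_less by (auto simp: v_def)
    let ?A = "{Wire c l, Wire c' l'}" and ?B = "(\<lambda>i. Below v i (jl v i)) ` {..<V - Suc v}"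
      and ?C = "(\<lambda>u. Above u (ja u)) ` {..<v}"
    let ?N = "\<lambda>t t'. nest key_less (edge t) (edge t')"
    \<comment> \<open>The negative wire starts first because of its zone and ends last because
      negative clauses have the larger numbers.\<close>
    have "?N (Wire c' l') (Wire c l)"
      using c(5,6) v v_def by (auto simp: nest_def)
    then have AA: "\<forall>t\<in>?A. \<forall>t'\<in>?A. t \<noteq> t' \<longrightarrow> ?N t t' \<or> ?N t' t"
      by (auto simp del: edge.simps)
    have AB: "\<forall>t\<in>?A. \<forall>t'\<in>?B. ?N t t'" and CA: "\<forall>t\<in>?C. \<forall>t'\<in>?A. ?N t t'"
      and CB: "\<forall>t\<in>?C. \<forall>t'\<in>?B. ?N t t'"
      using v v_def by (auto simp: nest_def)
    have "?N (Below v i j) (Below v i' j')" if "i < i'" "i' < V - Suc v" for i i' j j'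
      using that by (auto simp: nest_def)
    then have BB: "\<forall>t\<in>?B. \<forall>t'\<in>?B. t \<noteq> t' \<longrightarrow> ?N t t' \<or> ?N t' t"
      by (intro ballI impI) (rule comparable_image[where N = ?N]; blast)
    have "?N (Above u j) (Above u' j')" if "u < u'" "u' < v" for u u' j j'
      using that v by (auto simp: nest_def)
    then have CC: "\<forall>t\<in>?C. \<forall>t'\<in>?C. t \<noteq> t' \<longrightarrow> ?N t t' \<or> ?N t' t"
      by (intro ballI impI) (rule comparable_image[where N = ?N]; blast)
    have "card (?A \<union> ?B \<union> ?C) \<le> card ?qu"
    proof (rule nest_bound)
      show "?A \<union> ?B \<union> ?C \<subseteq> tags" using c v jl ja by auto
      show "\<not> stk (pg t)" if "t \<in> ?A \<union> ?B \<union> ?C" for t using that v jl ja no by auto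
      show "nest key_less (edge t) (edge t') \<or> nest key_less (edge t') (edge t)"
        if "t \<in> ?A \<union> ?B \<union> ?C" "t' \<in> ?A \<union> ?B \<union> ?C" "t \<noteq> t'" for t t'
        by (rule comparable_Un3[where N = ?N, OF AA AB BB CA CB CC that])
    qed
    moreover have "card (?A \<union> ?B \<union> ?C) = Suc V"
    proof -
      have "card (?A \<union> ?B \<union> ?C) = card ?A + card ?B + card ?C"
        by (subst card_Un_disjoint, simp, simp, force, subst card_Un_disjoint) auto
      \<comment> \<open>Two wires, \<open>V - Suc v\<close> columns below and \<open>v\<close>
        columns above: one edge more than there are queues.\<close>
      also have "\<dots> = 2 + (V - Suc v) + v"
        using c by (auto simp: card_image inj_on_def)
      finally show ?thesis using v by simp
    qed
    ultimately show False using qu by simp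
  qed
  have "sat (\<lambda>v. \<exists>c\<in>Cl. \<exists>l<W. c < mp \<and> vr c l = v \<and> \<not> stk (pg (Wire c l)))"
    unfolding sat_def
  proof
    fix c assume c: "c \<in> Cl"
    obtain l where l: "l < W" "\<not> stk (pg (Wire c l))" using clause[OF c] by blast
    have "(\<exists>c'\<in>Cl. \<exists>l'<W. c' < mp \<and> vr c' l' = vr c l \<and> \<not> stk (pg (Wire c' l'))) \<longleftrightarrow> c < mp"
      using var[of _ c _ l] c l by blast
    then show "\<exists>l<W. (\<exists>c'\<in>Cl. \<exists>l'<W. c' < mp \<and> vr c' l' = vr c l \<and> \<not> stk (pg (Wire c' l'))) \<longleftrightarrow> c < mp"
      using l by blast
  qed
  then show ?thesis by blast
qed

end

section \<open>Edges on consecutive vertices\<close>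

definition doubleton :: "nat \<times> nat \<Rightarrow> nat set" where
  "doubleton e = {2 ^ fst e, 2 ^ snd e}"

definition pow_order :: "nat \<Rightarrow> (nat \<times> nat) set" where
  "pow_order N = {(2 ^ i, 2 ^ j) | i j. i < j \<and> j < N}"

lemma pow_order_iff [simp]: "(2 ^ i, 2 ^ j) \<in> pow_order N \<longleftrightarrow> i < j \<and> j < N"
  by (auto simp: pow_order_def)

lemma pow_orderD: "(u, v) \<in> pow_order N \<Longrightarrow> u < v"
  by (auto simp: pow_order_def)

lemma doubleton_eq_ordered:
  "{2 ^ a, 2 ^ b} = {u, v} \<Longrightarrow> a < b \<Longrightarrow> u < v \<Longrightarrow> u = 2 ^ a \<and> v = (2 ^ b :: nat)"
  by (auto simp: doubleton_eq_iff)

lemma crosses_doubleton: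
  assumes "fst e < snd e" "fst f < snd f" "snd e < N" "snd f < N"
  shows "crosses (pow_order N) (doubleton e) (doubleton f) \<longleftrightarrow> cross (<) e f"
proof
  assume "crosses (pow_order N) (doubleton e) (doubleton f)"
  then obtain u1 v1 u2 v2 where *: "doubleton e = {u1, v1}" "doubleton f = {u2, v2}"
      "(u1, u2) \<in> pow_order N" "(u2, v1) \<in> pow_order N" "(v1, v2) \<in> pow_order N"
    unfolding crosses_def by blast
  have "u1 < v1" "u2 < v2" using *(3-5) by (auto dest!: pow_orderD)
  then have "u1 = 2 ^ fst e" "v1 = 2 ^ snd e" "u2 = 2 ^ fst f" "v2 = 2 ^ snd f"
    using doubleton_eq_ordered *(1,2) assms(1,2) unfolding doubleton_def by blast+
  then show "cross (<) e f" using *(3-5) by (simp add: cross_def)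
next
  assume "cross (<) e f"
  then show "crosses (pow_order N) (doubleton e) (doubleton f)"
    unfolding crosses_def doubleton_def using assms
    by (intro exI[of _ "2 ^ fst e"] exI[of _ "2 ^ snd e"] exI[of _ "2 ^ fst f"] exI[of _ "2 ^ snd f"])
      (auto simp: cross_def)
qed

lemma nests_doubleton:
  assumes "fst e < snd e" "fst f < snd f" "snd e < N" "snd f < N"
  shows "nests (pow_order N) (doubleton e) (doubleton f) \<longleftrightarrow> nest (<) e f"
proof
  assume "nests (pow_order N) (doubleton e) (doubleton f)"
  then obtain u1 v1 u2 v2 where *: "doubleton e = {u1, v1}" "doubleton f = {u2, v2}"
      "(u1, u2) \<in> pow_order N" "(u2, v2) \<in> pow_order N" "(v2, v1) \<in> pow_order N"
    unfolding nests_def by blast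
  have "u1 < v1" "u2 < v2" using *(3-5) by (auto dest!: pow_orderD)
  then have "u1 = 2 ^ fst e" "v1 = 2 ^ snd e" "u2 = 2 ^ fst f" "v2 = 2 ^ snd f"
    using doubleton_eq_ordered *(1,2) assms(1,2) unfolding doubleton_def by blast+
  then show "nest (<) e f" using *(3-5) by (simp add: nest_def)
next
  assume "nest (<) e f"
  then show "nests (pow_order N) (doubleton e) (doubleton f)"
    unfolding nests_def doubleton_def using assms
    by (intro exI[of _ "2 ^ fst e"] exI[of _ "2 ^ snd e"] exI[of _ "2 ^ fst f"] exI[of _ "2 ^ snd f"])
      (auto simp: nest_def)
qed

lemma doubleton_inject:
  assumes "fst e < snd e" "fst f < snd f" "doubleton e = doubleton f"
  shows "e = f"
proof -
  have "(2 :: nat) ^ fst f < 2 ^ snd f" using assms(2) by simp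
  with doubleton_eq_ordered[of "fst e" "snd e" "2 ^ fst f" "2 ^ snd f"] assms
  show ?thesis by (auto simp: doubleton_def prod_eq_iff)
qed

text \<open>Numbering the blocks gives the pages, and a block that is both a stack and a queue
  counts as a stack. Conversely the nonempty page classes form the partition.\<close>

lemma mixed_partitionable_iff_pages:
  assumes T: "finite T" "inj_on e T" "\<And>t. t \<in> T \<Longrightarrow> fst (e t) < snd (e t) \<and> snd (e t) < N"
  shows "mixed_partitionable (pow_order N) ((\<lambda>t. doubleton (e t)) ` T) k \<longleftrightarrow>
    (\<exists>pg stk. pages (<) k T e pg stk)"
proof
  let ?r = "pow_order N" and ?d = "\<lambda>t. doubleton (e t)"
  assume "mixed_partitionable ?r (?d ` T) k"
  then obtain P where P: "partition_on (?d ` T) P" "card P \<le> k" "\<forall>S\<in>P. is_stack ?r S \<or> is_queue ?r S"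
    unfolding mixed_partitionable_def by blast
  have "finite P" using finite_elements[OF _ P(1)] T(1) by simp
  then obtain h where h: "bij_betw h P {..<card P}"
    using ex_bij_betw_finite_nat by (metis atLeast0LessThan)
  have "\<forall>t\<in>T. \<exists>S\<in>P. ?d t \<in> S"
    using P(1) by (auto simp: partition_on_def)
  then obtain blk where blk: "\<And>t. t \<in> T \<Longrightarrow> blk t \<in> P \<and> ?d t \<in> blk t" by metis
  define pg where "pg t = h (blk t)" for t
  define stk where "stk p \<longleftrightarrow> is_stack ?r (inv_into P h p)" for p
  have inv: "inv_into P h (pg t) = blk t" if "t \<in> T" for t
    using h blk[OF that] unfolding pg_def bij_betw_def by (simp add: inv_into_f_f)
  have "pages (<) k T e pg stk"
    unfolding pages_def
  proof (intro conjI ballI impI)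
    fix t assume "t \<in> T"
    then show "pg t < k"
      using bij_betwE[OF h] blk P(2) by (force simp: pg_def)
  next
    fix t t' assume t: "t \<in> T" "t' \<in> T" "pg t = pg t'" "stk (pg t)"
    then have "?d t' \<in> blk t" using blk inv by metis
    moreover have "is_stack ?r (blk t)" using t(1,4) inv[of t] by (simp add: stk_def)
    ultimately have "\<not> crosses ?r (?d t) (?d t')"
      using blk[OF t(1)] by (auto simp: is_stack_def)
    then show "\<not> cross (<) (e t) (e t')"
      using T(3) t(1,2) by (simp add: crosses_doubleton)
  next
    fix t t' assume t: "t \<in> T" "t' \<in> T" "pg t = pg t'" "\<not> stk (pg t)"
    then have "?d t' \<in> blk t" using blk inv by metis
    moreover have "is_queue ?r (blk t)" using t(1,4) inv[of t] P(3) blk by (auto simp: stk_def)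
    ultimately have "\<not> nests ?r (?d t) (?d t')"
      using blk[OF t(1)] by (auto simp: is_queue_def)
    then show "\<not> nest (<) (e t) (e t')"
      using T(3) t(1,2) by (simp add: nests_doubleton)
  qed
  then show "\<exists>pg stk. pages (<) k T e pg stk" by blast
next
  let ?r = "pow_order N" and ?d = "\<lambda>t. doubleton (e t)"
  assume "\<exists>pg stk. pages (<) k T e pg stk"
  then obtain pg stk where pages: "pages (<) k T e pg stk" by blast
  have inj: "t = t'" if "t \<in> T" "t' \<in> T" "?d t = ?d t'" for t t'
    using that T(2,3) doubleton_inject by (metis inj_onD)
  define B where "B p = ?d ` {t \<in> T. pg t = p}" for p
  define P where "P = B ` {..<k} - {{}}"
  have "partition_on (?d ` T) P"
  proof (rule partition_onI)
    show "\<Union> P = ?d ` T"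
      using pages by (auto simp: P_def B_def pages_def)
    show "disjnt p q" if pq: "p \<in> P" "q \<in> P" "p \<noteq> q" for p q
    proof -
      obtain a b where ab: "p = B a" "q = B b" using pq(1,2) by (auto simp: P_def)
      have "a = b" if "x \<in> B a" "x \<in> B b" for x
        using that inj by (auto simp: B_def)
      then show ?thesis using ab pq(3) by (auto simp: disjnt_def)
    qed
  qed (auto simp: P_def)
  moreover have "card P \<le> k"
    unfolding P_def by (intro order.trans[OF card_Diff1_le] order.trans[OF card_image_le]) auto
  moreover have "is_stack ?r S \<or> is_queue ?r S" if S: "S \<in> P" for S
  proof -
    obtain p where p: "S = B p" using S by (auto simp: P_def)
    show ?thesis
    proof (cases "stk p")
      case True
      then have "is_stack ?r S"
        using pages T(3) by (auto simp: p is_stack_def B_def crosses_doubleton pages_def)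
      then show ?thesis ..
    next
      case False
      then have "is_queue ?r S"
        using pages T(3) by (auto simp: p is_queue_def B_def nests_doubleton pages_def)
      then show ?thesis ..
    qed
  qed
  ultimately show "mixed_partitionable ?r (?d ` T) k"
    unfolding mixed_partitionable_def by blast
qed

text \<open>All \<open>N\<close> positions become vertices, so the vertex list is a single loop;
  positions that end no edge affect neither crossing nor nesting.\<close>

lemma enc_instance_iff_pages:
  assumes ts: "distinct ts" "inj_on e (set ts)"
    "\<And>t. t \<in> set ts \<Longrightarrow> fst (e t) < snd (e t) \<and> snd (e t) < N"
  shows "enc_instance (map ((^) 2) [0..<N]) (map (\<lambda>t. (2 ^ fst (e t), 2 ^ snd (e t))) ts) k
      \<in> mixed_page_problem \<longleftrightarrow> (\<exists>pg stk. pages (<) k (set ts) e pg stk)"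
proof -
  let ?V = "(^) 2 ` {..<N} :: nat set" and ?E = "(\<lambda>t. doubleton (e t)) ` set ts" and ?r = "pow_order N"
  have G: "simple_graph ?V ?E"
    using ts(3) by (fastforce simp: simple_graph_def doubleton_def card_insert_if)
  have ord: "vertex_order ?V ?r"
    by (auto simp: vertex_order_def strict_linear_order_on_def pow_order_def irrefl_def
        total_on_def trans_def)
  have "inj_on (\<lambda>t. doubleton (e t)) (set ts)"
    using ts(2,3) doubleton_inject by (metis (no_types, lifting) inj_on_def)
  then have "lists_instance (map ((^) 2) [0..<N]) (map (\<lambda>t. (2 ^ fst (e t), 2 ^ snd (e t))) ts) ?V ?E ?r"
    using ts(1) by (auto simp: lists_instance_def sorted_wrt_iff_nth_less distinct_map comp_def doubleton_def
        case_prod_unfold)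
  then show ?thesis
    using mixed_page_problem_iff[OF G ord] mixed_page_number_le_iff[OF G ord]
      mixed_partitionable_iff_pages[of "set ts" e N k] ts(2,3) by simp
qed

section \<open>Keys as numbers in a large radix\<close>

fun pos :: "nat \<Rightarrow> key \<Rightarrow> nat" where
  "pos R (r, a, b, c, d) = (((r * R + a) * R + b) * R + c) * R + d"

fun digits :: "nat \<Rightarrow> key \<Rightarrow> bool" where
  "digits R (r, a, b, c, d) \<longleftrightarrow> r < 4 \<and> a < R \<and> b < R \<and> c < R \<and> d < R"

lemma radix_less_iff:
  fixes x y R :: nat
  assumes "y < R" "y' < R"
  shows "x * R + y < x' * R + y' \<longleftrightarrow> x < x' \<or> x = x' \<and> y < y'"
proof -
  have "x * R + y < x' * R + y'" if "x < x'" "y < R" for x x' y y'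
  proof -
    have "x * R + y < Suc x * R" using that by simp
    also have "\<dots> \<le> x' * R" using that by (intro mult_right_mono) auto
    finally show ?thesis by simp
  qed
  from this[of x x' y y'] this[of x' x y' y] show ?thesis
    using assms by (cases x x' rule: linorder_cases) auto
qed

lemma pos_less_iff: "digits R x \<Longrightarrow> digits R y \<Longrightarrow> pos R x < pos R y \<longleftrightarrow> key_less x y"
proof -
  have eq: "x * R + y = x' * R + y' \<longleftrightarrow> x = x' \<and> y = y'" if "y < R" "y' < R" for x x' y y' :: nat
    using radix_less_iff[OF that, of x x'] radix_less_iff[OF that(2,1), of x' x]
    by (auto simp: nat_neq_iff)
  show "digits R x \<Longrightarrow> digits R y \<Longrightarrow> pos R x < pos R y \<longleftrightarrow> key_less x y"
    by (cases x; cases y) (auto simp: radix_less_iff eq)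
qed

lemma pos_bound: "digits R x \<Longrightarrow> pos R x < 4 * R * R * R * R"
proof (cases x)
  case (fields r a b c d)
  assume "digits R x"
  then have *: "r < 4" "a < R" "b < R" "c < R" "d < R" using fields by auto
  have step: "u * R + w < U * R" if "u < U" "w < R" for u w U
    using radix_less_iff[of w R 0 u U] that by auto
  show ?thesis
    unfolding fields pos.simps using * by (intro step)
qed

lemma distinct_concat_map:
  assumes "distinct xs" "\<And>x. x \<in> set xs \<Longrightarrow> distinct (f x)"
    and "\<And>x y. x \<in> set xs \<Longrightarrow> y \<in> set xs \<Longrightarrow> x \<noteq> y \<Longrightarrow> set (f x) \<inter> set (f y) = {}"
  shows "distinct (concat (map f xs))"
  using assms
proof (induction xs)
  case (Cons a xs)
  have "distinct (concat (map f xs))" using Cons by simp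
  moreover have "set (f a) \<inter> set (f x) = {}" if "x \<in> set xs" for x
    using Cons.prems that by auto
  ultimately show ?case using Cons.prems by auto
qed simp

context monotone_cnf
begin

text \<open>Digits are indices up to \<open>k\<close> or zone numbers up to
  \<open>4\<close>.\<close>

definition rad :: nat where "rad = k + 5"

definition place :: "tag \<Rightarrow> nat \<times> nat" where
  "place t = map_prod (pos rad) (pos rad) (edge t)"

lemma edge_digits: "t \<in> tags \<Longrightarrow> digits rad (fst (edge t)) \<and> digits rad (snd (edge t))"
proof (cases t)
  case (Wire c l)
  assume "t \<in> tags"
  then have "c < m" "l < W" "vr c l < V" using Cl vr_less by (auto simp: Wire)
  moreover have "m \<le> fil" using W_pos by (simp add: fil_def)
  ultimately show ?thesis by (simp add: Wire rad_def k_def s_def)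
next
  case (Fill c i j)
  assume "t \<in> tags"
  then have "c < m" "i < fil" "j \<le> k" using Cl by (auto simp: Fill)
  moreover have "m \<le> fil" using W_pos by (simp add: fil_def)
  ultimately show ?thesis by (simp add: Fill rad_def k_def s_def)
qed (auto simp: rad_def k_def)

lemma pages_place: "pages (<) k tags place pg stk \<longleftrightarrow> pages key_less k tags edge pg stk"
  unfolding pages_def
  by (intro conj_cong refl ball_cong imp_cong)
    (auto simp: cross_def nest_def place_def pos_less_iff edge_digits)

lemma inj_on_place: "inj_on place tags"
proof (rule inj_onI)
  fix t t' assume t: "t \<in> tags" "t' \<in> tags" "place t = place t'"
  then have "pos rad (fst (edge t)) = pos rad (fst (edge t'))"
    by (simp add: place_def map_prod_def case_prod_unfold)
  then have "\<not> key_less (fst (edge t)) (fst (edge t'))" "\<not> key_less (fst (edge t')) (fst (edge t))"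
    using pos_less_iff[of rad "fst (edge t)" "fst (edge t')"] pos_less_iff[of rad "fst (edge t')" "fst (edge t)"]
      edge_digits t(1,2) by simp_all
  then show "t = t'" by (cases t; cases t') (auto split: if_splits)
qed

lemma place_bounds:
  assumes "t \<in> tags"
  shows "fst (place t) < snd (place t)" "snd (place t) < 4 * rad * rad * rad * rad"
proof -
  have "key_less (fst (edge t)) (snd (edge t))" by (cases t) auto
  then show "fst (place t) < snd (place t)"
    using edge_digits[OF assms] by (simp add: place_def pos_less_iff)
  show "snd (place t) < 4 * rad * rad * rad * rad"
    using edge_digits[OF assms] by (simp add: place_def pos_bound)
qed

text \<open>Listed in exactly the order in which the loops print the edges; the singleton lists
  correspond to their leaves.\<close>

definition clause_tags :: "nat \<Rightarrow> tag list" where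
  "clause_tags c = map (Wire c) [0..<W] @
     concat (map (\<lambda>i. concat (map (\<lambda>j. [Fill c i j]) [0..<Suc k])) [0..<fil])"

definition frame_tags :: "tag list" where
  "frame_tags =
     concat (map (\<lambda>i. concat (map (\<lambda>j. [Base i j]) [0..<Suc k])) [0..<s]) @
     concat (map (\<lambda>v. concat (map (\<lambda>i. concat (map (\<lambda>j. [Below v i j]) [0..<Suc k])) [0..<V - Suc v]) @
        concat (map (\<lambda>j. [Above v j]) [0..<Suc k])) [0..<V])"

lemma enc_instance_iff_sat:
  assumes "distinct cls" "set cls = Cl"
  shows "enc_instance (map ((^) 2) [0..<4 * rad * rad * rad * rad])
      (map (\<lambda>t. (2 ^ fst (place t), 2 ^ snd (place t))) (frame_tags @ concat (map clause_tags cls))) k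
      \<in> mixed_page_problem \<longleftrightarrow> (\<exists>\<alpha>. sat \<alpha>)"
proof -
  let ?ts = "frame_tags @ concat (map clause_tags cls)"
  have "t \<in> set ?ts \<longleftrightarrow> t \<in> tags" for t
    using assms(2) by (cases t) (auto simp: frame_tags_def clause_tags_def image_iff simp del: upt_Suc)
  then have set: "set ?ts = tags" by blast
  have "distinct frame_tags"
    unfolding frame_tags_def distinct_append
    by (intro conjI distinct_concat_map)
      (auto intro!: distinct_concat_map simp: distinct_map inj_on_def simp del: upt_Suc)
  moreover have "distinct (concat (map clause_tags cls))"
    using assms(1) by (intro distinct_concat_map)
      (auto simp: clause_tags_def distinct_map inj_on_def intro!: distinct_concat_map simp del: upt_Suc)
  moreover have "set frame_tags \<inter> set (concat (map clause_tags cls)) = {}"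
    by (auto simp: frame_tags_def clause_tags_def simp del: upt_Suc)
  ultimately have "distinct ?ts" by simp
  then show ?thesis
    using enc_instance_iff_pages[of ?ts place "4 * rad * rad * rad * rad" k] inj_on_place place_bounds
      sat_imp_pages pages_imp_sat
    unfolding set pages_place by blast
qed

end

section \<open>Clauses describing a computation\<close>

text \<open>
  The atoms of the formula are \<open>(\<kappa>, t, i)\<close>: for \<open>\<kappa> \<le> tm_states M\<close> (and \<open>i = 0\<close>) the machine is in
  state \<open>\<kappa>\<close> at time \<open>t\<close>; for \<open>\<kappa> = sym_code M j a\<close> tape \<open>j\<close> carries \<open>a\<close> at time \<open>t\<close> at
  distance \<open>i - (H + 1)\<close> from its head. A literal is a sign with an atom; a family
  \<open>(g, bt, bi, ls)\<close> is the set of clauses \<open>ls\<close> for \<open>t < bt\<close> (variable 1) and \<open>i < bi\<close> (variable 3),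
  restricted to the positions \<open>i\<close> of the input bits \<open>b\<close> if \<open>g = Some b\<close>.
\<close>

type_synonym literal = "bool \<times> nat \<times> pexp \<times> pexp"
type_synonym family = "bool option \<times> pexp \<times> pexp \<times> literal list"

definition sym_code :: "tm \<Rightarrow> nat \<Rightarrow> nat \<Rightarrow> nat" where
  "sym_code M j a = Suc (tm_states M) + j * tm_symbols M + a"

text \<open>The new index of the symbol that was at index \<open>b + 1\<close> before the head
  moved. Writing the old index as a successor avoids subtraction for moves to the right.\<close>

fun shift :: "move \<Rightarrow> pexp \<Rightarrow> pexp" where
  "shift Move_Right b = b"
| "shift Move_Stay b = Add b (Const 1)"
| "shift Move_Left b = Add b (Const 2)"

definition delta :: "tm \<Rightarrow> nat \<Rightarrow> nat list \<Rightarrow> nat \<times> (nat \<times> move) list" where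
  "delta M q as = (if q < tm_states M then tm_delta M q as else (q, stay as))"

text \<open>The known window reaches to distance \<open>H\<close> at time \<open>0\<close> and loses
  one cell on each side per step. The term with factor two leaves distance \<open>T\<close> in the
  end, enough to see the first output cell from wherever the head is. The other two summands make
  room for input and certificate, and splitting them off again needs no subtraction.\<close>

definition width :: "pexp \<Rightarrow> pexp \<Rightarrow> pexp" where
  "width Te Pe = Add (Var 0) (Add Pe (Mul (Const 2) Te))"

text \<open>The clause with three alternatives guesses a cell of the certificate. The family after
  it lets blanks propagate to the right, which makes the guessed cells a word followed by
  blanks.\<close>

definition init_families :: "tm \<Rightarrow> pexp \<Rightarrow> pexp \<Rightarrow> family list" where
  "init_families M Te Pe = (let H = width Te Pe; C = Add H (Const 1); i = Var 3; sy = sym_code M in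
     [(None, Const 1, Const 1, [(True, 0, Const 0, Const 0)]),
      (Some True, Const 1, Var 0, [(True, sy 0 2, Const 0, Add C i)]),
      (Some False, Const 1, Var 0, [(True, sy 0 1, Const 0, Add C i)]),
      (None, Const 1, Add (Add Pe (Mul (Const 2) Te)) (Const 1),
         [(True, sy 0 0, Const 0, Add (Add C (Var 0)) i)]),
      (None, Const 1, Pe, [(True, sy 1 0, Const 0, Add C i), (True, sy 1 1, Const 0, Add C i),
         (True, sy 1 2, Const 0, Add C i)]),
      (None, Const 1, Pe, [(False, sy 1 0, Const 0, Add C i), (True, sy 1 0, Const 0, Add (Add C i) (Const 1))]),
      (None, Const 1, Add (Add (Var 0) (Mul (Const 2) Te)) (Const 1),
         [(True, sy 1 0, Const 0, Add (Add C Pe) i)])] @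
     map (\<lambda>j. (None, Const 1, H, [(True, sy j 0, Const 0, Add (Const 1) i)])) [0..<tm_tapes M] @
     map (\<lambda>j. (None, Const 1, Add H (Const 1), [(True, sy j 0, Const 0, Add C i)])) [2..<tm_tapes M])"

definition premise :: "tm \<Rightarrow> pexp \<Rightarrow> nat \<Rightarrow> nat list \<Rightarrow> literal list" where
  "premise M H q as = (False, q, Var 1, Const 0) #
     map (\<lambda>j. (False, sym_code M j (as ! j), Var 1, Add H (Const 1))) [0..<tm_tapes M]"

text \<open>The cell under a head, those to its left and those to its right need separate families:
  the first is rewritten, the others are only shifted. Taking \<open>delta\<close> instead of
  \<open>tm_delta\<close> lets a halted run continue up to time \<open>Te\<close>.\<close>

definition step_families :: "tm \<Rightarrow> pexp \<Rightarrow> pexp \<Rightarrow> nat \<Rightarrow> nat list \<Rightarrow> family list" where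
  "step_families M Te H q as = (let t' = Add (Var 1) (Const 1); i = Var 3; sy = sym_code M;
       pre = premise M H q as; q' = fst (delta M q as);
       b = (\<lambda>j. fst (snd (delta M q as) ! j)); d = (\<lambda>j. snd (snd (delta M q as) ! j)) in
     [(None, Te, Const 1, pre @ [(True, q', t', Const 0)])] @
     map (\<lambda>j. (None, Te, Const 1, pre @ [(True, sy j (b j), t', shift (d j) H)])) [0..<tm_tapes M] @
     concat (map (\<lambda>j. concat (map (\<lambda>a.
       [(None, Te, H, pre @ [(False, sy j a, Var 1, Add (Const 1) i), (True, sy j a, t', shift (d j) i)]),
        (None, Te, H, pre @ [(False, sy j a, Var 1, Add (Add H (Const 2)) i),
           (True, sy j a, t', shift (d j) (Add (Add H (Const 1)) i))])])
       [0..<tm_symbols M])) [0..<tm_tapes M]))"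

text \<open>Symbol \<open>1\<close> stands for the bit \<open>False\<close>; a run accepts if and
  only if this symbol is absent from the output tape at the end.\<close>

definition families :: "tm \<Rightarrow> pexp \<Rightarrow> pexp \<Rightarrow> family list" where
  "families M Te Pe = init_families M Te Pe @
     concat (map (\<lambda>q. concat (map (\<lambda>as. step_families M Te (width Te Pe) q as)
       (List.n_lists (tm_tapes M) [0..<tm_symbols M]))) [0..<Suc (tm_states M)]) @
     [(None, Const 1, Add (Mul (Const 2) (width Te Pe)) (Const 3), [(False, sym_code M 0 1, Te, Var 3)])]"

text \<open>The environment that \<open>sem\<close> produces inside two nested loops opened at
  variable \<open>1\<close>, complements included.\<close>

definition loop_env :: "bool list \<Rightarrow> nat \<Rightarrow> nat \<Rightarrow> nat \<Rightarrow> nat \<Rightarrow> nat \<Rightarrow> nat" where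
  "loop_env x bt bi t i = (input_env x)(1 := t, 2 := bt - Suc t, 3 := i, 4 := bi - Suc i)"

definition guard :: "bool list \<Rightarrow> bool option \<Rightarrow> nat \<Rightarrow> bool" where
  "guard x g i \<longleftrightarrow> (case g of None \<Rightarrow> True | Some b \<Rightarrow> (i < length x \<and> x ! i) = b)"

fun lit_true :: "(nat \<Rightarrow> nat \<Rightarrow> nat \<Rightarrow> bool) \<Rightarrow> (nat \<Rightarrow> nat) \<Rightarrow> literal \<Rightarrow> bool" where
  "lit_true \<beta> \<eta> (sg, \<kappa>, tp, ip) \<longleftrightarrow> \<beta> \<kappa> (val tp \<eta>) (val ip \<eta>) = sg"

fun models :: "bool list \<Rightarrow> (nat \<Rightarrow> nat \<Rightarrow> nat \<Rightarrow> bool) \<Rightarrow> family \<Rightarrow> bool" where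
  "models x \<beta> (g, bt, bi, ls) \<longleftrightarrow> (\<forall>t < val bt (input_env x). \<forall>i < val bi (input_env x). guard x g i \<longrightarrow>
     (\<exists>l \<in> set ls. lit_true \<beta> (loop_env x (val bt (input_env x)) (val bi (input_env x)) t i) l))"

lemma loop_env_simps [simp]:
  "loop_env x bt bi t i 0 = length x" "loop_env x bt bi t i (Suc 0) = t" "loop_env x bt bi t i 3 = i"
  by (simp_all add: loop_env_def input_env_def)

lemma input_env_0 [simp]: "input_env x 0 = length x"
  by (simp add: input_env_def)

lemma val_loop_env: "below 1 p \<Longrightarrow> val p (loop_env x bt bi t i) = val p (input_env x)"
  by (rule val_cong[of 1]) (auto simp: loop_env_def)

lemma int_val_shift: "int (val (shift d b) \<eta>) = int (val b \<eta>) + 1 - head_move d 0"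
  by (cases d) auto

lemma in_n_lists:
  "as \<in> set (List.n_lists n [0..<g]) \<longleftrightarrow> length as = n \<and> (\<forall>a\<in>set as. a < g)"
  by (auto simp: set_n_lists)

section \<open>Accepting runs satisfy the clauses\<close>

locale verifier =
  fixes M :: tm and R :: "bool list \<Rightarrow> bool list \<Rightarrow> bool" and x :: "bool list" and Te Pe :: pexp
  assumes wf: "wf_tm M" and two: "2 \<le> tm_tapes M" and below: "below 1 Te" "below 1 Pe"
    and computes: "\<And>u. length u \<le> val Pe (input_env x) \<Longrightarrow>
      tm_computes M [x, u] [R x u] (val Te (input_env x))"
begin

definition T :: nat where "T = val Te (input_env x)"
definition P :: nat where "P = val Pe (input_env x)"
definition H :: nat where "H = length x + (P + 2 * T)"

lemma vals [simp]:
  "val Te (loop_env x bt bi t i) = T" "val Pe (loop_env x bt bi t i) = P"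
  "val Te (input_env x) = T" "val Pe (input_env x) = P"
  "val (width Te Pe) (input_env x) = H" "val (width Te Pe) (loop_env x bt bi t i) = H"
  using below by (simp_all add: val_loop_env T_def P_def H_def width_def)

definition conf :: "bool list \<Rightarrow> nat \<Rightarrow> config" where
  "conf u t = (tm_step M ^^ t) (tm_init M [x, u])"

definition st :: "bool list \<Rightarrow> nat \<Rightarrow> nat" where
  "st u t = fst (conf u t)"

definition hpos :: "bool list \<Rightarrow> nat \<Rightarrow> nat \<Rightarrow> int" where
  "hpos u t j = snd (snd (conf u t) ! j)"

definition sym :: "bool list \<Rightarrow> nat \<Rightarrow> nat \<Rightarrow> int \<Rightarrow> nat" where
  "sym u t j z = fst (snd (conf u t) ! j) (hpos u t j + z)"

definition reads :: "bool list \<Rightarrow> nat \<Rightarrow> nat list" where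
  "reads u t = map (\<lambda>j. sym u t j 0) [0..<tm_tapes M]"

lemma conf_step:
  assumes "length (snd (conf u t)) = tm_tapes M" "length (snd (delta M (st u t) (reads u t))) = tm_tapes M"
  shows "conf u (Suc t) = (fst (delta M (st u t) (reads u t)),
    map2 tape_act (snd (delta M (st u t) (reads u t))) (snd (conf u t)))"
proof -
  have r: "reads u t = scan (snd (conf u t))"
    using assms(1) by (intro nth_equalityI) (auto simp: reads_def sym_def hpos_def case_prod_unfold)
  have "conf u (Suc t) = tm_step M (st u t, snd (conf u t))"
    by (simp add: conf_def st_def)
  also have "\<dots> = (fst (delta M (st u t) (reads u t)),
    map2 tape_act (snd (delta M (st u t) (reads u t))) (snd (conf u t)))"
  proof (cases "st u t < tm_states M")
    case True
    then show ?thesis using tm_step_code[OF True] by (simp add: r delta_def)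
  next
    case False
    then show ?thesis by (simp add: tm_step_def delta_def r map2_tape_act_stay)
  qed
  finally show ?thesis .
qed

lemma delta_wf:
  assumes "q \<le> tm_states M" "length as = tm_tapes M" "\<forall>a\<in>set as. a < tm_symbols M"
  shows "fst (delta M q as) \<le> tm_states M" "length (snd (delta M q as)) = tm_tapes M"
    "j < tm_tapes M \<Longrightarrow> fst (snd (delta M q as) ! j) < tm_symbols M"
proof -
  have "fst (delta M q as) \<le> tm_states M \<and> length (snd (delta M q as)) = tm_tapes M \<and>
      (\<forall>ad\<in>set (snd (delta M q as)). fst ad < tm_symbols M)"
  proof (cases "q < tm_states M")
    case True
    have "case tm_delta M q as of (q', acts) \<Rightarrow>
           q' \<le> tm_states M \<and> length acts = tm_tapes M \<and> (\<forall>(a, d) \<in> set acts. a < tm_symbols M)"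
    proof -
      from wf have "\<forall>q < tm_states M. \<forall>as. length as = tm_tapes M \<and> (\<forall>a \<in> set as. a < tm_symbols M) \<longrightarrow>
        (case tm_delta M q as of (q', acts) \<Rightarrow>
           q' \<le> tm_states M \<and> length acts = tm_tapes M \<and> (\<forall>(a, d) \<in> set acts. a < tm_symbols M))"
        unfolding wf_tm_def by (elim conjE)
      from this[rule_format, OF True] assms show ?thesis by simp
    qed
    then show ?thesis using True by (simp add: delta_def case_prod_unfold)
  next
    case False
    then show ?thesis using assms by (auto simp: delta_def stay_def)
  qed
  then show "fst (delta M q as) \<le> tm_states M" "length (snd (delta M q as)) = tm_tapes M"
    "j < tm_tapes M \<Longrightarrow> fst (snd (delta M q as) ! j) < tm_symbols M"
    by simp_all
qed

lemma conf_0: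
  "st u 0 = 0" "length (snd (conf u 0)) = tm_tapes M"
  "j < tm_tapes M \<Longrightarrow> hpos u 0 j = 0"
  "j < tm_tapes M \<Longrightarrow> sym u 0 j z = contents (if j = 0 then x else if j = 1 then u else []) z"
  by (auto simp: st_def conf_def tm_init_def hpos_def sym_def nth_Cons split: nat.splits)

lemma conf_invar:
  "st u t \<le> tm_states M \<and> length (snd (conf u t)) = tm_tapes M \<and>
   (\<forall>j<tm_tapes M. \<forall>z. sym u t j z < tm_symbols M)"
proof (induction t)
  case 0
  have "3 \<le> tm_symbols M" using wf by (simp add: wf_tm_def)
  then show ?case by (auto simp: conf_0 contents_def)
next
  case (Suc t)
  have len: "length (reads u t) = tm_tapes M" and small: "\<forall>a\<in>set (reads u t). a < tm_symbols M"
    using Suc by (auto simp: reads_def)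
  note d = delta_wf[OF _ len small, of "st u t"]
  have c: "conf u (Suc t) = (fst (delta M (st u t) (reads u t)),
      map2 tape_act (snd (delta M (st u t) (reads u t))) (snd (conf u t)))"
    using Suc d by (intro conf_step) auto
  show ?case
  proof (intro conjI allI impI)
    show "st u (Suc t) \<le> tm_states M" using Suc d by (simp add: st_def c)
    show "length (snd (conf u (Suc t))) = tm_tapes M" using Suc d by (simp add: c)
    fix j z assume j: "j < tm_tapes M"
    have "\<forall>z. fst (snd (conf u t) ! j) z < tm_symbols M"
    proof
      fix z
      have "sym u t j (z - hpos u t j) < tm_symbols M" using Suc j by blast
      then show "fst (snd (conf u t) ! j) z < tm_symbols M" by (simp add: sym_def)
    qed
    then show "sym u (Suc t) j z < tm_symbols M"
      using Suc d j by (auto simp: sym_def c case_prod_unfold tape_act_def)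
  qed
qed

lemma reads_wf: "length (reads u t) = tm_tapes M" "\<forall>a\<in>set (reads u t). a < tm_symbols M"
  using conf_invar by (auto simp: reads_def)

text \<open>Relative to its head, a tape is rewritten only at distance \<open>0\<close> and then
  shifted as a whole, so the head position itself never enters.\<close>

lemma conf_Suc:
  defines "D u t \<equiv> delta M (st u t) (reads u t)"
  shows "st u (Suc t) = fst (D u t)"
    and "j < tm_tapes M \<Longrightarrow> hpos u (Suc t) j = hpos u t j + head_move (snd (snd (D u t) ! j)) 0"
    and "j < tm_tapes M \<Longrightarrow> sym u (Suc t) j z =
      (let z' = z + head_move (snd (snd (D u t) ! j)) 0 in
       if z' = 0 then fst (snd (D u t) ! j) else sym u t j z')"
proof -
  have inv: "st u t \<le> tm_states M" "length (snd (conf u t)) = tm_tapes M" using conf_invar by auto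
  note d = delta_wf[OF inv(1) reads_wf]
  have c: "conf u (Suc t) = (fst (D u t), map2 tape_act (snd (D u t)) (snd (conf u t)))"
    unfolding D_def by (rule conf_step[OF inv(2) d(2)])
  have hm: "head_move m h = h + head_move m 0" for m h by (cases m) auto
  show "st u (Suc t) = fst (D u t)" by (simp add: st_def c)
  show 1: "hpos u (Suc t) j = hpos u t j + head_move (snd (snd (D u t) ! j)) 0" if "j < tm_tapes M" for j
    using that d(2) inv(2) hm[of "snd (snd (D u t) ! j)" "hpos u t j"]
    by (simp add: hpos_def c case_prod_unfold tape_act_def D_def)
  show "sym u (Suc t) j z = (let z' = z + head_move (snd (snd (D u t) ! j)) 0 in
       if z' = 0 then fst (snd (D u t) ! j) else sym u t j z')" if "j < tm_tapes M"
  proof -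
    have "fst (snd (conf u (Suc t)) ! j) = (fst (snd (conf u t) ! j))(hpos u t j := fst (snd (D u t) ! j))"
      using that d(2) inv(2) by (simp add: c case_prod_unfold tape_act_def D_def hpos_def)
    then show ?thesis
      unfolding sym_def 1[OF that] Let_def by (simp add: ac_simps)
  qed
qed

lemma hpos_bound: "j < tm_tapes M \<Longrightarrow> \<bar>hpos u t j\<bar> \<le> int t"
proof (induction t)
  case (Suc t)
  let ?d = "head_move (snd (snd (delta M (st u t) (reads u t)) ! j)) 0"
  have "\<bar>head_move d 0\<bar> \<le> 1" for d by (cases d) auto
  from this have "\<bar>?d\<bar> \<le> 1" .
  moreover have "\<bar>hpos u t j\<bar> \<le> int t" using Suc by blast
  ultimately show ?case using conf_Suc(2)[OF Suc.prems, of u t] by linarith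
qed (simp add: conf_0)

lemma final_contents:
  assumes "length u \<le> P"
  shows "sym u T 0 z = contents [R x u] (hpos u T 0 + z)"
proof -
  have "tm_computes M [x, u] [R x u] T" using computes[of u] assms by simp
  then show ?thesis
    by (auto simp: tm_computes_def conf_def sym_def hpos_def split: prod.splits)
qed

definition run_atom :: "bool list \<Rightarrow> nat \<Rightarrow> nat \<Rightarrow> nat \<Rightarrow> bool" where
  "run_atom u \<kappa> t i \<longleftrightarrow> (if \<kappa> \<le> tm_states M then st u t = \<kappa>
     else sym u t ((\<kappa> - Suc (tm_states M)) div tm_symbols M) (int i - int (Suc H)) =
       (\<kappa> - Suc (tm_states M)) mod tm_symbols M)"

lemma run_atom_simps:
  "q \<le> tm_states M \<Longrightarrow> run_atom u q t i \<longleftrightarrow> st u t = q"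
  "a < tm_symbols M \<Longrightarrow> run_atom u (sym_code M j a) t i \<longleftrightarrow> sym u t j (int i - int (Suc H)) = a"
  by (auto simp: run_atom_def sym_code_def)

lemma three: "3 \<le> tm_symbols M"
  using wf by (simp add: wf_tm_def)

lemma run_models_init:
  assumes "length u \<le> P" "f \<in> set (init_families M Te Pe)"
  shows "models x (run_atom u) f"
proof -
  have "0 < tm_symbols M" "Suc 0 < tm_symbols M" "2 < tm_symbols M" "0 < tm_tapes M" "Suc 0 < tm_tapes M"
    using three two by auto
  note facts = this run_atom_simps conf_0 contents_def guard_def
  have "\<forall>f \<in> set (init_families M Te Pe). models x (run_atom u) f"
    unfolding init_families_def Let_def set_append ball_Un
    using assms(1) by (simp add: facts)
  then show ?thesis using assms(2) by blast
qed

lemma premise_run: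
  assumes "q \<le> tm_states M" "length as = tm_tapes M" "\<forall>a\<in>set as. a < tm_symbols M"
    and "\<eta> 1 = t" "val He \<eta> = H"
    and "\<not> (\<exists>l \<in> set (premise M He q as). lit_true (run_atom u) \<eta> l)"
  shows "st u t = q" "reads u t = as"
proof -
  show "st u t = q" using assms by (simp add: premise_def run_atom_simps)
  have "sym u t j 0 = as ! j" if "j < tm_tapes M" for j
  proof -
    have "as ! j < tm_symbols M" using assms(2,3) that by auto
    then have "run_atom u (sym_code M j (as ! j)) t (Suc H)"
      using assms(4-6) that by (simp add: premise_def)
    then show ?thesis using \<open>as ! j < tm_symbols M\<close> by (simp add: run_atom_simps)
  qed
  then show "reads u t = as"
    using assms(2) by (intro nth_equalityI) (auto simp: reads_def)
qed

text \<open>If a premise literal is satisfied, so is the clause; otherwise the state and the symbols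
  read are those of the premise, and one of the remaining literals has to hold.\<close>

lemma run_models_premise:
  assumes q: "q \<le> tm_states M" and as: "length as = tm_tapes M" "\<forall>a\<in>set as. a < tm_symbols M"
    and concl: "\<And>t i. st u t = q \<Longrightarrow> reads u t = as \<Longrightarrow> i < val bi (input_env x) \<Longrightarrow>
      \<exists>l \<in> set ls. lit_true (run_atom u) (loop_env x T (val bi (input_env x)) t i) l"
  shows "models x (run_atom u) (None, Te, bi, premise M (width Te Pe) q as @ ls)"
proof -
  have "\<exists>l \<in> set (premise M (width Te Pe) q as @ ls).
      lit_true (run_atom u) (loop_env x T (val bi (input_env x)) t i) l"
    if i: "i < val bi (input_env x)" for t i
  proof (cases "\<exists>l \<in> set (premise M (width Te Pe) q as).
      lit_true (run_atom u) (loop_env x T (val bi (input_env x)) t i) l")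
    case True
    then show ?thesis unfolding set_append by blast
  next
    case False
    have "st u t = q" "reads u t = as"
      by (rule premise_run[OF q as _ _ False]; simp)+
    from concl[OF this i] show ?thesis unfolding set_append by blast
  qed
  then show ?thesis by simp
qed

lemma sym_shift:
  assumes "st u t = q" "reads u t = as" "j < tm_tapes M"
  shows "sym u (Suc t) j (int (val (shift (snd (snd (delta M q as) ! j)) b) \<eta>) - int (Suc H)) =
    (if val b \<eta> = H then fst (snd (delta M q as) ! j) else sym u t j (int (val b \<eta>) - int H))"
  using conf_Suc(3)[OF assms(3), of u t] by (simp add: assms(1,2) int_val_shift Let_def)

lemma run_models_step:
  assumes q: "q \<le> tm_states M" and as: "length as = tm_tapes M" "\<forall>a\<in>set as. a < tm_symbols M"
    and f: "f \<in> set (step_families M Te (width Te Pe) q as)"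
  shows "models x (run_atom u) f"
proof -
  note d = delta_wf[OF q as]
  note prem = run_models_premise[OF q as]
  let ?pre = "premise M (width Te Pe) q as" and ?t = "Add (Var 1) (Const 1)" and ?D = "delta M q as"
  have "models x (run_atom u) (None, Te, Const 1, ?pre @ [(True, fst ?D, ?t, Const 0)])"
    using d(1) conf_Suc(1) by (intro prem) (simp add: run_atom_simps)
  moreover have "models x (run_atom u) (None, Te, Const 1, ?pre @
      [(True, sym_code M j (fst (snd ?D ! j)), ?t, shift (snd (snd ?D ! j)) (width Te Pe))])"
    if "j < tm_tapes M" for j
    using d(3)[OF that] by (intro prem) (simp add: run_atom_simps sym_shift[OF _ _ that, simplified])
  moreover have "models x (run_atom u) (None, Te, width Te Pe, ?pre @
      [(False, sym_code M j a, Var 1, Add (Const 1) (Var 3)),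
       (True, sym_code M j a, ?t, shift (snd (snd ?D ! j)) (Var 3))])"
    if "j < tm_tapes M" "a < tm_symbols M" for j a
    using that(2) by (intro prem) (simp add: run_atom_simps sym_shift[OF _ _ that(1), simplified])
  moreover have "models x (run_atom u) (None, Te, width Te Pe, ?pre @
      [(False, sym_code M j a, Var 1, Add (Add (width Te Pe) (Const 2)) (Var 3)),
       (True, sym_code M j a, ?t, shift (snd (snd ?D ! j)) (Add (Add (width Te Pe) (Const 1)) (Var 3)))])"
    if "j < tm_tapes M" "a < tm_symbols M" for j a
    using that(2) by (intro prem) (simp add: run_atom_simps sym_shift[OF _ _ that(1), simplified])
  ultimately show ?thesis
    using f unfolding step_families_def Let_def by (auto simp del: models.simps One_nat_def)
qed

lemma in_families:
  "f \<in> set (families M Te Pe) \<longleftrightarrow> f \<in> set (init_families M Te Pe) \<or>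
     (\<exists>q\<in>{..tm_states M}. \<exists>as\<in>{as. length as = tm_tapes M \<and> (\<forall>a\<in>set as. a < tm_symbols M)}.
        f \<in> set (step_families M Te (width Te Pe) q as)) \<or>
     f = (None, Const 1, Add (Mul (Const 2) (width Te Pe)) (Const 3), [(False, sym_code M 0 1, Te, Var 3)])"
proof -
  have "set (List.n_lists (tm_tapes M) [0..<tm_symbols M]) =
      {as. length as = tm_tapes M \<and> (\<forall>a\<in>set as. a < tm_symbols M)}"
    by (auto simp: in_n_lists)
  then show ?thesis
    by (simp add: families_def atLeast0LessThan lessThan_Suc_atMost del: upt_Suc) argo
qed

theorem run_models:
  assumes "length u \<le> P" "R x u" "f \<in> set (families M Te Pe)"
  shows "models x (run_atom u) f"
proof -
  have "sym u T 0 z \<noteq> Suc 0" for z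
    using final_contents[OF assms(1)] assms(2) by (simp add: contents_def)
  then have "models x (run_atom u)
      (None, Const 1, Add (Mul (Const 2) (width Te Pe)) (Const 3), [(False, sym_code M 0 1, Te, Var 3)])"
    using three by (simp add: run_atom_simps)
  then show ?thesis
    using assms(3) run_models_init[OF assms(1)] run_models_step unfolding in_families by blast
qed

lemma modelsD:
  "models x \<beta> (g, bt, bi, ls) \<Longrightarrow> t < val bt (input_env x) \<Longrightarrow> i < val bi (input_env x) \<Longrightarrow> guard x g i \<Longrightarrow>
    \<exists>l \<in> set ls. lit_true \<beta> (loop_env x (val bt (input_env x)) (val bi (input_env x)) t i) l"
  by simp

section \<open>Models yield certificates\<close>

context
  fixes \<beta> :: "nat \<Rightarrow> nat \<Rightarrow> nat \<Rightarrow> bool"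
  assumes models: "\<And>f. f \<in> set (families M Te Pe) \<Longrightarrow> models x \<beta> f"
begin

text \<open>The end of the guessed certificate. The disjunct \<open>i = P\<close> makes the minimum
  exist and bounds the length.\<close>

definition blank_from :: nat where
  "blank_from = (LEAST i. i = P \<or> \<beta> (sym_code M 1 0) 0 (Suc H + i))"

text \<open>A model may allow both bits in a cell; then \<open>True\<close> is taken. All that
  matters is that the atom for the chosen bit is true.\<close>

definition cert :: "bool list" where
  "cert = map (\<lambda>i. \<beta> (sym_code M 1 2) 0 (Suc H + i)) [0..<blank_from]"

lemma init_model: "\<forall>f \<in> set (init_families M Te Pe). models x \<beta> f"
  using models by (simp add: families_def)

lemma cert_length: "length cert \<le> P"
  unfolding cert_def blank_from_def by (auto intro: Least_le)

lemma init_facts: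
  "\<beta> 0 0 0"
  "i < length x \<Longrightarrow> x ! i \<Longrightarrow> \<beta> (sym_code M 0 2) 0 (Suc H + i)"
  "i < length x \<Longrightarrow> \<not> x ! i \<Longrightarrow> \<beta> (sym_code M 0 1) 0 (Suc H + i)"
  "i \<le> P + 2 * T \<Longrightarrow> \<beta> (sym_code M 0 0) 0 (Suc H + length x + i)"
  "i < P \<Longrightarrow> \<beta> (sym_code M 1 0) 0 (Suc H + i) \<or> \<beta> (sym_code M 1 1) 0 (Suc H + i) \<or>
     \<beta> (sym_code M 1 2) 0 (Suc H + i)"
  "i < P \<Longrightarrow> \<beta> (sym_code M 1 0) 0 (Suc H + i) \<Longrightarrow> \<beta> (sym_code M 1 0) 0 (Suc H + Suc i)"
  "i \<le> length x + 2 * T \<Longrightarrow> \<beta> (sym_code M 1 0) 0 (Suc H + P + i)"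
  "j < tm_tapes M \<Longrightarrow> i < H \<Longrightarrow> \<beta> (sym_code M j 0) 0 (Suc i)"
  "2 \<le> j \<Longrightarrow> j < tm_tapes M \<Longrightarrow> i \<le> H \<Longrightarrow> \<beta> (sym_code M j 0) 0 (Suc H + i)"
  using init_model[unfolded init_families_def Let_def set_append ball_Un, simplified, simplified guard_def, simplified]
  by (auto simp: less_Suc_eq_le)

lemma blank_after:
  assumes "blank_from \<le> i" "i \<le> H"
  shows "\<beta> (sym_code M 1 0) 0 (Suc H + i)"
proof (cases "i < P")
  case True
  have "blank_from = P \<or> \<beta> (sym_code M 1 0) 0 (Suc H + blank_from)"
    unfolding blank_from_def by (rule LeastI[of _ P]) simp
  then have start: "\<beta> (sym_code M 1 0) 0 (Suc H + blank_from)" using True assms by auto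
  show ?thesis
    using assms(1) True
  proof (induction i rule: dec_induct)
    case base
    show ?case by (rule start)
  next
    case (step n)
    then show ?case using init_facts(6)[of n] by simp
  qed
next
  case False
  then have "Suc H + P + (i - P) = Suc H + i" by simp
  moreover have "i - P \<le> length x + 2 * T" using assms(2) by (simp add: H_def)
  ultimately show ?thesis using init_facts(7)[of "i - P"] by (simp only:)
qed

lemma start_symbols:
  assumes j: "j < tm_tapes M" and z: "\<bar>z\<bar> \<le> int H"
  shows "\<beta> (sym_code M j (sym cert 0 j z)) 0 (nat (int (Suc H) + z))"
proof (cases "z < 0")
  case True
  then have "nat (int (Suc H) + z) = Suc (nat (int H + z))" "nat (int H + z) < H" using z by auto
  moreover have "sym cert 0 j z = 0" using True j by (simp add: conf_0 contents_def)
  ultimately show ?thesis using init_facts(8)[OF j, of "nat (int H + z)"] by simp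
next
  case False
  then obtain i where i: "z = int i" by (metis not_less nonneg_int_cases)
  then have iH: "i \<le> H" and nat: "nat (int (Suc H) + z) = Suc H + i" using z by auto
  consider "j = 0" | "j = 1" | "2 \<le> j" by linarith
  then show ?thesis
  proof cases
    case 1
    show ?thesis
    proof (cases "i < length x")
      case True
      then show ?thesis unfolding nat using 1 j i init_facts(2,3)[of i] by (simp add: conf_0 contents_def)
    next
      case False
      then have "Suc H + length x + (i - length x) = Suc H + i" by simp
      moreover have "i - length x \<le> P + 2 * T" using iH by (simp add: H_def)
      ultimately have "\<beta> (sym_code M 0 0) 0 (Suc H + i)"
        using init_facts(4)[of "i - length x"] by (simp only:)
      then show ?thesis unfolding nat using False 1 j i by (simp add: conf_0 contents_def)
    qed
  next
    case 2
    show ?thesis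
    proof (cases "i < blank_from")
      case True
      have "\<not> (i = P \<or> \<beta> (sym_code M 1 0) 0 (Suc H + i))"
        using True unfolding blank_from_def by (rule not_less_Least)
      moreover have "i < P" using True cert_length by (simp add: cert_def)
      ultimately have "\<beta> (sym_code M 1 1) 0 (Suc H + i) \<or> \<beta> (sym_code M 1 2) 0 (Suc H + i)"
        using init_facts(5)[of i] by blast
      then show ?thesis unfolding nat using 2 j i True by (auto simp: conf_0 contents_def cert_def)
    next
      case False
      then show ?thesis unfolding nat using 2 j i iH blank_after[of i]
        by (simp add: conf_0 contents_def cert_def)
    qed
  next
    case 3
    then show ?thesis unfolding nat using j i iH init_facts(9)[of j i] by (simp add: conf_0 contents_def)
  qed
qed

text \<open>A model may make more atoms true than the run does, but the Horn clauses force those of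
  the run within the window, which shrinks because a shifted cell is known only if its neighbour
  was.\<close>

lemma run_facts:
  assumes "t \<le> T"
  shows "\<beta> (st cert t) t 0 \<and> (\<forall>j<tm_tapes M. \<forall>z. \<bar>z\<bar> \<le> int H - int t \<longrightarrow>
    \<beta> (sym_code M j (sym cert t j z)) t (nat (int (Suc H) + z)))"
  using assms
proof (induction t)
  case 0
  then show ?case using init_facts(1) start_symbols by (simp add: conf_0)
next
  case (Suc t)
  let ?q = "st cert t" and ?as = "reads cert t"
  let ?D = "delta M ?q ?as"
  let ?pre = "premise M (width Te Pe) ?q ?as" and ?t = "Add (Var 1) (Const 1)"
  have IH: "\<beta> ?q t 0" "\<And>j z. j < tm_tapes M \<Longrightarrow> \<bar>z\<bar> \<le> int H - int t \<Longrightarrow>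
      \<beta> (sym_code M j (sym cert t j z)) t (nat (int (Suc H) + z))"
    using Suc by auto
  have tT: "t < T" "t \<le> H" using Suc.prems by (auto simp: H_def)
  have no: "\<not> lit_true \<beta> (loop_env x T b t i) l" if "l \<in> set ?pre" for l b i
  proof -
    have "nat (1 + int H) = Suc H" by simp
    then show ?thesis using that IH(1) IH(2)[of _ 0] tT by (auto simp: premise_def reads_def)
  qed
  have fam: "models x \<beta> f" if "f \<in> set (step_families M Te (width Te Pe) ?q ?as)" for f
    using that conf_invar[of cert t] reads_wf[of cert t]
    by (intro models) (unfold in_families, blast)
  have use: "\<exists>l \<in> set ls. lit_true \<beta> (loop_env x T (val bi (input_env x)) t i) l"
    if "(None, Te, bi, ?pre @ ls) \<in> set (step_families M Te (width Te Pe) ?q ?as)"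
      "i < val bi (input_env x)" for bi ls i
    using modelsD[OF fam[OF that(1)], of t i] that(2) tT no by (auto simp: guard_def)
  have 1: "\<beta> (st cert (Suc t)) (Suc t) 0"
    using use[of "Const 1" "[(True, fst ?D, ?t, Const 0)]" 0] conf_Suc(1)
    by (simp add: step_families_def Let_def)
  have 2: "\<beta> (sym_code M j (sym cert (Suc t) j z)) (Suc t) (nat (int (Suc H) + z))"
    if j: "j < tm_tapes M" and z: "\<bar>z\<bar> \<le> int H - int (Suc t)" for j z
  proof -
    let ?d = "snd (snd ?D ! j)"
    \<comment> \<open>The distance, before the step, of the cell that is at distance
      \<open>z\<close> after it.\<close>
    define y where "y = z + head_move ?d 0"
    have s: "sym cert (Suc t) j z = (if y = 0 then fst (snd ?D ! j) else sym cert t j y)"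
      using conf_Suc(3)[OF j, of cert t z] by (simp add: y_def Let_def)
    have "\<bar>head_move ?d 0\<bar> \<le> 1" by (cases ?d) auto
    then have y: "\<bar>y\<bar> \<le> int H - int t" using z by (simp add: y_def)
    have a: "sym cert t j y < tm_symbols M" using conf_invar j by blast
    have tgt: "val (shift ?d b) \<eta> = nat (int (Suc H) + z)" if "int (val b \<eta>) = int H + y" for b \<eta>
      using int_val_shift[of ?d b \<eta>] that by (simp add: y_def)
    consider "y = 0" | "y < 0" | "y > 0" by linarith
    then show ?thesis
    proof cases
      case 1
      have "\<exists>l \<in> set [(True, sym_code M j (fst (snd ?D ! j)), ?t, shift ?d (width Te Pe))].
          lit_true \<beta> (loop_env x T (val (Const 1) (input_env x)) t 0) l"
        using j by (intro use) (auto simp: step_families_def Let_def)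
      then show ?thesis using 1 s tgt[of "width Te Pe"] by simp
    next
      case 2
      define i where "i = nat (int H + y)"
      have i: "int i = int H + y" "i < H" using 2 y by (auto simp: i_def)
      have "\<exists>l \<in> set [(False, sym_code M j (sym cert t j y), Var 1, Add (Const 1) (Var 3)),
          (True, sym_code M j (sym cert t j y), ?t, shift ?d (Var 3))].
          lit_true \<beta> (loop_env x T (val (width Te Pe) (input_env x)) t i) l"
        using j a i by (intro use) (fastforce simp: step_families_def Let_def)+
      moreover have "nat (int (Suc H) + y) = Suc i" using i by simp
      ultimately show ?thesis using 2 s tgt[of "Var 3" "loop_env x T H t i"] i IH(2)[OF j y] by simp
    next
      case 3
      define i where "i = nat (y - 1)"
      have i: "int i = y - 1" "i < H" using 3 y by (auto simp: i_def)
      have "\<exists>l \<in> set [(False, sym_code M j (sym cert t j y), Var 1, Add (Add (width Te Pe) (Const 2)) (Var 3)),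
          (True, sym_code M j (sym cert t j y), ?t, shift ?d (Add (Add (width Te Pe) (Const 1)) (Var 3)))].
          lit_true \<beta> (loop_env x T (val (width Te Pe) (input_env x)) t i) l"
        using j a i by (intro use) (fastforce simp: step_families_def Let_def)+
      moreover have "nat (int (Suc H) + y) = H + 2 + i" using i by simp
      ultimately show ?thesis
        using 3 s tgt[of "Add (Add (width Te Pe) (Const 1)) (Var 3)" "loop_env x T H t i"] i IH(2)[OF j y] by simp
    qed
  qed
  show ?case using 1 2 by blast
qed

theorem models_cert: "R x cert"
proof (rule ccontr)
  assume no: "\<not> R x cert"
  \<comment> \<open>Cell \<open>0\<close> of the output tape as seen from the head; in a rejecting
    run it carries symbol \<open>1\<close>.\<close>
  define z where "z = - hpos cert T 0"
  have "sym cert T 0 z = 1"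
    using final_contents[OF cert_length] no by (simp add: z_def contents_def)
  moreover have z: "\<bar>z\<bar> \<le> int T" using hpos_bound[of 0 cert T] two by (simp add: z_def)
  ultimately have "\<beta> (sym_code M 0 1) T (nat (int (Suc H) + z))"
    using run_facts[of T] two by (auto simp: H_def dest!: spec[of _ "0 :: nat"] spec[of _ z])
  moreover have "models x \<beta> (None, Const 1, Add (Mul (Const 2) (width Te Pe)) (Const 3), [(False, sym_code M 0 1, Te, Var 3)])"
    by (rule models) (simp add: in_families)
  moreover have "nat (int (Suc H) + z) < 2 * H + 3" using z by (auto simp: H_def)
  ultimately show False by (simp add: guard_def)
qed

end

corollary satisfiable_iff:
  "(\<exists>\<beta>. \<forall>f \<in> set (families M Te Pe). models x \<beta> f) \<longleftrightarrow> (\<exists>u. length u \<le> P \<and> R x u)"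
  using run_models models_cert cert_length by blast

end

section \<open>The reduction\<close>

definition times_exp :: "pexp \<Rightarrow> pexp" where
  "times_exp Te = Add Te (Const 1)"

definition cells_exp :: "pexp \<Rightarrow> pexp \<Rightarrow> pexp" where
  "cells_exp Te Pe = Add (Mul (Const 2) (width Te Pe)) (Const 3)"

text \<open>A mixed radix numeral with \<open>T + 1\<close> times and \<open>2 * H + 3\<close>
  cells. Its leading part \<open>n\<close> is an atom code when variables are numbered and the
  number of a family when clauses are.\<close>

definition index_exp :: "pexp \<Rightarrow> pexp \<Rightarrow> nat \<Rightarrow> pexp \<Rightarrow> pexp \<Rightarrow> pexp" where
  "index_exp Te Pe n t i = Add (Mul (Add (Mul (Const n) (times_exp Te)) t) (cells_exp Te Pe)) i"

text \<open>The two literals of atom number \<open>a\<close> become the variables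
  \<open>2 * a\<close> and \<open>2 * a + 1\<close>.\<close>

fun lit_exp :: "pexp \<Rightarrow> pexp \<Rightarrow> literal \<Rightarrow> pexp" where
  "lit_exp Te Pe (sg, \<kappa>, tp, ip) = Add (Mul (Const 2) (index_exp Te Pe \<kappa> tp ip)) (Const (if sg then 0 else 1))"

definition codes :: "tm \<Rightarrow> nat" where
  "codes M = Suc (tm_states M) + tm_tapes M * tm_symbols M"

text \<open>A premise has \<open>tm_tapes M + 1\<close> literals, and at most two more follow
  it.\<close>

definition clause_width :: "tm \<Rightarrow> nat" where
  "clause_width M = tm_tapes M + 3"

definition atoms_exp :: "tm \<Rightarrow> pexp \<Rightarrow> pexp \<Rightarrow> pexp" where
  "atoms_exp M Te Pe = Mul (Mul (Const (codes M)) (times_exp Te)) (cells_exp Te Pe)"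

definition pos_clauses_exp :: "tm \<Rightarrow> pexp \<Rightarrow> pexp \<Rightarrow> pexp" where
  "pos_clauses_exp M Te Pe = Mul (Mul (Const (length (families M Te Pe))) (times_exp Te)) (cells_exp Te Pe)"

definition vars_exp :: "tm \<Rightarrow> pexp \<Rightarrow> pexp \<Rightarrow> pexp" where
  "vars_exp M Te Pe = Mul (Const 2) (atoms_exp M Te Pe)"

definition fill_exp :: "tm \<Rightarrow> pexp \<Rightarrow> pexp \<Rightarrow> pexp" where
  "fill_exp M Te Pe = Mul (Add (pos_clauses_exp M Te Pe) (atoms_exp M Te Pe)) (Const (clause_width M))"

definition stacks_exp :: "tm \<Rightarrow> pexp \<Rightarrow> pexp \<Rightarrow> pexp" where
  "stacks_exp M Te Pe = Add (fill_exp M Te Pe) (Const (clause_width M - 1))"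

definition pages_exp :: "tm \<Rightarrow> pexp \<Rightarrow> pexp \<Rightarrow> pexp" where
  "pages_exp M Te Pe = Add (stacks_exp M Te Pe) (vars_exp M Te Pe)"

definition rad_exp :: "tm \<Rightarrow> pexp \<Rightarrow> pexp \<Rightarrow> pexp" where
  "rad_exp M Te Pe = Add (pages_exp M Te Pe) (Const 5)"

fun pos_exp :: "pexp \<Rightarrow> pexp \<times> pexp \<times> pexp \<times> pexp \<times> pexp \<Rightarrow> pexp" where
  "pos_exp R (r, a, b, c, d) = Add (Mul (Add (Mul (Add (Mul (Add (Mul r R) a) R) b) R) c) R) d"

type_synonym edge_em = "(pexp \<times> pexp) list em"

definition edge_leaf :: "(pexp \<times> pexp) list \<Rightarrow> (nat \<Rightarrow> nat) \<Rightarrow> (nat \<times> nat) list" where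
  "edge_leaf ps \<eta> = map (\<lambda>(p, q). (val p \<eta>, val q \<eta>)) ps"

definition wf_edge_leaf :: "nat \<Rightarrow> (pexp \<times> pexp) list \<Rightarrow> bool" where
  "wf_edge_leaf d ps \<longleftrightarrow> (\<forall>(p, q) \<in> set ps. below d p \<and> below d q)"

text \<open>A loop opened at level \<open>d\<close> binds \<open>Var d\<close> and the complement
  \<open>Var (d + 1)\<close>. With \<open>k + 1\<close> rounds the complement of \<open>j\<close> is
  \<open>k - j\<close>; with \<open>V\<close> rounds that of \<open>v\<close> is
  \<open>V - Suc v\<close>, which is also the number of columns of \<open>Below v\<close>.\<close>

definition frame_em :: "tm \<Rightarrow> pexp \<Rightarrow> pexp \<Rightarrow> edge_em" where
  "frame_em M Te Pe = (let R = rad_exp M Te Pe; k1 = Add (pages_exp M Te Pe) (Const 1); z = Const 0 in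
     Cat (Rep (stacks_exp M Te Pe) (Rep k1 (Leaf
           [(pos_exp R (z, z, z, Var 1, Var 3), pos_exp R (z, z, Const 1, Var 1, Var 4))])))
         (Rep (vars_exp M Te Pe)
           (Cat (Rep (Var 2) (Rep k1 (Leaf
                  [(pos_exp R (Const 1, Var 1, Const 2, Var 3, Var 5),
                    pos_exp R (Const 1, Var 1, Const 3, Var 4, Var 5))])))
                (Rep k1 (Leaf
                  [(pos_exp R (Const 1, Var 1, Const 4, z, Var 3), pos_exp R (Const 3, Var 2, z, z, Var 3))])))))"

definition clause_em :: "tm \<Rightarrow> pexp \<Rightarrow> pexp \<Rightarrow> nat \<Rightarrow> nat \<Rightarrow> pexp \<Rightarrow> (nat \<Rightarrow> pexp) \<Rightarrow> edge_em" where
  "clause_em M Te Pe d sg c v = (let R = rad_exp M Te Pe; k1 = Add (pages_exp M Te Pe) (Const 1) in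
     Cat (Leaf (map (\<lambda>l. (pos_exp R (Const 1, v l, Const sg, c, Const l), pos_exp R (Const 2, c, Const 1, v l, Const l)))
            [0..<clause_width M]))
         (Rep (fill_exp M Te Pe) (Rep k1 (Leaf
            [(pos_exp R (Const 2, c, Const 0, Var d, Var (d + 2)),
              pos_exp R (Const 2, c, Const 2, Var d, Var (d + 3)))]))))"

text \<open>The index \<open>min l (length ls - 1)\<close> pads short clauses by repeating their
  last literal, so that all clauses have the same number of wires.\<close>

fun family_em :: "tm \<Rightarrow> pexp \<Rightarrow> pexp \<Rightarrow> nat \<Rightarrow> family \<Rightarrow> edge_em" where
  "family_em M Te Pe n (g, bt, bi, ls) = (
     let e = clause_em M Te Pe 5 1 (index_exp Te Pe n (Var 1) (Var 3))
               (\<lambda>l. lit_exp Te Pe (ls ! min l (length ls - 1))) in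
     Rep bt (Rep bi (case g of None \<Rightarrow> e
       | Some b \<Rightarrow> if b then If_Bit 3 e (Leaf []) else If_Bit 3 (Leaf []) e)))"

text \<open>The last loop adds, for every atom, the negative clause that its two literals are not
  both true. This suffices to tie them together, because the other clauses use all literals
  positively.\<close>

definition edges_em :: "tm \<Rightarrow> pexp \<Rightarrow> pexp \<Rightarrow> edge_em" where
  "edges_em M Te Pe = Cat (frame_em M Te Pe)
     (Cat (foldr (\<lambda>n. Cat (family_em M Te Pe n (families M Te Pe ! n))) [0..<length (families M Te Pe)] (Leaf []))
          (Rep (atoms_exp M Te Pe) (clause_em M Te Pe 3 0 (Add (pos_clauses_exp M Te Pe) (Var 1))
             (\<lambda>l. if l = 0 then Mul (Const 2) (Var 1) else Add (Mul (Const 2) (Var 1)) (Const 1)))))"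

definition instance_em :: "tm \<Rightarrow> pexp \<Rightarrow> pexp \<Rightarrow> leaf list em" where
  "instance_em M Te Pe = (let R = rad_exp M Te Pe in
     Cat (Rep (Mul (Mul (Mul (Mul (Const 4) R) R) R) R) (Leaf [Out [True], Pow (Var 1)]))
    (Cat (Leaf [Out [False]])
    (Cat (map_em (\<lambda>ps. concat (map (\<lambda>(p, q). [Out [True], Pow p, Pow q]) ps)) (edges_em M Te Pe))
         (Leaf [Out [False], Bin (pages_exp M Te Pe)]))))"

section \<open>Variable bounds in the printing program\<close>

lemma below_mono: "below d p \<Longrightarrow> d \<le> d' \<Longrightarrow> below d' p"
  by (induction p) auto

lemma below_exps:
  assumes "below 1 Te" "below 1 Pe" "0 < d"
  shows "below d Te" "below d Pe" "below d (times_exp Te)" "below d (width Te Pe)" "below d (cells_exp Te Pe)"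
    "below d (atoms_exp M Te Pe)" "below d (pos_clauses_exp M Te Pe)" "below d (vars_exp M Te Pe)"
    "below d (fill_exp M Te Pe)" "below d (stacks_exp M Te Pe)" "below d (pages_exp M Te Pe)"
    "below d (rad_exp M Te Pe)"
  using below_mono[OF assms(1), of d] below_mono[OF assms(2), of d] assms(3)
  by (simp_all add: times_exp_def width_def cells_exp_def atoms_exp_def pos_clauses_exp_def
      vars_exp_def fill_exp_def stacks_exp_def pages_exp_def rad_exp_def)

definition wf_family :: "tm \<Rightarrow> family \<Rightarrow> bool" where
  "wf_family M = (\<lambda>(g, bt, bi, ls). below 1 bt \<and> below 1 bi \<and> ls \<noteq> [] \<and> length ls \<le> clause_width M \<and>
     (\<forall>(sg, \<kappa>, tp, ip) \<in> set ls. below 5 tp \<and> below 5 ip \<and> \<kappa> < codes M))"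

lemma wf_clause_em:
  assumes "below 1 Te" "below 1 Pe" "0 < d" "below d c" "\<And>l. l < clause_width M \<Longrightarrow> below d (v l)"
  shows "wf_em wf_edge_leaf d (clause_em M Te Pe d sg c v)"
proof -
  have "below (d + 4) c" using assms(4) by (rule below_mono) simp
  then show ?thesis
    using assms below_exps[OF assms(1,2)]
    by (auto simp: clause_em_def Let_def wf_edge_leaf_def eval_nat_numeral)
qed

lemma wf_edges_em:
  assumes Te: "below 1 Te" and Pe: "below 1 Pe" and fam: "\<And>f. f \<in> set (families M Te Pe) \<Longrightarrow> wf_family M f"
  shows "wf_em wf_edge_leaf 1 (edges_em M Te Pe)"
proof -
  note b = below_exps[OF Te Pe]
  have "wf_em wf_edge_leaf 1 (frame_em M Te Pe)"
    using b by (simp add: frame_em_def Let_def wf_edge_leaf_def eval_nat_numeral)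
  moreover have "wf_em wf_edge_leaf 1 (family_em M Te Pe n f)" if "wf_family M f" for n f
  proof -
    obtain g bt bi ls where f: "f = (g, bt, bi, ls)" by (cases f) auto
    have w: "below 1 bt" "below 1 bi" "ls \<noteq> []" "\<And>sg \<kappa> tp ip. (sg, \<kappa>, tp, ip) \<in> set ls \<Longrightarrow> below 5 tp \<and> below 5 ip"
      using that by (auto simp: wf_family_def f)
    have "below 5 (lit_exp Te Pe (ls ! min l (length ls - 1)))" for l
    proof -
      obtain sg \<kappa> tp ip where l: "ls ! min l (length ls - 1) = (sg, \<kappa>, tp, ip)"
        by (metis prod_cases4)
      have "ls ! min l (length ls - 1) \<in> set ls" using w(3) by (intro nth_mem) (cases ls; auto)
      then show ?thesis unfolding l using w(4) b by (simp add: index_exp_def)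
    qed
    then have "wf_em wf_edge_leaf 5 (clause_em M Te Pe 5 1 (index_exp Te Pe n (Var 1) (Var 3))
               (\<lambda>l. lit_exp Te Pe (ls ! min l (length ls - 1))))" (is "wf_em _ _ ?e")
      using b by (intro wf_clause_em Te Pe) (auto simp: index_exp_def)
    then have "wf_em wf_edge_leaf 5 (case g of None \<Rightarrow> ?e
       | Some b \<Rightarrow> if b then If_Bit 3 ?e (Leaf []) else If_Bit 3 (Leaf []) ?e)"
      by (auto simp: wf_edge_leaf_def split: option.split)
    moreover have "below (1 + 2) bi" using w(2) by (rule below_mono) simp
    moreover have "1 + 2 + 2 = (5 :: nat)" by simp
    ultimately show ?thesis
      using w(1) unfolding f family_em.simps Let_def wf_em.simps by (simp only: simp_thms)
  qed
  then have fold: "wf_em wf_edge_leaf 1 (foldr (\<lambda>n. Cat (family_em M Te Pe n (families M Te Pe ! n))) ns (Leaf []))"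
    if "set ns \<subseteq> {..<length (families M Te Pe)}" for ns
    using that fam by (induction ns) (auto simp: wf_edge_leaf_def)
  moreover have "wf_em wf_edge_leaf 1 (foldr (\<lambda>n. Cat (family_em M Te Pe n (families M Te Pe ! n)))
      [0..<length (families M Te Pe)] (Leaf []))"
    by (rule fold) (simp add: atLeast0LessThan)
  moreover have "wf_em wf_edge_leaf (1 + 2) (clause_em M Te Pe 3 0 (Add (pos_clauses_exp M Te Pe) (Var 1))
             (\<lambda>l. if l = 0 then Mul (Const 2) (Var 1) else Add (Mul (Const 2) (Var 1)) (Const 1)))"
  proof -
    have "1 + 2 = (3 :: nat)" by simp
    then show ?thesis using b by (simp only:) (intro wf_clause_em Te Pe, auto)
  qed
  ultimately show ?thesis
    unfolding edges_em_def wf_em.simps using b(6)[of 1] by simp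
qed

lemma wf_instance_em:
  assumes Te: "below 1 Te" and Pe: "below 1 Pe" and fam: "\<And>f. f \<in> set (families M Te Pe) \<Longrightarrow> wf_family M f"
  shows "wf_em wf_leaves 1 (instance_em M Te Pe)"
proof -
  have "wf_em wf_leaves 1 (map_em (\<lambda>ps. concat (map (\<lambda>(p, q). [Out [True], Pow p, Pow q]) ps)) (edges_em M Te Pe))"
    by (rule wf_em_map_em[OF _ wf_edges_em[OF assms]]) (auto simp: wf_edge_leaf_def wf_leaves_def)
  then show ?thesis
    using below_exps[OF Te Pe] by (simp add: instance_em_def Let_def wf_leaves_def)
qed

lemma sem_instance_em:
  "sem leaves_out x 1 (instance_em M Te Pe) (input_env x) =
    enc_instance (map ((^) 2) [0..<val (Mul (Mul (Mul (Mul (Const 4) (rad_exp M Te Pe)) (rad_exp M Te Pe))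
        (rad_exp M Te Pe)) (rad_exp M Te Pe)) (input_env x)])
      (map (\<lambda>(a, b). (2 ^ a, 2 ^ b)) (sem edge_leaf x 1 (edges_em M Te Pe) (input_env x)))
      (val (pages_exp M Te Pe) (input_env x))"
proof -
  have "sem leaves_out x 1 (map_em (\<lambda>ps. concat (map (\<lambda>(p, q). [Out [True], Pow p, Pow q]) ps)) (edges_em M Te Pe))
      (input_env x) = concat (map (\<lambda>(a, b). True # enc_pair (2 ^ a, 2 ^ b))
      (sem edge_leaf x 1 (edges_em M Te Pe) (input_env x)))"
  proof (rule sem_map_em)
    show "leaves_out (concat (map (\<lambda>(p, q). [Out [True], Pow p, Pow q]) ps)) \<eta> =
        concat (map (\<lambda>(a, b). True # enc_pair (2 ^ a, 2 ^ b)) (edge_leaf ps \<eta>))" for ps \<eta>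
      by (induction ps) (auto simp: leaves_out_def edge_leaf_def enc_pair_def)
  qed
  then show ?thesis
    by (simp add: instance_em_def Let_def leaves_out_def enc_instance_def enc_list_def comp_def case_prod_unfold)
qed

lemma below_shift: "below d b \<Longrightarrow> below d (shift m b)"
  by (cases m) auto

lemma val_shift_le: "val (shift m b) \<eta> \<le> val b \<eta> + 2"
  by (cases m) auto

section \<open>Ranges of the atoms and clauses\<close>

context verifier
begin

text \<open>The bounds on times and cells are those under which the mixed radix numbering is
  injective.\<close>

definition good_family :: "family \<Rightarrow> bool" where
  "good_family = (\<lambda>(g, bt, bi, ls). wf_family M (g, bt, bi, ls) \<and>
     val bt (input_env x) \<le> Suc T \<and> val bi (input_env x) \<le> 2 * H + 3 \<and>
     (\<forall>t < val bt (input_env x). \<forall>i < val bi (input_env x). \<forall>(sg, \<kappa>, tp, ip) \<in> set ls.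
        val tp (loop_env x (val bt (input_env x)) (val bi (input_env x)) t i) \<le> T \<and>
        val ip (loop_env x (val bt (input_env x)) (val bi (input_env x)) t i) < 2 * H + 3))"

lemma sym_code_less: "j < tm_tapes M \<Longrightarrow> a < tm_symbols M \<Longrightarrow> sym_code M j a < codes M"
proof -
  assume "j < tm_tapes M" "a < tm_symbols M"
  then have "j * tm_symbols M + a < Suc j * tm_symbols M" "Suc j * tm_symbols M \<le> tm_tapes M * tm_symbols M"
    by (simp, intro mult_right_mono) auto
  then show ?thesis unfolding sym_code_def codes_def by linarith
qed

lemma state_less: "q \<le> tm_states M \<Longrightarrow> q < codes M"
  by (simp add: codes_def)

lemma below5: "below 5 Te" "below 5 Pe" "below 5 (width Te Pe)" "below 1 (width Te Pe)"
  using below_exps[OF below] by simp_all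

lemma good_init: "f \<in> set (init_families M Te Pe) \<Longrightarrow> good_family f"
proof -
  have c: "0 < tm_symbols M" "Suc 0 < tm_symbols M" "2 < tm_symbols M" "0 < tm_tapes M" "Suc 0 < tm_tapes M"
    using three two by auto
  have "\<forall>f \<in> set (init_families M Te Pe). good_family f"
    unfolding init_families_def Let_def set_append ball_Un
    using c below below5
    by (simp add: good_family_def wf_family_def sym_code_less clause_width_def state_less) (auto simp: H_def)
  then show "f \<in> set (init_families M Te Pe) \<Longrightarrow> good_family f" by blast
qed

lemma good_step:
  assumes q: "q \<le> tm_states M" and as: "length as = tm_tapes M" "\<forall>a\<in>set as. a < tm_symbols M"
    and f: "f \<in> set (step_families M Te (width Te Pe) q as)"
  shows "good_family f"
proof -
  note d = delta_wf[OF q as]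
  let ?pre = "premise M (width Te Pe) q as" and ?t = "Add (Var 1) (Const 1)" and ?D = "delta M q as"
  have pre: "good_family (None, Te, bi, ?pre @ ls)"
    if "below 1 bi" "val bi (input_env x) \<le> H + 1" "length ls \<le> 2"
      "\<And>sg \<kappa> tp ip. (sg, \<kappa>, tp, ip) \<in> set ls \<Longrightarrow> below 5 tp \<and> below 5 ip \<and> \<kappa> < codes M"
      "\<And>t i sg \<kappa> tp ip. t < T \<Longrightarrow> i < val bi (input_env x) \<Longrightarrow> (sg, \<kappa>, tp, ip) \<in> set ls \<Longrightarrow>
        val tp (loop_env x T (val bi (input_env x)) t i) \<le> T \<and>
        val ip (loop_env x T (val bi (input_env x)) t i) < 2 * H + 3" for bi ls
  proof -
    have "as ! j < tm_symbols M" if "j < tm_tapes M" for j using as that by auto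
    then have p: "\<And>sg \<kappa> tp ip. (sg, \<kappa>, tp, ip) \<in> set ?pre \<Longrightarrow> below 5 tp \<and> below 5 ip \<and> \<kappa> < codes M"
      using q below5 by (auto simp: premise_def sym_code_less state_less)
    have p': "\<And>t i sg \<kappa> tp ip. t < T \<Longrightarrow> (sg, \<kappa>, tp, ip) \<in> set ?pre \<Longrightarrow>
        val tp (loop_env x T (val bi (input_env x)) t i) \<le> T \<and>
        val ip (loop_env x T (val bi (input_env x)) t i) < 2 * H + 3"
      by (auto simp: premise_def)
    have "length ?pre = Suc (tm_tapes M)" by (simp add: premise_def)
    moreover have "?pre \<noteq> []" by (simp add: premise_def)
    moreover have "\<forall>l \<in> set (?pre @ ls). case l of (sg, \<kappa>, tp, ip) \<Rightarrow> below 5 tp \<and> below 5 ip \<and> \<kappa> < codes M"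
      using p that(4) by auto
    moreover have "\<forall>t < T. \<forall>i < val bi (input_env x). \<forall>l \<in> set (?pre @ ls). case l of (sg, \<kappa>, tp, ip) \<Rightarrow>
        val tp (loop_env x T (val bi (input_env x)) t i) \<le> T \<and>
        val ip (loop_env x T (val bi (input_env x)) t i) < 2 * H + 3"
      using p' that(5) by auto
    ultimately show ?thesis
      using that(1-3) below(1) by (simp add: good_family_def wf_family_def clause_width_def)
  qed
  note sh = val_shift_le[THEN le_less_trans]
  have A: "good_family (None, Te, Const 1, ?pre @ [(True, fst ?D, ?t, Const 0)])"
    using d(1) by (intro pre) (auto simp: state_less)
  have B: "good_family (None, Te, Const 1, ?pre @
      [(True, sym_code M j (fst (snd ?D ! j)), ?t, shift (snd (snd ?D ! j)) (width Te Pe))])"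
    if "j < tm_tapes M" for j
    using d(3)[OF that] that below5 by (intro pre) (auto simp: sym_code_less below_shift intro!: sh)
  have C: "good_family (None, Te, width Te Pe, ?pre @
      [(False, sym_code M j a, Var 1, Add (Const 1) (Var 3)),
       (True, sym_code M j a, ?t, shift (snd (snd ?D ! j)) (Var 3))])"
    if "j < tm_tapes M" "a < tm_symbols M" for j a
    using that below5 by (intro pre) (auto simp: sym_code_less below_shift intro!: sh)
  have D: "good_family (None, Te, width Te Pe, ?pre @
      [(False, sym_code M j a, Var 1, Add (Add (width Te Pe) (Const 2)) (Var 3)),
       (True, sym_code M j a, ?t, shift (snd (snd ?D ! j)) (Add (Add (width Te Pe) (Const 1)) (Var 3)))])"
    if "j < tm_tapes M" "a < tm_symbols M" for j a
    using that below5 by (intro pre) (auto simp: sym_code_less below_shift intro!: sh)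
  show ?thesis
    using f A B C D unfolding step_families_def Let_def by (auto simp del: One_nat_def)
qed

lemma good_families: "f \<in> set (families M Te Pe) \<Longrightarrow> good_family f"
proof -
  have "good_family (None, Const 1, Add (Mul (Const 2) (width Te Pe)) (Const 3), [(False, sym_code M 0 1, Te, Var 3)])"
    using below5 sym_code_less[of 0 1] two three by (simp add: good_family_def wf_family_def clause_width_def)
  then show "f \<in> set (families M Te Pe) \<Longrightarrow> good_family f"
    unfolding in_families using good_init good_step by blast
qed

end

section \<open>The monotone clauses of a verifier\<close>

context verifier
begin

abbreviation "fams \<equiv> families M Te Pe"

definition I :: nat where "I = 2 * H + 3"

definition idx :: "nat \<Rightarrow> nat \<Rightarrow> nat \<Rightarrow> nat" where
  "idx n t i = (n * Suc T + t) * I + i"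

definition atoms :: nat where "atoms = codes M * Suc T * I"
definition nvars :: nat where "nvars = 2 * atoms"
definition pos_clauses :: nat where "pos_clauses = length fams * Suc T * I"

definition tb :: "nat \<Rightarrow> nat" where "tb n = val (fst (snd (fams ! n))) (input_env x)"
definition ib :: "nat \<Rightarrow> nat" where "ib n = val (fst (snd (snd (fams ! n)))) (input_env x)"

definition fam_env :: "nat \<Rightarrow> nat \<Rightarrow> nat \<Rightarrow> nat \<Rightarrow> nat" where
  "fam_env n t i = loop_env x (tb n) (ib n) t i"

definition fam_lits :: "nat \<Rightarrow> literal list" where
  "fam_lits n = snd (snd (snd (fams ! n)))"

definition fam_lit :: "nat \<Rightarrow> nat \<Rightarrow> literal" where
  "fam_lit n l = fam_lits n ! min l (length (fam_lits n) - 1)"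

fun lit_var :: "(nat \<Rightarrow> nat) \<Rightarrow> literal \<Rightarrow> nat" where
  "lit_var \<eta> (sg, \<kappa>, tp, ip) = 2 * idx \<kappa> (val tp \<eta>) (val ip \<eta>) + (if sg then 0 else 1)"

text \<open>The clause number is decoded into family, time and position by division; from
  \<open>pos_clauses\<close> on it stands for a negative clause, whose number is offset by that of
  its atom.\<close>

definition clause_var :: "nat \<Rightarrow> nat \<Rightarrow> nat" where
  "clause_var c l =
     (if c < pos_clauses
      then lit_var (fam_env (c div I div Suc T) (c div I mod Suc T) (c mod I)) (fam_lit (c div I div Suc T) l)
      else if l = 0 then 2 * (c - pos_clauses) else 2 * (c - pos_clauses) + 1)"

definition fam_clauses :: "nat \<Rightarrow> nat list" where
  "fam_clauses n = concat (map (\<lambda>t. concat (map (\<lambda>i.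
       if guard x (fst (fams ! n)) i then [idx n t i] else [])
     [0..<ib n])) [0..<tb n])"

definition clauses :: "nat list" where
  "clauses = concat (map fam_clauses [0..<length fams]) @ map ((+) pos_clauses) [0..<atoms]"

lemma idx_decode:
  assumes "t < Suc T" "i < I"
  shows "idx n t i mod I = i" "idx n t i div I mod Suc T = t" "idx n t i div I div Suc T = n"
proof -
  have "idx n t i div I = n * Suc T + t" using assms(2) by (simp add: idx_def)
  then show "idx n t i div I mod Suc T = t" "idx n t i div I div Suc T = n"
    using assms(1) by (simp_all del: mult_Suc_right)
  show "idx n t i mod I = i" using assms(2) by (simp add: idx_def)
qed

lemma idx_less: "n < N \<Longrightarrow> t < Suc T \<Longrightarrow> i < I \<Longrightarrow> idx n t i < N * Suc T * I"
  using radix_less_iff[of t "Suc T" 0 n N] radix_less_iff[of i I 0 "n * Suc T + t" "N * Suc T"]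
  by (simp add: idx_def del: mult_Suc_right)

lemma fam_good:
  assumes "n < length fams" "t < tb n"
    "i < ib n"
  shows "t < Suc T" "i < I" "fam_lits n \<noteq> []" "length (fam_lits n) \<le> clause_width M"
    "(sg, \<kappa>, tp, ip) \<in> set (fam_lits n) \<Longrightarrow>
      \<kappa> < codes M \<and> val tp (fam_env n t i) < Suc T \<and> val ip (fam_env n t i) < I"
proof -
  obtain g bt bi ls where f: "fams ! n = (g, bt, bi, ls)" by (metis prod_cases4)
  have good: "good_family (g, bt, bi, ls)" using good_families[of "fams ! n"] nth_mem[OF assms(1)] by (simp only: f)
  show "t < Suc T" "i < I" "fam_lits n \<noteq> []" "length (fam_lits n) \<le> clause_width M"
    using good assms by (auto simp: good_family_def wf_family_def f fam_lits_def I_def tb_def ib_def)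
  show "\<kappa> < codes M \<and> val tp (fam_env n t i) < Suc T \<and> val ip (fam_env n t i) < I"
    if "(sg, \<kappa>, tp, ip) \<in> set (fam_lits n)"
    using good assms that by (fastforce simp: good_family_def wf_family_def f fam_lits_def fam_env_def I_def tb_def ib_def)
qed

lemma in_fam_clauses:
  "c \<in> set (fam_clauses n) \<longleftrightarrow> (\<exists>t i. c = idx n t i \<and> t < tb n \<and>
     i < ib n \<and> guard x (fst (fams ! n)) i)"
  unfolding fam_clauses_def by (auto split: if_splits) (blast, force)

lemma fam_clause_less: "n < length fams \<Longrightarrow> c \<in> set (fam_clauses n) \<Longrightarrow> c < pos_clauses"
  unfolding in_fam_clauses pos_clauses_def using fam_good(1,2) idx_less by blast

lemma clause_var_fam:
  assumes "n < length fams" "t < tb n"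
    "i < ib n"
  shows "clause_var (idx n t i) l = lit_var (fam_env n t i) (fam_lit n l)"
proof -
  note g = fam_good(1,2)[OF assms]
  have "idx n t i < pos_clauses" unfolding pos_clauses_def by (rule idx_less[OF assms(1) g])
  then show ?thesis by (simp add: clause_var_def idx_decode[OF g] del: mult_Suc_right)
qed

lemma fam_lits_min: "fam_lits n \<noteq> [] \<Longrightarrow> fam_lit n l \<in> set (fam_lits n)"
  unfolding fam_lit_def by (intro nth_mem) (cases "fam_lits n"; auto)

sublocale cnf: monotone_cnf nvars "pos_clauses + atoms" pos_clauses "clause_width M" "set clauses" clause_var
proof
  show "0 < clause_width M" by (simp add: clause_width_def)
  show "set clauses \<subseteq> {..<pos_clauses + atoms}"
    using fam_clause_less by (fastforce simp: clauses_def)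
  show "clause_var c l < nvars" if c: "c \<in> set clauses" for c l
  proof (cases "c < pos_clauses")
    case True
    then obtain n t i where n: "n < length fams" "c = idx n t i"
        "t < tb n" "i < ib n"
      using c by (auto simp: clauses_def in_fam_clauses)
    obtain sg \<kappa> tp ip where l: "fam_lit n l = (sg, \<kappa>, tp, ip)"
      by (metis prod_cases4)
    have "(sg, \<kappa>, tp, ip) \<in> set (fam_lits n)"
      using fam_lits_min[OF fam_good(3)[OF n(1,3,4)], of l] by (simp only: l)
    from fam_good(5)[OF n(1,3,4) this] have "idx \<kappa> (val tp (fam_env n t i)) (val ip (fam_env n t i)) < atoms"
      unfolding atoms_def by (intro idx_less) auto
    then show ?thesis using clause_var_fam[OF n(1,3,4), of l] by (simp add: n(2) l nvars_def)
  next
    case False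
    then have "c - pos_clauses < atoms" using c fam_clause_less by (auto simp: clauses_def)
    then show ?thesis using False by (simp add: clause_var_def nvars_def)
  qed
qed

text \<open>Reading off the even variables is enough: if the variable of a negated literal is true,
  the negative clause of the atom makes the even one false.\<close>

lemma sat_imp_models:
  assumes sat: "cnf.sat \<alpha>" and f: "f \<in> set fams"
  shows "models x (\<lambda>\<kappa> t i. \<alpha> (2 * idx \<kappa> t i)) f"
proof -
  obtain n where n: "n < length fams" "f = fams ! n" using f by (metis in_set_conv_nth)
  obtain g bt bi ls where fn: "fams ! n = (g, bt, bi, ls)" by (metis prod_cases4)
  have "\<exists>l \<in> set ls. lit_true (\<lambda>\<kappa> t i. \<alpha> (2 * idx \<kappa> t i))
      (loop_env x (val bt (input_env x)) (val bi (input_env x)) t i) l"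
    if t: "t < val bt (input_env x)" and i: "i < val bi (input_env x)" and g: "guard x g i" for t i
  proof -
    have ti: "t < tb n" "i < ib n"
      using t i by (simp_all add: fn tb_def ib_def)
    have c: "idx n t i \<in> set (fam_clauses n)" unfolding in_fam_clauses using ti g by (auto simp: fn)
    then have "idx n t i \<in> set clauses" using n(1) by (auto simp: clauses_def)
    then obtain l where l: "\<alpha> (clause_var (idx n t i) l)"
      using sat fam_clause_less[OF n(1) c] by (auto simp: cnf.sat_def)
    obtain sg \<kappa> tp ip where lit: "fam_lit n l = (sg, \<kappa>, tp, ip)"
      by (metis prod_cases4)
    have mem: "(sg, \<kappa>, tp, ip) \<in> set (fam_lits n)"
      using fam_lits_min[OF fam_good(3)[OF n(1) ti], of l] by (simp only: lit)
    let ?a = "idx \<kappa> (val tp (fam_env n t i)) (val ip (fam_env n t i))"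
    have true: "\<alpha> (2 * ?a + (if sg then 0 else 1))"
      using l clause_var_fam[OF n(1) ti, of l] by (simp add: lit)
    have "\<alpha> (2 * ?a) = sg"
    proof (cases sg)
      case True
      then show ?thesis using true by simp
    next
      case False
      have "?a < atoms"
        unfolding atoms_def using fam_good(5)[OF n(1) ti mem] by (intro idx_less) auto
      then have "pos_clauses + ?a \<in> set clauses" by (auto simp: clauses_def)
      then obtain l' where "\<not> \<alpha> (clause_var (pos_clauses + ?a) l')"
        using sat by (fastforce simp: cnf.sat_def)
      then have "\<not> \<alpha> (2 * ?a) \<or> \<not> \<alpha> (2 * ?a + 1)" by (auto simp: clause_var_def split: if_splits)
      then show ?thesis using False true by simp
    qed
    then have "lit_true (\<lambda>\<kappa> t i. \<alpha> (2 * idx \<kappa> t i))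
        (loop_env x (val bt (input_env x)) (val bi (input_env x)) t i) (sg, \<kappa>, tp, ip)"
      by (simp add: fam_env_def fn tb_def ib_def)
    then show ?thesis by (rule bexI) (use mem in \<open>simp add: fam_lits_def fn\<close>)
  qed
  then show ?thesis by (simp add: n(2) fn)
qed

lemma models_imp_sat:
  assumes models: "\<And>f. f \<in> set fams \<Longrightarrow> models x \<beta> f"
  shows "\<exists>\<alpha>. cnf.sat \<alpha>"
proof -
  \<comment> \<open>Even variables get the value of their atom, odd ones the opposite value.\<close>
  define \<alpha> where "\<alpha> v \<longleftrightarrow> even v = \<beta> (v div 2 div I div Suc T) (v div 2 div I mod Suc T) (v div 2 mod I)" for v
  have \<alpha>: "\<alpha> (2 * idx \<kappa> t i + (if sg then 0 else 1)) \<longleftrightarrow> \<beta> \<kappa> t i = sg" if "t < Suc T" "i < I" for \<kappa> t i sg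
    using idx_decode[OF that, of \<kappa>] by (simp add: \<alpha>_def del: mult_Suc_right)
  have "cnf.sat \<alpha>"
    unfolding cnf.sat_def
  proof
    fix c assume c: "c \<in> set clauses"
    show "\<exists>l<clause_width M. \<alpha> (clause_var c l) \<longleftrightarrow> c < pos_clauses"
    proof (cases "c < pos_clauses")
      case True
      then obtain n t i where n: "n < length fams" "c = idx n t i"
          "t < tb n" "i < ib n"
          "guard x (fst (fams ! n)) i"
        using c by (auto simp: clauses_def in_fam_clauses)
      obtain g bt bi ls where fn: "fams ! n = (g, bt, bi, ls)" by (metis prod_cases4)
      have "models x \<beta> (g, bt, bi, ls)" using models[of "fams ! n"] nth_mem[OF n(1)] by (simp only: fn)
      from modelsD[OF this, of t i] n obtain lit where lit: "lit \<in> set ls"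
        "lit_true \<beta> (fam_env n t i) lit" by (auto simp: fn fam_env_def tb_def ib_def)
      obtain l where l: "l < length ls" "ls ! l = lit" using lit(1) by (metis in_set_conv_nth)
      obtain sg \<kappa> tp ip where lit_eq: "lit = (sg, \<kappa>, tp, ip)" by (metis prod_cases4)
      have lw: "l < clause_width M" using fam_good(4)[OF n(1,3,4)] l(1) by (simp add: fam_lits_def fn)
      have "min l (length ls - 1) = l" using l(1) by simp
      then have "clause_var c l = lit_var (fam_env n t i) lit"
        using clause_var_fam[OF n(1,3,4), of l] l(2) by (simp add: n(2) fam_lit_def fam_lits_def fn)
      moreover have "\<alpha> (lit_var (fam_env n t i) lit)"
        unfolding lit_eq lit_var.simps
        using fam_good(5)[OF n(1,3,4), of sg \<kappa> tp ip] lit by (subst \<alpha>) (auto simp: fam_lits_def fn lit_eq)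
      ultimately show ?thesis using True lw by auto
    next
      case False
      define a where "a = c - pos_clauses"
      have "clause_var c 0 = 2 * a" "clause_var c 1 = 2 * a + 1" using False by (simp_all add: clause_var_def a_def)
      moreover have "\<alpha> (2 * a + 1) \<longleftrightarrow> \<not> \<alpha> (2 * a)" by (simp add: \<alpha>_def)
      moreover have w: "0 < clause_width M" "1 < clause_width M" by (simp_all add: clause_width_def)
      ultimately have "\<not> \<alpha> (clause_var c 0) \<or> \<not> \<alpha> (clause_var c 1)" by simp
      then show ?thesis using False w by blast
    qed
  qed
  then show ?thesis by blast
qed

text \<open>A clause listed twice would repeat its edges, which an encoded instance must not
  do.\<close>

lemma distinct_clauses: "distinct clauses"
proof -
  have inj: "n = n' \<and> t = t' \<and> i = i'"
    if "idx n t i = idx n' t' i'" "t < Suc T" "i < I" "t' < Suc T" "i' < I" for n t i n' t' i'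
    using idx_decode[OF that(2,3), of n] idx_decode[OF that(4,5), of n'] unfolding that(1) by simp
  have 1: "distinct (fam_clauses n)" if n: "n < length fams" for n
    unfolding fam_clauses_def
  proof (intro distinct_concat_map)
    let ?L = "\<lambda>t. concat (map (\<lambda>i. if guard x (fst (fams ! n)) i then [idx n t i] else []) [0..<ib n])"
    have L: "\<exists>i<ib n. c = idx n t i" if "c \<in> set (?L t)" for c t
      using that by (auto split: if_splits)
    fix t t' assume t: "t \<in> set [0..<tb n]" "t' \<in> set [0..<tb n]" "t \<noteq> t'"
    have False if c: "c \<in> set (?L t)" "c \<in> set (?L t')" for c
    proof -
      obtain i i' where i: "i < ib n" "i' < ib n" "idx n t i = idx n t' i'" using L[OF c(1)] L[OF c(2)] by auto
      have "t < tb n" "t' < tb n" using t by auto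
      then show False
        using inj[OF i(3)] fam_good(1,2)[OF n _ i(1), of t] fam_good(1,2)[OF n _ i(2), of t'] t(3) by simp
    qed
    then show "set (?L t) \<inter> set (?L t') = {}" by blast
  next
    fix t i i' assume t: "t \<in> set [0..<tb n]" and i: "i \<in> set [0..<ib n]" "i' \<in> set [0..<ib n]" "i \<noteq> i'"
    then have "idx n t i \<noteq> idx n t i'"
      using inj[of n t i n t i'] fam_good(1,2)[OF n, of t i] fam_good(1,2)[OF n, of t i'] by auto
    then show "set (if guard x (fst (fams ! n)) i then [idx n t i] else []) \<inter>
        set (if guard x (fst (fams ! n)) i' then [idx n t i'] else []) = {}"
      by auto
  qed auto
  have 2: "set (fam_clauses n) \<inter> set (fam_clauses n') = {}"
    if n: "n < length fams" "n' < length fams" "n \<noteq> n'" for n n'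
  proof -
    have False if c: "c \<in> set (fam_clauses n)" "c \<in> set (fam_clauses n')" for c
    proof -
      obtain t i where i: "c = idx n t i" "t < tb n" "i < ib n" using c(1) unfolding in_fam_clauses by blast
      obtain t' i' where i': "c = idx n' t' i'" "t' < tb n'" "i' < ib n'" using c(2) unfolding in_fam_clauses by blast
      show False
        using inj[of n t i n' t' i'] fam_good(1,2)[OF n(1) i(2,3)] fam_good(1,2)[OF n(2) i'(2,3)] i(1) i'(1) n(3)
        by simp
    qed
    then show ?thesis by blast
  qed
  have "distinct (concat (map fam_clauses [0..<length fams]))"
    using 1 2 by (intro distinct_concat_map) auto
  moreover have "set (concat (map fam_clauses [0..<length fams])) \<inter> set (map ((+) pos_clauses) [0..<atoms]) = {}"
    using fam_clause_less by (auto dest!: fam_clause_less[rotated])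
  ultimately show ?thesis by (simp add: clauses_def distinct_map)
qed

section \<open>The printed instance\<close>

text \<open>These expressions contain no variable but \<open>0\<close>, so they keep their values
  inside all loops.\<close>

lemma val_consts:
  assumes "\<eta> 0 = length x"
  shows "val (times_exp Te) \<eta> = Suc T" "val (cells_exp Te Pe) \<eta> = I" "val (atoms_exp M Te Pe) \<eta> = atoms"
    "val (pos_clauses_exp M Te Pe) \<eta> = pos_clauses" "val (vars_exp M Te Pe) \<eta> = nvars"
    "val (fill_exp M Te Pe) \<eta> = cnf.fil" "val (stacks_exp M Te Pe) \<eta> = cnf.s"
    "val (pages_exp M Te Pe) \<eta> = cnf.k" "val (rad_exp M Te Pe) \<eta> = cnf.rad"
proof -
  have "val p \<eta> = val p (input_env x)" if "below 1 p" for p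
    using that by (rule val_cong) (simp add: assms)
  from this[OF below5(4)] this[OF below(1)] have v: "val (width Te Pe) \<eta> = H" "val Te \<eta> = T" by simp_all
  show t: "val (times_exp Te) \<eta> = Suc T" and c: "val (cells_exp Te Pe) \<eta> = I"
    by (simp_all add: times_exp_def cells_exp_def v I_def)
  show a: "val (atoms_exp M Te Pe) \<eta> = atoms" and p: "val (pos_clauses_exp M Te Pe) \<eta> = pos_clauses"
    by (simp_all add: atoms_exp_def pos_clauses_exp_def atoms_def pos_clauses_def t c)
  show w: "val (vars_exp M Te Pe) \<eta> = nvars" by (simp add: vars_exp_def a nvars_def)
  show f: "val (fill_exp M Te Pe) \<eta> = cnf.fil" by (simp add: fill_exp_def cnf.fil_def a p)
  show s: "val (stacks_exp M Te Pe) \<eta> = cnf.s" by (simp add: stacks_exp_def cnf.s_def f)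
  show k: "val (pages_exp M Te Pe) \<eta> = cnf.k" by (simp add: pages_exp_def cnf.k_def s w)
  show "val (rad_exp M Te Pe) \<eta> = cnf.rad" by (simp add: rad_exp_def cnf.rad_def k)
qed

lemma val_pos_exp:
  "\<eta> 0 = length x \<Longrightarrow> val (pos_exp (rad_exp M Te Pe) (r, a, b, c, d)) \<eta> =
    pos cnf.rad (val r \<eta>, val a \<eta>, val b \<eta>, val c \<eta>, val d \<eta>)"
  by (simp add: val_consts)

lemma sem_frame_em: "sem edge_leaf x 1 (frame_em M Te Pe) (input_env x) = map cnf.place cnf.frame_tags"
  by (simp add: frame_em_def Let_def edge_leaf_def cnf.frame_tags_def cnf.place_def map_concat comp_def
      val_pos_exp val_consts eval_nat_numeral del: upt_Suc pos_exp.simps pos.simps)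

lemma sem_clause_em:
  assumes "\<eta> 0 = length x" "0 < d" "below d c" "\<And>l. l < clause_width M \<Longrightarrow> below d (v l)"
    and "val c \<eta> = C" "\<And>l. l < clause_width M \<Longrightarrow> val (v l) \<eta> = clause_var C l"
    and "sg = (if C < pos_clauses then 1 else 0)"
  shows "sem edge_leaf x d (clause_em M Te Pe d sg c v) \<eta> = map cnf.place (cnf.clause_tags C)"
proof -
  have c: "val c (\<eta>(d := a, Suc d := b, Suc (Suc d) := a', Suc (Suc (Suc d)) := b')) = C" for a b a' b'
  proof -
    have "val c (\<eta>(d := a, Suc d := b, Suc (Suc d) := a', Suc (Suc (Suc d)) := b')) = val c \<eta>"
      by (rule val_cong[OF assms(3)]) auto
    then show ?thesis using assms(5) by simp
  qed
  have "sem edge_leaf x d (Leaf (map (\<lambda>l. (pos_exp (rad_exp M Te Pe) (Const 1, v l, Const sg, c, Const l),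
        pos_exp (rad_exp M Te Pe) (Const 2, c, Const 1, v l, Const l))) [0..<clause_width M])) \<eta> =
      map cnf.place (map (Wire C) [0..<clause_width M])"
    using assms by (simp add: edge_leaf_def cnf.place_def val_pos_exp del: pos_exp.simps pos.simps)
  moreover have "sem edge_leaf x d (Rep (fill_exp M Te Pe) (Rep (Add (pages_exp M Te Pe) (Const 1)) (Leaf
            [(pos_exp (rad_exp M Te Pe) (Const 2, c, Const 0, Var d, Var (d + 2)),
              pos_exp (rad_exp M Te Pe) (Const 2, c, Const 2, Var d, Var (d + 3)))]))) \<eta> =
      map cnf.place (concat (map (\<lambda>i. concat (map (\<lambda>j. [Fill C i j]) [0..<Suc cnf.k])) [0..<cnf.fil]))"
    using assms(1,2) c
    by (simp add: edge_leaf_def cnf.place_def map_concat comp_def val_pos_exp val_consts eval_nat_numeral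
        del: upt_Suc pos_exp.simps pos.simps)
  ultimately show ?thesis
    unfolding clause_em_def Let_def cnf.clause_tags_def sem.simps(2) map_append by (simp only:)
qed

lemma val_index_exp:
  "\<eta> 0 = length x \<Longrightarrow> val (index_exp Te Pe n tp ip) \<eta> = idx n (val tp \<eta>) (val ip \<eta>)"
  by (simp add: index_exp_def idx_def val_consts del: mult_Suc_right)

lemma val_lit_exp: "\<eta> 0 = length x \<Longrightarrow> val (lit_exp Te Pe l) \<eta> = lit_var \<eta> l"
  by (cases l) (simp add: val_index_exp)

lemma sem_family_em:
  assumes n: "n < length fams"
  shows "sem edge_leaf x 1 (family_em M Te Pe n (fams ! n)) (input_env x) =
    map cnf.place (concat (map cnf.clause_tags (fam_clauses n)))"
proof -
  obtain g bt bi ls where fn: "fams ! n = (g, bt, bi, ls)" by (metis prod_cases4)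
  have wf: "wf_family M (g, bt, bi, ls)"
    using good_families[OF nth_mem[OF n]] by (simp add: fn good_family_def)
  have bounds: "val bt (input_env x) = tb n" "val bi (input_env x) = ib n" by (simp_all add: tb_def ib_def fn)
  let ?e = "clause_em M Te Pe 5 1 (index_exp Te Pe n (Var 1) (Var 3))
      (\<lambda>l. lit_exp Te Pe (ls ! min l (length ls - 1)))"
  let ?ge = "case g of None \<Rightarrow> ?e | Some b \<Rightarrow> if b then If_Bit 3 ?e (Leaf []) else If_Bit 3 (Leaf []) ?e"
  let ?env = "\<lambda>t i. (input_env x)(1 := t, Suc 1 := tb n - Suc t, 3 := i, Suc 3 := ib n - Suc i)"
  have body: "sem edge_leaf x 5 ?ge (?env t i) =
      (if guard x g i then map cnf.place (cnf.clause_tags (idx n t i)) else [])"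
    if t: "t < tb n" and i: "i < ib n" for t i
  proof -
    note good = fam_good(1,2,3)[OF n t i]
    have env: "?env t i = fam_env n t i"
      by (simp add: fam_env_def loop_env_def eval_nat_numeral)
    have env0: "fam_env n t i 0 = length x" "fam_env n t i 1 = t" "fam_env n t i 3 = i" by (simp_all add: fam_env_def)
    have "sem edge_leaf x 5 ?e (fam_env n t i) = map cnf.place (cnf.clause_tags (idx n t i))"
    proof (rule sem_clause_em)
      show "below 5 (index_exp Te Pe n (Var 1) (Var 3))"
        using below_exps[OF below, of 5] by (simp add: index_exp_def)
      show "val (index_exp Te Pe n (Var 1) (Var 3)) (fam_env n t i) = idx n t i"
        using env0 by (simp add: val_index_exp)
      show "(1 :: nat) = (if idx n t i < pos_clauses then 1 else 0)"
        unfolding pos_clauses_def using idx_less[OF n good(1,2)] by simp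
      fix l
      have l: "ls ! min l (length ls - 1) = fam_lit n l" by (simp add: fam_lit_def fam_lits_def fn)
      show "val (lit_exp Te Pe (ls ! min l (length ls - 1))) (fam_env n t i) = clause_var (idx n t i) l"
        unfolding l using env0 by (simp add: val_lit_exp clause_var_fam[OF n t i])
      have "fam_lit n l \<in> set ls" using fam_lits_min[OF good(3)] by (simp add: fam_lits_def fn)
      then show "below 5 (lit_exp Te Pe (ls ! min l (length ls - 1)))"
        unfolding l using wf below_exps[OF below, of 5]
        by (cases "fam_lit n l") (auto simp: wf_family_def index_exp_def)
    qed (use env0 in auto)
    then show ?thesis
      unfolding env using env0(3) by (auto simp: guard_def edge_leaf_def split: option.split)
  qed
  have bi: "val bi ((input_env x)(1 := t, Suc 1 := b)) = ib n" for t b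
  proof -
    have "val bi ((input_env x)(1 := t, Suc 1 := b)) = val bi (input_env x)"
      using wf by (intro val_cong[of 1]) (auto simp: wf_family_def)
    then show ?thesis by (simp only: bounds)
  qed
  have lev: "1 + 2 = (3 :: nat)" "3 + 2 = (5 :: nat)" by simp_all
  have "sem edge_leaf x 1 (family_em M Te Pe n (fams ! n)) (input_env x) =
      concat (map (\<lambda>t. concat (map (\<lambda>i. sem edge_leaf x 5 ?ge (?env t i)) [0..<ib n])) [0..<tb n])"
    unfolding fn family_em.simps Let_def sem.simps(3) bounds bi lev ..
  also have "\<dots> = concat (map (\<lambda>t. concat (map (\<lambda>i.
      if guard x g i then map cnf.place (cnf.clause_tags (idx n t i)) else []) [0..<ib n])) [0..<tb n])"
    using body by (intro arg_cong[of _ _ concat] map_cong refl) auto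
  also have "\<dots> = map cnf.place (concat (map cnf.clause_tags (fam_clauses n)))"
    unfolding fam_clauses_def fn fst_conv map_concat map_map comp_def concat_concat
    by (intro arg_cong[of _ _ concat] map_cong refl) auto
  finally show ?thesis .
qed

lemma sem_edges_em:
  "sem edge_leaf x 1 (edges_em M Te Pe) (input_env x) =
    map cnf.place (cnf.frame_tags @ concat (map cnf.clause_tags clauses))"
proof -
  have fold: "sem edge_leaf x 1 (foldr (\<lambda>n. Cat (h n)) ns (Leaf [])) \<eta> =
      concat (map (\<lambda>n. sem edge_leaf x 1 (h n) \<eta>) ns)" for h ns \<eta>
    by (induction ns) (simp_all add: edge_leaf_def)
  have pos: "sem edge_leaf x 1 (foldr (\<lambda>n. Cat (family_em M Te Pe n (fams ! n))) [0..<length fams] (Leaf []))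
      (input_env x) = map cnf.place (concat (map cnf.clause_tags (concat (map fam_clauses [0..<length fams]))))"
    unfolding fold map_concat map_map comp_def concat_concat
    using sem_family_em by (intro arg_cong[of _ _ concat] map_cong refl) (simp add: map_concat comp_def)
  have lev: "1 + 2 = (3 :: nat)" by simp
  let ?c = "clause_em M Te Pe 3 0 (Add (pos_clauses_exp M Te Pe) (Var 1))
      (\<lambda>l. if l = 0 then Mul (Const 2) (Var 1) else Add (Mul (Const 2) (Var 1)) (Const 1))"
  have "sem edge_leaf x 3 ?c ((input_env x)(1 := a, Suc 1 := b)) =
      map cnf.place (cnf.clause_tags (pos_clauses + a))" for a b
    using below_exps[OF below, of 3]
    by (intro sem_clause_em) (auto simp: val_consts clause_var_def)
  then have neg: "sem edge_leaf x 1 (Rep (atoms_exp M Te Pe) ?c) (input_env x) =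
      map cnf.place (concat (map cnf.clause_tags (map ((+) pos_clauses) [0..<atoms])))"
    unfolding sem.simps(3) lev by (simp add: val_consts map_concat comp_def)
  show ?thesis
    unfolding edges_em_def sem.simps(2) sem_frame_em pos neg clauses_def by simp
qed

theorem instance_em_correct:
  "sem leaves_out x 1 (instance_em M Te Pe) (input_env x) \<in> mixed_page_problem \<longleftrightarrow>
    (\<exists>u. length u \<le> P \<and> R x u)"
proof -
  have "sem leaves_out x 1 (instance_em M Te Pe) (input_env x) =
      enc_instance (map ((^) 2) [0..<4 * cnf.rad * cnf.rad * cnf.rad * cnf.rad])
        (map (\<lambda>t. (2 ^ fst (cnf.place t), 2 ^ snd (cnf.place t)))
          (cnf.frame_tags @ concat (map cnf.clause_tags clauses))) cnf.k"
    unfolding sem_instance_em sem_edges_em map_map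
    by (simp add: val_consts comp_def case_prod_unfold)
  then have "sem leaves_out x 1 (instance_em M Te Pe) (input_env x) \<in> mixed_page_problem \<longleftrightarrow> (\<exists>\<alpha>. cnf.sat \<alpha>)"
    using cnf.enc_instance_iff_sat[OF distinct_clauses refl] by simp
  also have "\<dots> \<longleftrightarrow> (\<exists>\<beta>. \<forall>f \<in> set fams. models x \<beta> f)"
    using sat_imp_models models_imp_sat by blast
  finally show ?thesis using satisfiable_iff by simp
qed

end

section \<open>Reducing an arbitrary problem in NP\<close>

text \<open>The Horner scheme, turning the bounds on time and certificate length into expressions
  that the program can evaluate.\<close>

definition poly_exp :: "nat poly \<Rightarrow> pexp \<Rightarrow> pexp" where
  "poly_exp p e = fold_coeffs (\<lambda>a q. Add (Const a) (Mul e q)) p (Const 0)"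

lemma poly_exp: "val (poly_exp p e) \<eta> = poly p (val e \<eta>)" "below d e \<Longrightarrow> below d (poly_exp p e)"
proof -
  have "val (foldr (\<lambda>a q. Add (Const a) (Mul e q)) xs (Const 0)) \<eta> = foldr (\<lambda>a b. a + val e \<eta> * b) xs 0" for xs
    by (induction xs) auto
  then show "val (poly_exp p e) \<eta> = poly p (val e \<eta>)"
    by (simp add: poly_exp_def fold_coeffs_def poly_def horner_sum_foldr comp_def)
  have "below d (foldr (\<lambda>a q. Add (Const a) (Mul e q)) xs (Const 0))" if "below d e" for xs
    using that by (induction xs) auto
  then show "below d e \<Longrightarrow> below d (poly_exp p e)" by (simp add: poly_exp_def fold_coeffs_def)
qed

lemma tm_computes_mono:
  assumes "tm_computes M xs y t" "t \<le> t'"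
  shows "tm_computes M xs y t'"
proof -
  obtain ts where ts: "(tm_step M ^^ t) (tm_init M xs) = (tm_states M, ts)" "fst (ts ! 0) = contents y"
    using assms(1) by (auto simp: tm_computes_def)
  have "t' = (t' - t) + t" using assms(2) by simp
  then have "(tm_step M ^^ t') (tm_init M xs) = (tm_states M, ts)"
    by (metis comp_apply funpow_add tm_steps_halted ts(1))
  then show ?thesis using ts(2) by (simp add: tm_computes_def)
qed

theorem theorem2:
  shows "NP_hard mixed_page_problem"
  unfolding NP_hard_def
proof
  fix A assume "A \<in> NP"
  then obtain R and p :: "nat poly" where R: "polytime 2 (\<lambda>xs. [R (xs ! 0) (xs ! 1)])"
      and A: "\<And>x. x \<in> A \<longleftrightarrow> (\<exists>u. length u \<le> poly p (length x) \<and> R x u)"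
    unfolding NP_def mem_Collect_eq by (elim exE conjE) (erule that, simp)
  from R obtain M and p' :: "nat poly" where MR: "wf_tm M \<and> 2 \<le> tm_tapes M \<and> (\<forall>xs. length xs = 2 \<longrightarrow>
        tm_computes M xs [R (xs ! 0) (xs ! 1)] (poly p' (sum_list (map length xs))))"
    unfolding polytime_def by (elim exE)
  then have M: "wf_tm M" "2 \<le> tm_tapes M" by simp_all
  have comp: "tm_computes M [x, u] [R x u] (poly p' (length x + length u))" for x u
    using MR[THEN conjunct2, THEN conjunct2, rule_format, of "[x, u]"] by simp
  define Pe where "Pe = poly_exp p (Var 0)"
  \<comment> \<open>The running time for a certificate of maximal length; shorter ones are covered
    since polynomials with natural coefficients are monotone.\<close>
  define Te where "Te = poly_exp p' (Add (Var 0) Pe)"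
  have Pe: "below 1 Pe" "val Pe (input_env x) = poly p (length x)" for x
    by (simp_all add: Pe_def poly_exp)
  have Te: "below 1 Te" "val Te (input_env x) = poly p' (length x + poly p (length x))" for x
    using Pe by (simp_all add: Te_def poly_exp)
  have ver: "verifier M R x Te Pe" for x
  proof
    fix u :: "bool list" assume "length u \<le> val Pe (input_env x)"
    then have "poly p' (length x + length u) \<le> val Te (input_env x)"
      unfolding Pe Te by (intro poly_mono_nat) simp
    then show "tm_computes M [x, u] [R x u] (val Te (input_env x))"
      by (rule tm_computes_mono[OF comp])
  qed (rule M Pe Te)+
  define f where "f x = sem leaves_out x 1 (instance_em M Te Pe) (input_env x)" for x
  have fam: "wf_family M g" if "g \<in> set (families M Te Pe)" for g
  proof -
    \<comment> \<open>\<open>wf_family\<close> does not refer to the input, so any word can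
      instantiate the locale.\<close>
    interpret verifier M R "[]" Te Pe by (rule ver)
    show ?thesis using good_families[OF that] by (cases g) (simp add: good_family_def)
  qed
  have "polytime 1 (\<lambda>xs. f (xs ! 0))"
    unfolding f_def by (rule polytime_em[OF wf_instance_em[OF Te(1) Pe(1) fam]])
  moreover have "x \<in> A \<longleftrightarrow> f x \<in> mixed_page_problem" for x
  proof -
    interpret verifier M R x Te Pe by (rule ver)
    show ?thesis using instance_em_correct by (simp only: f_def A P_def Pe)
  qed
  ultimately show "polytime_reducible A mixed_page_problem"
    unfolding polytime_reducible_def by blast
qed

end
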